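(* Let $n>6$ be an integer and let $A=\{2i+1 : 0\le i<n\}\subseteq[2n]$. Then the sparse paving positroid corresponding to the $\mathsf{Le}$-diagram $D_{n+1,2n}(A)$ is transversal and does not have a noncrossing minimal presentation.
   Context: $[m]=\{1,\dots,m\}$. **Diagrams.** Young diagrams are left-justified with the largest part on top; box $(i,j)$ is in row $i$ (increasing downward) and column $j$ (increasing to the right). A $\mathsf{Le}$-diagram is a filling of a Young diagram in which each box is either empty or contains $\bullet$, such that for $i<i'$ and $j<j'$: if box $(i',j')$ exists and boxes $(i,j')$ and $(i',j)$ both contain $\bullet$, then $(i',j')$ contains $\bullet$. **The diagrams $D_{k,m}(A)$** ($2\le k\le m-2$). $D_{k,m}$ is the $k\times(m-k)$ rectangle with every box containing $\bullet$. Label $m$ of the boxes along its boundary as follows: the box in the lower right corner is labeled $1$; the boxes of the top row are labeled, from right to left, $2,3,\dots,m-k+1$; the boxes of the leftmost column are labeled, from top to bottom, $m-k+1,m-k+2,\dots,m$. For $A\subseteq[m]$, $D_{k,m}(A)$ is obtained from $D_{k,m}$ by removing the $\bullet$ in the box labeled $i$ for each $i\in A$; when $1\in A$, the box labeled $1$ is itself also removed from the Young diagram. Each $D_{k,m}(A)$ is a $\mathsf{Le}$-diagram. **Positroid associated with a $\mathsf{Le}$-diagram $D$ in a $k\times(m-k)$ box.** The southeast border of $D$ inside the box (together, where needed, with parts of the top and left sides of the box) is a lattice path from the top right corner to the bottom left corner of the box. Place a boundary vertex on each of its $m$ steps, labeled $1,\dots,m$ in order starting from the top right. Vertical steps are sources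 (one for each row), horizontal steps are sinks (one for each column). Each $\bullet$ is an internal vertex. From each source or internal vertex, a directed edge is drawn leftward to the nearest internal vertex to the left in the same row, if there is one; it carries a positive real weight. From each internal vertex a directed edge of weight $1$ is drawn downward to the nearest internal vertex below it in the same column, or to the sink of that column if there is none. Call this network $N_D$. With $K$ the set of sources, $\operatorname{Meas}(N_D)$ is the $K\times[m]$ matrix with entries $\operatorname{Meas}(N_D)_{ij}=\sum_{P:i\rightsquigarrow j}(-1)^{s_{ij}}\prod_{e\in P}w_e$, the sum being over directed paths from $i$ to $j$ (the empty path gives $\operatorname{Meas}(N_D)_{ii}=1$), where $w_e$ is the weight of $e$ and $s_{ij}$ is the number of sources strictly between $i$ and $j$. The positroid associated with $D$ is the matroid on $[m]$ whose bases are the $k$-subsets indexing nonvanishing maximal minors of $\operatorname{Meas}(N_D)$; it does not depend on the choice of positive weights. **Sparse paving.** A rank $k$ matroid on $E$ is sparse paving if every $k$-element subset of $E$ is either a basis or a circuit-hyperplane (both a circuit and a hyperplane). It is a known result that for $2\le k\le m-2$ the positroid associated with $D_{k,m}(A)$ is sparse paving if and only if $A$ contains no two cyclically consecutive elements modulo $m$, and in that case its circuit-hyperplanes are exactly the cyclic intervals $\{i,i+1,\dots,i+k-1\}$ (modulo $m$) for $i\in A$. **Transversal matroids.** A set system $(S_1,\dots,S_k)$ is a family of subsets of $E$, repetitions allowed, considered up to reordering. A transversal is a set $I\subseteq E$ with a bijection $\phi:[k]\to I$ such that $\phi(j)\in S_j$ for all $j$. All set systems are assumed to have a transversal. $M[(S_1,\dots,S_k)]$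 is the matroid whose bases are the transversals; such a matroid is called transversal and $(S_1,\dots,S_k)$ is a presentation of it (presentations of rank $k$ matroids always use exactly $k$ sets). A presentation $(S_1,\dots,S_k)$ is minimal if whenever $(S'_1,\dots,S'_k)$ is a presentation of the same matroid with, after some reordering, $S'_i\subseteq S_i$ for all $i$, then the two set systems are equal. **Noncrossing.** For $a\in[m]$, let $<_a$ be the total order $a<_a a+1<_a\cdots<_a m<_a 1<_a\cdots<_a a-1$. For $S,T\subseteq[m]$, $S$ crosses $T$ if there are $a,b,c,d\in[m]$ with $a<_a b<_a c<_a d$, $a,c\in S$, $a,c\notin T$, $b,d\in T$, and $b\notin S$. A set system is crossing if $S_i$ crosses $S_j$ for some $i,j$, and noncrossing otherwise. *)

theory Defs
  imports Complex_Main "Jordan_Normal_Form.Determinant"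
begin

section \<open>Fillings of Young diagrams and the diagrams \<open>D\<^sub>k\<^sub>,\<^sub>m(A)\<close>\<close>

text \<open>Box \<open>(i, j)\<close> lies in row \<open>i\<close> (downward) and column \<open>j\<close> (to the right), both starting from 1.
  A filling is a Young diagram together with the set of its boxes that contain a dot.\<close>

record filling =
  boxes :: "(nat \<times> nat) set"
  dots :: "(nat \<times> nat) set"

definition young_diagram :: "nat \<Rightarrow> nat \<Rightarrow> (nat \<times> nat) set \<Rightarrow> bool" where
  "young_diagram k c Y \<longleftrightarrow> Y \<subseteq> {1..k} \<times> {1..c} \<and>
     (\<forall>i j i' j'. (i', j') \<in> Y \<and> 1 \<le> i \<and> i \<le> i' \<and> 1 \<le> j \<and> j \<le> j' \<longrightarrow> (i, j) \<in> Y)"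

definition le_diagram :: "nat \<Rightarrow> nat \<Rightarrow> filling \<Rightarrow> bool" where
  "le_diagram k c D \<longleftrightarrow> young_diagram k c (boxes D) \<and> dots D \<subseteq> boxes D \<and>
     (\<forall>i i' j j'. i < i' \<and> j < j' \<and> (i', j') \<in> boxes D \<and> (i, j') \<in> dots D \<and> (i', j) \<in> dots D
        \<longrightarrow> (i', j') \<in> dots D)"

text \<open>The box of the \<open>k \<times> (m - k)\<close> rectangle with label \<open>l \<in> {1..m}\<close>.\<close>

definition labeled_box :: "nat \<Rightarrow> nat \<Rightarrow> nat \<Rightarrow> nat \<times> nat" where
  "labeled_box k m l =
     (if l = 1 then (k, m - k)
      else if l \<le> m - k + 1 then (1, m - k + 2 - l)
      else (l - (m - k), 1))"

definition D_boxes :: "nat \<Rightarrow> nat \<Rightarrow> nat set \<Rightarrow> (nat \<times> nat) set" where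
  "D_boxes k m A = {1..k} \<times> {1..m - k} - (if 1 \<in> A then {labeled_box k m 1} else {})"

definition D_diagram :: "nat \<Rightarrow> nat \<Rightarrow> nat set \<Rightarrow> filling" where
  "D_diagram k m A =
     \<lparr> boxes = D_boxes k m A, dots = {1..k} \<times> {1..m - k} - labeled_box k m ` A \<rparr>"

lemma le_diagram_D_diagram:
  assumes k: "2 \<le> k" and m: "k + 2 \<le> m" and A: "A \<subseteq> {1..m}"
  shows "le_diagram k (m - k) (D_diagram k m A)"
proof -
  have *: "l = 1" if "labeled_box k m l = (i, j)" "l \<in> A" "1 < i" "1 < j" for l i j
    using that by (auto simp: labeled_box_def split: if_splits)
  have corner: "i' = i \<and> j' = j"
    if "labeled_box k m 1 = (i, j)" "i \<le> i'" "j \<le> j'" "i' \<le> k" "j' \<le> m - k" for i j i' j'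
    using that by (auto simp: labeled_box_def)
  have "young_diagram k (m - k) (D_boxes k m A)"
    unfolding young_diagram_def D_boxes_def using corner
    by (auto split: if_splits) (metis Suc_le_eq One_nat_def)+
  moreover have "dots (D_diagram k m A) \<subseteq> boxes (D_diagram k m A)"
    by (auto simp: D_diagram_def D_boxes_def split: if_splits)
  moreover have "(i', j') \<in> dots (D_diagram k m A)"
    if "i < i'" "j < j'" "(i', j') \<in> boxes (D_diagram k m A)"
       "(i, j') \<in> dots (D_diagram k m A)" "(i', j) \<in> dots (D_diagram k m A)" for i i' j j'
  proof -
    have "1 < i'" "1 < j'"
      using that by (auto simp: D_diagram_def)
    with *[of _ i' j'] that(3) show ?thesis
      by (auto simp: D_diagram_def D_boxes_def split: if_splits)
  qed
  ultimately show ?thesis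
    unfolding le_diagram_def by (intro conjI allI impI) (simp add: D_diagram_def, blast+)
qed


section \<open>The network of a filling\<close>

text \<open>
  The southeast border is traversed from the top right to the bottom left corner of the
  \<open>k \<times> c\<close> box. The steps before the vertical step of row \<open>i\<close> are the \<open>i - 1\<close> vertical steps of the
  rows above and the horizontal steps of the columns to the right of the last box of row \<open>i\<close>; the
  steps before the horizontal step of column \<open>j\<close> are the vertical steps of the rows that have a box
  in column \<open>j\<close> and the \<open>c - j\<close> horizontal steps of the columns to the right.
\<close>

definition row_label :: "nat \<Rightarrow> filling \<Rightarrow> nat \<Rightarrow> nat" where
  "row_label c D i = i + (c - card {j. (i, j) \<in> boxes D})"

definition col_label :: "nat \<Rightarrow> filling \<Rightarrow> nat \<Rightarrow> nat" where
  "col_label c D j = card {i. (i, j) \<in> boxes D} + (c - j) + 1"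

definition sources :: "nat \<Rightarrow> nat \<Rightarrow> filling \<Rightarrow> nat set" where
  "sources k c D = row_label c D ` {1..k}"

datatype vertex = Boundary nat | Internal nat nat

definition left_edges :: "nat \<Rightarrow> nat \<Rightarrow> filling \<Rightarrow> (vertex \<times> vertex) set" where
  "left_edges k c D =
     {(Boundary (row_label c D i), Internal i j) | i j.
        i \<in> {1..k} \<and> (i, j) \<in> dots D \<and> (\<forall>j'. j < j' \<longrightarrow> (i, j') \<notin> dots D)} \<union>
     {(Internal i j', Internal i j) | i j j'.
        (i, j) \<in> dots D \<and> (i, j') \<in> dots D \<and> j < j' \<and>
        (\<forall>j''. j < j'' \<and> j'' < j' \<longrightarrow> (i, j'') \<notin> dots D)}"

definition down_edges :: "nat \<Rightarrow> filling \<Rightarrow> (vertex \<times> vertex) set" where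
  "down_edges c D =
     {(Internal i j, Internal i' j) | i i' j.
        (i, j) \<in> dots D \<and> (i', j) \<in> dots D \<and> i < i' \<and>
        (\<forall>i''. i < i'' \<and> i'' < i' \<longrightarrow> (i'', j) \<notin> dots D)} \<union>
     {(Internal i j, Boundary (col_label c D j)) | i j.
        (i, j) \<in> dots D \<and> (\<forall>i'. i < i' \<longrightarrow> (i', j) \<notin> dots D)}"

definition paths :: "nat \<Rightarrow> nat \<Rightarrow> filling \<Rightarrow> nat \<Rightarrow> nat \<Rightarrow> vertex list set" where
  "paths k c D i j =
     {p. p \<noteq> [] \<and> hd p = Boundary i \<and> last p = Boundary j \<and>
         successively (\<lambda>u v. (u, v) \<in> left_edges k c D \<union> down_edges c D) p}"

text \<open>Only the values of \<open>w\<close> on the leftward edges matter; downward edges have weight 1.\<close>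

definition edge_weight ::
  "nat \<Rightarrow> nat \<Rightarrow> filling \<Rightarrow> (vertex \<times> vertex \<Rightarrow> real) \<Rightarrow> vertex \<times> vertex \<Rightarrow> real" where
  "edge_weight k c D w e = (if e \<in> left_edges k c D then w e else 1)"

definition path_weight ::
  "nat \<Rightarrow> nat \<Rightarrow> filling \<Rightarrow> (vertex \<times> vertex \<Rightarrow> real) \<Rightarrow> vertex list \<Rightarrow> real" where
  "path_weight k c D w p = prod_list (map (edge_weight k c D w) (zip p (tl p)))"

text \<open>For a diagram in the \<open>k \<times> c\<close> box the network is acyclic and finite, so the sum over paths
  is finite.\<close>

definition Meas ::
  "nat \<Rightarrow> nat \<Rightarrow> filling \<Rightarrow> (vertex \<times> vertex \<Rightarrow> real) \<Rightarrow> nat \<Rightarrow> nat \<Rightarrow> real" where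
  "Meas k c D w i j =
     (\<Sum>p \<in> paths k c D i j.
        (- 1) ^ card {s \<in> sources k c D. min i j < s \<and> s < max i j} * path_weight k c D w p)"

definition Meas_submatrix ::
  "nat \<Rightarrow> nat \<Rightarrow> filling \<Rightarrow> (vertex \<times> vertex \<Rightarrow> real) \<Rightarrow> nat set \<Rightarrow> real mat" where
  "Meas_submatrix k c D w I =
     mat k k (\<lambda>(a, b). Meas k c D w (sorted_list_of_set (sources k c D) ! a)
                                     (sorted_list_of_set I ! b))"

text \<open>The bases of the positroid on \<open>{1..m}\<close> of a diagram in the \<open>k \<times> (m - k)\<close> box.\<close>

definition positroid_bases ::
  "nat \<Rightarrow> nat \<Rightarrow> filling \<Rightarrow> (vertex \<times> vertex \<Rightarrow> real) \<Rightarrow> nat set set" where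
  "positroid_bases k m D w =
     {I. I \<subseteq> {1..m} \<and> card I = k \<and> det (Meas_submatrix k (m - k) D w I) \<noteq> 0}"


section \<open>Matroids, given by a ground set \<open>E\<close> and a set of bases\<close>

definition matroid_bases :: "'a set \<Rightarrow> 'a set set \<Rightarrow> bool" where
  "matroid_bases E Bs \<longleftrightarrow> finite E \<and> Bs \<noteq> {} \<and> (\<forall>B \<in> Bs. B \<subseteq> E) \<and>
     (\<forall>B\<^sub>1 \<in> Bs. \<forall>B\<^sub>2 \<in> Bs. \<forall>x \<in> B\<^sub>1 - B\<^sub>2. \<exists>y \<in> B\<^sub>2 - B\<^sub>1. insert y (B\<^sub>1 - {x}) \<in> Bs)"

definition independent :: "'a set set \<Rightarrow> 'a set \<Rightarrow> bool" where
  "independent Bs X \<longleftrightarrow> (\<exists>B \<in> Bs. X \<subseteq> B)"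

definition rank_of :: "'a set set \<Rightarrow> 'a set \<Rightarrow> nat" where
  "rank_of Bs X = Max ((\<lambda>B. card (X \<inter> B)) ` Bs)"

definition circuit :: "'a set \<Rightarrow> 'a set set \<Rightarrow> 'a set \<Rightarrow> bool" where
  "circuit E Bs C \<longleftrightarrow> C \<subseteq> E \<and> \<not> independent Bs C \<and> (\<forall>X. X \<subset> C \<longrightarrow> independent Bs X)"

definition flat :: "'a set \<Rightarrow> 'a set set \<Rightarrow> 'a set \<Rightarrow> bool" where
  "flat E Bs F \<longleftrightarrow> F \<subseteq> E \<and> (\<forall>x \<in> E - F. rank_of Bs F < rank_of Bs (insert x F))"

definition hyperplane :: "'a set \<Rightarrow> 'a set set \<Rightarrow> 'a set \<Rightarrow> bool" where
  "hyperplane E Bs H \<longleftrightarrow> flat E Bs H \<and> rank_of Bs H + 1 = rank_of Bs E"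

definition sparse_paving :: "nat \<Rightarrow> 'a set \<Rightarrow> 'a set set \<Rightarrow> bool" where
  "sparse_paving k E Bs \<longleftrightarrow> matroid_bases E Bs \<and> (\<forall>B \<in> Bs. card B = k) \<and>
     (\<forall>X. X \<subseteq> E \<and> card X = k \<longrightarrow> X \<in> Bs \<or> (circuit E Bs X \<and> hyperplane E Bs X))"


section \<open>Transversal matroids\<close>

text \<open>Set systems are lists of sets; the order of the list is disregarded by comparing \<open>mset\<close>.\<close>

definition transversals :: "'a set list \<Rightarrow> 'a set set" where
  "transversals Ss =
     {I. \<exists>\<phi>. bij_betw \<phi> {..<length Ss} I \<and> (\<forall>j < length Ss. \<phi> j \<in> Ss ! j)}"

definition presentation :: "'a set \<Rightarrow> 'a set set \<Rightarrow> 'a set list \<Rightarrow> bool" where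
  "presentation E Bs Ss \<longleftrightarrow>
     (\<forall>S \<in> set Ss. S \<subseteq> E) \<and> transversals Ss \<noteq> {} \<and> transversals Ss = Bs"

definition transversal_matroid :: "'a set \<Rightarrow> 'a set set \<Rightarrow> bool" where
  "transversal_matroid E Bs \<longleftrightarrow> (\<exists>Ss. presentation E Bs Ss)"

definition minimal_presentation :: "'a set \<Rightarrow> 'a set set \<Rightarrow> 'a set list \<Rightarrow> bool" where
  "minimal_presentation E Bs Ss \<longleftrightarrow> presentation E Bs Ss \<and>
     (\<forall>Ss' Ts. presentation E Bs Ss' \<and> mset Ts = mset Ss' \<and> list_all2 (\<subseteq>) Ts Ss
        \<longrightarrow> mset Ss' = mset Ss)"


section \<open>Noncrossing set systems on \<open>{1..m}\<close>\<close>

text \<open>The order \<open>a < a+1 < \<dots> < m < 1 < \<dots> < a-1\<close>; on \<open>{1..m}\<close> it does not need \<open>m\<close>.\<close>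

definition cyc_less :: "nat \<Rightarrow> nat \<Rightarrow> nat \<Rightarrow> bool" where
  "cyc_less a x y \<longleftrightarrow> (a \<le> x \<and> x < y) \<or> (a \<le> x \<and> y < a) \<or> (x < y \<and> y < a)"

definition crosses :: "nat \<Rightarrow> nat set \<Rightarrow> nat set \<Rightarrow> bool" where
  "crosses m S T \<longleftrightarrow>
     (\<exists>a \<in> {1..m}. \<exists>b \<in> {1..m}. \<exists>c \<in> {1..m}. \<exists>d \<in> {1..m}.
        cyc_less a a b \<and> cyc_less a b c \<and> cyc_less a c d \<and>
        a \<in> S \<and> c \<in> S \<and> a \<notin> T \<and> c \<notin> T \<and> b \<in> T \<and> d \<in> T \<and> b \<notin> S)"

definition noncrossing :: "nat \<Rightarrow> nat set list \<Rightarrow> bool" where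
  "noncrossing m Ss \<longleftrightarrow> \<not> (\<exists>i < length Ss. \<exists>j < length Ss. crosses m (Ss ! i) (Ss ! j))"

end

theory Submission
  imports Defs
begin

text \<open>
  A maximal minor of \<open>Meas\<close> vanishes iff there is a nonzero potential on the network that is supported,
  at the sinks, on the columns of the minor and vanishes at the sources outside of it. Going down through
  the rows of the diagram, the number of sign blocks of the potential does not decrease, and it increases
  at every row whose source value is zero. So there are too many blocks for the support, unless a missing
  dot interferes; this happens only if the potential starts as a unit vector at a missing box, which
  forces the minor to be the cyclic interval that starts at the label of this box.

  Let \<open>C\<^sub>i\<close> be the complement of the circuit-hyperplane \<open>H\<^sub>i\<close>. By Hall's theorem, every presentation
  consists of the \<open>n\<close> sets \<open>C\<^sub>i\<close> and one more set \<open>S\<close>, and \<open>S\<close> is subject only to lower bounds on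
  \<open>|S|\<close>, \<open>|S - C\<^sub>i|\<close> and \<open>|S \<inter> H\<^sub>i \<inter> H\<^sub>i\<^sub>+\<^sub>2|\<close>. Counting shows that \<open>|S| = n\<close> if the presentation is
  minimal. If no \<open>C\<^sub>i\<close> crosses \<open>S\<close>, then every maximal run of \<open>S\<close> has at least \<open>n - 3 > n / 2\<close>
  elements, so \<open>S\<close> is a cyclic interval of length \<open>n\<close> and contains some \<open>C\<^sub>i\<close>, contradicting
  \<open>|S - C\<^sub>i| \<ge> 2\<close>.
\<close>

section \<open>Sign changes\<close>

text \<open>Row \<open>i\<close> turns the potential above it into the one below it by
  \<open>h j = g j - e j * g (j - 1)\<close> with nonnegative weights. The inverse of this
  bidiagonal matrix is totally nonnegative, which is why no sign block is lost on the way down; a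
  zero at the last dot of the row lets the last block spill over into a new block of the opposite
  sign. A minor has as many sink columns as there are sources outside of it, so one surplus block is
  already a contradiction. Two rows disturb the scheme: in the first row, edges may jump over empty
  boxes, so its step is not bidiagonal; in the last row, the removed corner interchanges the labels
  \<open>k\<close> and \<open>k + 1\<close> and shortens the row. The bounds on \<open>S\<close> are
  Hall's condition for \<open>S\<close> together with none, one or two neighbouring sets
  \<open>C i\<close>; all other subfamilies containing \<open>S\<close> satisfy it by size alone.
  The sets \<open>C i\<close> have \<open>n - 1\<close> elements but start only at every second
  point, so a window of \<open>n - 2\<close> points is sure to lie in one of them. Hence the runs of
  length \<open>n - 3\<close>, and \<open>n > 6\<close> is exactly
  \<open>2 (n - 3) > n\<close>.\<close>

fun last_sign :: "(nat \<Rightarrow> real) \<Rightarrow> nat \<Rightarrow> real" where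
  "last_sign g 0 = 0"
| "last_sign g (Suc j) = (if g (Suc j) = 0 then last_sign g j else sgn (g (Suc j)))"

text \<open>One more than the number of sign changes with zeros skipped, but 0 for the zero vector.
  Counting blocks instead of changes makes the size of the support an upper bound. The initial value
  0 of \<open>last_sign\<close> differs from every sign, so the first nonzero entry opens a
  block.\<close>

fun sign_blocks :: "(nat \<Rightarrow> real) \<Rightarrow> nat \<Rightarrow> nat" where
  "sign_blocks g 0 = 0"
| "sign_blocks g (Suc j) =
     (if g (Suc j) = 0 \<or> sgn (g (Suc j)) = last_sign g j then sign_blocks g j
      else Suc (sign_blocks g j))"

lemma last_sign_nonzero: "1 \<le> j \<Longrightarrow> g j \<noteq> 0 \<Longrightarrow> last_sign g j = sgn (g j)"
  by (cases j) auto

lemma last_sign_eq_0_iff: "last_sign g j = 0 \<longleftrightarrow> (\<forall>i\<in>{1..j}. g i = 0)"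
  by (induction j) (auto simp: sgn_zero_iff atLeastAtMostSuc_conv)

lemma sign_blocks_eq_0_iff: "sign_blocks g j = 0 \<longleftrightarrow> (\<forall>i\<in>{1..j}. g i = 0)"
proof (induction j)
  case (Suc j)
  then show ?case
    using last_sign_eq_0_iff[of g j] by (auto simp: sgn_zero_iff atLeastAtMostSuc_conv)
qed auto

lemma sign_blocks_mono: "i \<le> j \<Longrightarrow> sign_blocks g i \<le> sign_blocks g j"
  by (induction j) (auto simp: le_Suc_eq)

lemma last_sign_cong_sign_blocks:
  "i \<le> j \<Longrightarrow> sign_blocks g j = sign_blocks g i \<Longrightarrow> 0 < sign_blocks g i \<Longrightarrow> last_sign g j = last_sign g i"
proof (induction j)
  case (Suc j)
  show ?case
  proof (cases "i = Suc j")
    case False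
    with Suc.prems have "i \<le> j" by simp
    moreover have "sign_blocks g j = sign_blocks g i"
      using sign_blocks_mono[OF \<open>i \<le> j\<close>, of g] sign_blocks_mono[of j "Suc j" g] Suc.prems by simp
    ultimately show ?thesis
      using Suc by (auto split: if_splits)
  qed simp
qed simp

lemma sign_blocks_less:
  assumes "1 \<le> i" "i < j" "g i * g j < 0"
  shows "sign_blocks g i < sign_blocks g j"
proof (rule ccontr)
  assume "\<not> ?thesis"
  with sign_blocks_mono[of i j g] assms(2) have eq: "sign_blocks g j = sign_blocks g i" by simp
  have nz: "g i \<noteq> 0" "g j \<noteq> 0" using assms(3) by auto
  have "0 < sign_blocks g i"
    using nz assms(1) sign_blocks_eq_0_iff[of g i] by fastforce
  with last_sign_cong_sign_blocks[OF _ eq] assms nz have "sgn (g j) = sgn (g i)"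
    by (simp add: last_sign_nonzero)
  with assms(3) show False by (auto simp: sgn_if mult_less_0_iff split: if_splits)
qed

lemma sign_blocks_le_card_support: "sign_blocks g j \<le> card {i \<in> {1..j}. g i \<noteq> 0}"
proof (induction j)
  case (Suc j)
  have "{i \<in> {1..Suc j}. g i \<noteq> 0}
      = (if g (Suc j) = 0 then {i \<in> {1..j}. g i \<noteq> 0} else insert (Suc j) {i \<in> {1..j}. g i \<noteq> 0})"
    by (auto simp: le_Suc_eq)
  with Suc show ?case by auto
qed simp

lemma sign_blocks_one_sign:
  assumes "sign_blocks g c \<le> 1"
  obtains s :: real where "s = 1 \<or> s = -1" "\<And>j. j \<in> {1..c} \<Longrightarrow> 0 \<le> s * g j"
proof (cases "\<exists>i\<in>{1..c}. g i > 0")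
  case True
  then obtain i where i: "i \<in> {1..c}" "g i > 0" by blast
  have "0 \<le> g j" if j: "j \<in> {1..c}" for j
  proof (rule ccontr)
    assume neg: "\<not> ?thesis"
    with i have "i \<noteq> j" by auto
    have "\<exists>x y. 1 \<le> x \<and> x < y \<and> y \<le> c \<and> g x * g y < 0"
    proof (cases "i < j")
      case True
      with i j neg show ?thesis by (intro exI[of _ i] exI[of _ j]) (auto simp: mult_less_0_iff)
    next
      case False
      with i j neg \<open>i \<noteq> j\<close> show ?thesis
        by (intro exI[of _ j] exI[of _ i]) (auto simp: mult_less_0_iff)
    qed
    then obtain x y where xy: "1 \<le> x" "x < y" "y \<le> c" "g x * g y < 0" by blast
    with sign_blocks_less[OF xy(1,2,4)] sign_blocks_mono[of y c g] assms
    have "sign_blocks g x = 0" by simp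
    with xy show False by (force simp: sign_blocks_eq_0_iff)
  qed
  with that[of 1] show ?thesis by simp
next
  case False
  with that[of "-1"] show ?thesis by force
qed

section \<open>Bidiagonal maps and sign blocks\<close>

text \<open>\<open>g\<close> and \<open>h\<close> are the potentials above and below a row,
  \<open>e\<close> holds the weights of its left edges; a weight may vanish where a dot is
  missing.\<close>

locale bidiagonal =
  fixes e g h :: "nat \<Rightarrow> real" and c :: nat
  assumes e_nonneg: "\<And>j. j \<in> {2..c} \<Longrightarrow> 0 \<le> e j"
    and h_1: "h 1 = g 1"
    and h_eq: "\<And>j. j \<in> {2..c} \<Longrightarrow> h j = g j - e j * g (j - 1)"
begin

lemma h_Suc: "Suc j \<le> c \<Longrightarrow> 1 \<le> j \<Longrightarrow> h (Suc j) = g (Suc j) - e (Suc j) * g j"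
  using h_eq[of "Suc j"] by simp

text \<open>The entry before the start of a block is zero or of the opposite sign, so subtracting a
  nonnegative multiple of it only pushes the new entry further from zero.\<close>

lemma sgn_h_block_start:
  assumes j: "Suc j \<le> c" and new: "g (Suc j) \<noteq> 0" "sgn (g (Suc j)) \<noteq> last_sign g j"
  shows "h (Suc j) \<noteq> 0" "sgn (h (Suc j)) = sgn (g (Suc j))"
proof -
  have "h (Suc j) \<noteq> 0 \<and> sgn (h (Suc j)) = sgn (g (Suc j))"
  proof (cases "j = 0")
    case True
    with new h_1 show ?thesis by simp
  next
    case False
    then have eq: "h (Suc j) = g (Suc j) - e (Suc j) * g j" and e: "0 \<le> e (Suc j)"
      using j h_Suc e_nonneg[of "Suc j"] by auto
    have opp: "g j * g (Suc j) \<le> 0"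
      using new last_sign_nonzero[of j g] False
      by (cases "g j = 0") (auto simp: sgn_if mult_le_0_iff split: if_splits)
    show ?thesis
    proof (cases "g (Suc j) > 0")
      case True
      with opp have "g j \<le> 0" by (simp add: mult_le_0_iff)
      with e have "e (Suc j) * g j \<le> 0" by (simp add: mult_nonneg_nonpos)
      with True eq show ?thesis by simp
    next
      case False
      with new have neg: "g (Suc j) < 0" by simp
      with opp have "g j \<ge> 0" by (simp add: mult_le_0_iff)
      with e have "e (Suc j) * g j \<ge> 0" by simp
      with neg eq show ?thesis by simp
    qed
  qed
  then show "h (Suc j) \<noteq> 0" "sgn (h (Suc j)) = sgn (g (Suc j))" by auto
qed

text \<open>When the numbers of blocks agree, so do the first and hence the last signs; this is what
  makes the comparison of the two numbers inductive.\<close>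

lemma sign_blocks_compare:
  "j \<le> c \<Longrightarrow> sign_blocks g j < sign_blocks h j \<or>
     sign_blocks g j = sign_blocks h j \<and> last_sign g j = last_sign h j"
proof (induction j)
  case (Suc j)
  show ?case
  proof (cases "g (Suc j) = 0 \<or> sgn (g (Suc j)) = last_sign g j")
    case True
    then have "sign_blocks g (Suc j) = sign_blocks g j" "last_sign g (Suc j) = last_sign g j"
      by auto
    with Suc show ?thesis by auto
  next
    case False
    with Suc.prems have "h (Suc j) \<noteq> 0" "sgn (h (Suc j)) = sgn (g (Suc j))"
      using sgn_h_block_start by auto
    with False Suc show ?thesis by auto
  qed
qed simp

lemma sign_blocks_le: "j \<le> c \<Longrightarrow> sign_blocks g j \<le> sign_blocks h j"
  using sign_blocks_compare[of j] by auto

text \<open>Let \<open>i\<close> be the last nonzero column up to \<open>j\<close>. Then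
  \<open>h (i + 1) = - e (i + 1) * g i\<close> has the sign opposite to the last block of
  \<open>g\<close>, although \<open>g\<close> opens no block there; so either \<open>h\<close> was
  already ahead or it opens a block now. The bound \<open>b\<close> permits the weights up to column
  \<open>b\<close> to vanish, as \<open>e 2\<close> does when column 1 has no dot.\<close>

lemma sign_blocks_less_aux:
  assumes b: "1 \<le> b" and e_pos: "\<And>i. b < i \<Longrightarrow> i \<le> j \<Longrightarrow> 0 < e i"
  shows "j \<le> c \<Longrightarrow> g j = 0 \<Longrightarrow> \<exists>i\<in>{b..j}. g i \<noteq> 0 \<Longrightarrow> sign_blocks g j < sign_blocks h j"
  using e_pos
proof (induction j)
  case (Suc j)
  from Suc.prems(2,3) have bj: "b \<le> j" and ex: "\<exists>i\<in>{b..j}. g i \<noteq> 0"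
    by (auto simp: le_Suc_eq)
  have eq: "h (Suc j) = - e (Suc j) * g j" and e: "e (Suc j) > 0"
    using Suc.prems(1,2,4) bj b h_Suc[of j] by auto
  have g: "sign_blocks g (Suc j) = sign_blocks g j" using Suc.prems(2) by simp
  have mono: "sign_blocks h j \<le> sign_blocks h (Suc j)" by (rule sign_blocks_mono) simp
  show ?case
  proof (cases "g j = 0")
    case True
    with Suc.IH Suc.prems ex have "sign_blocks g j < sign_blocks h j" by simp
    with g mono show ?thesis by simp
  next
    case False
    then have *: "last_sign g j = sgn (g j)" using bj b by (simp add: last_sign_nonzero)
    have "h (Suc j) \<noteq> 0" using False e eq by auto
    moreover have "sgn (h (Suc j)) \<noteq> sgn (g j)"
      using False e by (auto simp: eq sgn_mult sgn_if mult_less_0_iff zero_less_mult_iff)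
    ultimately show ?thesis
      using sign_blocks_compare[of j] Suc.prems(1) g mono * by auto
  qed
qed simp

end

text \<open>The extreme case for sign blocks: the support is an interval and each of its entries is
  a block of its own. Such potentials grow out of a unit vector at a missing box. Only the sign of
  \<open>s\<close> matters.\<close>

definition alternating_on :: "nat \<Rightarrow> (nat \<Rightarrow> real) \<Rightarrow> nat \<Rightarrow> nat \<Rightarrow> bool" where
  "alternating_on c g p q \<longleftrightarrow> (\<exists>s. \<forall>j\<in>{1..c}.
     (if p \<le> j \<and> j \<le> q then 0 < s * (- 1) ^ j * g j else g j = 0))"

lemma alternating_on_nonzero_iff:
  "alternating_on c g p q \<Longrightarrow> j \<in> {1..c} \<Longrightarrow> g j \<noteq> 0 \<longleftrightarrow> p \<le> j \<and> j \<le> q"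
  unfolding alternating_on_def by (metis mult_zero_right less_irrefl)

lemma sign_blocks_alternating:
  assumes alt: "alternating_on c g p q" and pq: "1 \<le> p" "p \<le> q" "q \<le> c"
  shows "q - p + 1 \<le> sign_blocks g c"
proof -
  from alt obtain s where s: "\<And>j. j \<in> {p..q} \<Longrightarrow> 0 < s * (- 1) ^ j * g j"
    unfolding alternating_on_def using pq by (metis atLeastAtMost_iff order_trans)
  have "j - p + 1 \<le> sign_blocks g j" if "p \<le> j" "j \<le> q" for j
    using that
  proof (induction j)
    case (Suc j)
    show ?case
    proof (cases "p = Suc j")
      case True
      have "g p \<noteq> 0" using s[of p] pq by auto
      then have "sign_blocks g p \<noteq> 0" using pq by (auto simp: sign_blocks_eq_0_iff)
      with True show ?thesis by simp
    next
      case False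
      with Suc.prems have j: "p \<le> j" by simp
      have "0 < (s * (- 1) ^ j * g j) * (s * (- 1) ^ Suc j * g (Suc j))"
        by (rule mult_pos_pos; rule s) (use j Suc.prems in auto)
      also have "\<dots> = s\<^sup>2 * ((- 1) ^ j * (- 1) ^ j) * - (g j * g (Suc j))"
        by (simp add: power2_eq_square algebra_simps)
      also have "(- 1 :: real) ^ j * (- 1) ^ j = 1" by (simp flip: power_mult_distrib)
      finally have "g j * g (Suc j) < 0" by (simp add: zero_less_mult_iff mult_less_0_iff)
      then have "sign_blocks g j < sign_blocks g (Suc j)"
        using j pq by (intro sign_blocks_less) auto
      with Suc j show ?thesis by simp
    qed
  qed (use pq in auto)
  from this[of q] sign_blocks_mono[of q c g] pq show ?thesis by simp
qed

text \<open>In the coordinates \<open>s * (- 1) ^ j * g j\<close> the step adds instead of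
  subtracting. So nothing cancels inside the support, and the support can only grow by the next
  column to the right.\<close>

lemma (in bidiagonal) alternating_step:
  assumes alt: "alternating_on c g p q" and pq: "1 \<le> p" "p \<le> q" "q \<le> c"
  shows "alternating_on c h p (if q + 1 \<le> c \<and> 0 < e (q + 1) then q + 1 else q)"
proof -
  let ?q = "if q + 1 \<le> c \<and> 0 < e (q + 1) then q + 1 else q"
  from alt obtain s where s: "\<And>j. j \<in> {1..c} \<Longrightarrow>
      if p \<le> j \<and> j \<le> q then 0 < s * (- 1) ^ j * g j else g j = 0"
    unfolding alternating_on_def by blast
  have "if p \<le> j \<and> j \<le> ?q then 0 < s * (- 1) ^ j * h j else h j = 0" if j: "j \<in> {1..c}" for j
  proof (cases "j = 1")
    case True
    with s[of 1] j pq h_1 show ?thesis by (auto split: if_splits)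
  next
    case False
    with j have j2: "j \<in> {2..c}" by auto
    then obtain i where i: "j = Suc i" "1 \<le> i" by (cases j) auto
    have h: "s * (- 1) ^ j * h j = s * (- 1) ^ j * g j + e j * (s * (- 1) ^ i * g i)"
    proof -
      have "h j = g j - e j * g i" "(- 1 :: real) ^ j = - ((- 1) ^ i)" using h_eq[OF j2] i by auto
      then show ?thesis by (simp add: right_diff_distrib)
    qed
    have e0: "0 \<le> e j" using e_nonneg[OF j2] .
    consider "j < p" | "j = p" | "p < j" "j \<le> q" | "j = q + 1" | "q + 1 < j" by linarith
    then show ?thesis
    proof cases
      case 1
      with s[of j] s[of i] i j h_eq[OF j2] pq show ?thesis by auto
    next
      case 2
      with s[of j] s[of i] i j h_eq[OF j2] pq show ?thesis by auto
    next
      case 3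
      with s[of j] s[of i] i j have "0 < s * (- 1) ^ j * g j" "0 < s * (- 1) ^ i * g i" by auto
      with e0 h have "0 < s * (- 1) ^ j * h j" by (simp add: add_pos_nonneg)
      with 3 show ?thesis by auto
    next
      case 4
      with s[of j] s[of i] i j pq have g: "g j = 0" "0 < s * (- 1) ^ i * g i" by auto
      show ?thesis
      proof (cases "0 < e j")
        case True
        have "0 < s * (- 1) ^ j * h j"
          using mult_pos_pos[OF True g(2)] unfolding h g(1) by simp
        with 4 True pq j show ?thesis by auto
      next
        case False
        with e0 have "e j = 0" by simp
        with g h_eq[OF j2] 4 pq False show ?thesis by auto
      qed
    next
      case 5
      with s[of j] s[of i] i j h_eq[OF j2] pq show ?thesis by auto
    qed
  qed
  then show ?thesis unfolding alternating_on_def by blast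
qed

section \<open>Walks in acyclic networks\<close>

definition walks :: "('v \<times> 'v) set \<Rightarrow> 'v \<Rightarrow> 'v \<Rightarrow> 'v list set" where
  "walks E u v = {p. p \<noteq> [] \<and> hd p = u \<and> last p = v \<and> successively (\<lambda>x y. (x, y) \<in> E) p}"

definition walk_sum :: "('v \<times> 'v) set \<Rightarrow> ('v \<times> 'v \<Rightarrow> real) \<Rightarrow> 'v \<Rightarrow> 'v \<Rightarrow> real" where
  "walk_sum E W u v = (\<Sum>p \<in> walks E u v. prod_list (map W (zip p (tl p))))"

lemma walks_step:
  assumes "u \<noteq> v"
  shows "walks E u v = (\<Union>x \<in> E `` {u}. (#) u ` walks E x v)"
proof (intro equalityI subsetI)
  fix p assume "p \<in> walks E u v"
  then obtain q where p: "p = u # q" and *: "last p = v" "successively (\<lambda>x y. (x, y) \<in> E) p"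
    by (cases p) (auto simp: walks_def)
  with assms obtain x r where q: "q = x # r" by (cases q) auto
  with p * have "(u, x) \<in> E" "q \<in> walks E x v" by (auto simp: walks_def)
  with p show "p \<in> (\<Union>x \<in> E `` {u}. (#) u ` walks E x v)" by blast
next
  fix p assume "p \<in> (\<Union>x \<in> E `` {u}. (#) u ` walks E x v)"
  then obtain x q where "(u, x) \<in> E" "q \<in> walks E x v" "p = u # q" by auto
  then show "p \<in> walks E u v"
    by (cases q) (auto simp: walks_def)
qed

lemma walks_sink:
  assumes "E `` {v} = {}"
  shows "walks E v v = {[v]}"
proof -
  have "p = [v]" if p: "p \<in> walks E v v" for p
  proof -
    from p obtain q where q: "p = v # q" by (cases p) (auto simp: walks_def)
    with p assms show ?thesis by (cases q) (auto simp: walks_def)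
  qed
  then show ?thesis by (auto simp: walks_def)
qed

lemma finite_walks:
  fixes rank :: "'v \<Rightarrow> nat"
  assumes rank: "\<And>x y. (x, y) \<in> E \<Longrightarrow> rank y < rank x" and fin: "\<And>x. finite (E `` {x})"
  shows "finite (walks E u v)"
proof (induction "rank u" arbitrary: u rule: less_induct)
  case less
  show ?case
  proof (cases "u = v")
    case False
    then show ?thesis unfolding walks_step[OF False] using less rank fin by auto
  next
    case True
    have "p = [v]" if p: "p \<in> walks E v v" for p
    proof (rule ccontr)
      assume "p \<noteq> [v]"
      with p obtain x r where pr: "p = v # x # r"
        by (cases p; cases "tl p") (auto simp: walks_def)
      have "successively (\<lambda>x y. rank y < rank x) p"
        using p rank by (auto simp: walks_def elim: successively_mono)
      then have "sorted_wrt (\<lambda>x y. rank y < rank x) p"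
        by (subst (asm) successively_conv_sorted_wrt) (auto intro: transpI)
      moreover have "last (x # r) = v" using p pr by (auto simp: walks_def)
      ultimately show False using pr by (metis last_in_set less_irrefl list.distinct(1) sorted_wrt.simps(2))
    qed
    then have "walks E v v \<subseteq> {[v]}" by blast
    with True show ?thesis by (auto intro: finite_subset)
  qed
qed

lemma walk_sum_step:
  fixes rank :: "'v \<Rightarrow> nat"
  assumes rank: "\<And>x y. (x, y) \<in> E \<Longrightarrow> rank y < rank x" and fin: "\<And>x. finite (E `` {x})"
    and "u \<noteq> v"
  shows "walk_sum E W u v = (\<Sum>x \<in> E `` {u}. W (u, x) * walk_sum E W x v)"
proof -
  let ?f = "\<lambda>p. prod_list (map W (zip p (tl p)))"
  have "walk_sum E W u v = (\<Sum>x \<in> E `` {u}. \<Sum>p \<in> (#) u ` walks E x v. ?f p)"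
    unfolding walk_sum_def walks_step[OF assms(3)]
  proof (rule sum.UNION_disjoint)
    show "\<forall>x\<in>E `` {u}. finite ((#) u ` walks E x v)" using finite_walks[of E rank] rank fin by blast
    show "\<forall>x\<in>E `` {u}. \<forall>y\<in>E `` {u}. x \<noteq> y \<longrightarrow> (#) u ` walks E x v \<inter> (#) u ` walks E y v = {}"
      by (auto simp: walks_def)
  qed (rule fin)
  also have "\<dots> = (\<Sum>x \<in> E `` {u}. \<Sum>p \<in> walks E x v. ?f (u # p))"
    by (intro sum.cong refl sum.reindex_cong[of "(#) u"]) auto
  also have "\<dots> = (\<Sum>x \<in> E `` {u}. \<Sum>p \<in> walks E x v. W (u, x) * ?f p)"
  proof (intro sum.cong refl)
    fix x p assume "p \<in> walks E x v"
    then show "?f (u # p) = W (u, x) * ?f p" by (cases p) (auto simp: walks_def)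
  qed
  finally show ?thesis by (simp add: walk_sum_def sum_distrib_left)
qed

lemma walk_sum_sink: "E `` {v} = {} \<Longrightarrow> walk_sum E W v v = 1"
  by (simp add: walk_sum_def walks_sink)

text \<open>A function that is harmonic on a set closed under edges is determined by its values at
  the sinks, with walk sums as coefficients. Confining harmonicity to \<open>Q\<close> admits
  potentials that obey the row rule only from some row downward.\<close>

lemma walk_sum_potential:
  fixes rank :: "'v \<Rightarrow> nat"
  assumes rank: "\<And>x y. (x, y) \<in> E \<Longrightarrow> rank y < rank x" and fin: "\<And>x. finite (E `` {x})"
    and T: "finite T" "\<And>t. t \<in> T \<Longrightarrow> E `` {t} = {}"
    and closed: "E `` Q \<subseteq> Q"
    and harmonic: "\<And>x. x \<in> Q \<Longrightarrow> x \<notin> T \<Longrightarrow> \<phi> x = (\<Sum>y \<in> E `` {x}. W (x, y) * \<phi> y)"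
    and "u \<in> Q"
  shows "(\<Sum>t \<in> T. walk_sum E W u t * \<phi> t) = \<phi> u"
  using \<open>u \<in> Q\<close>
proof (induction "rank u" arbitrary: u rule: less_induct)
  case less
  show ?case
  proof (cases "u \<in> T")
    case True
    have "walk_sum E W u t = (if t = u then 1 else 0)" if "t \<in> T" for t
      using that T(2)[OF True] walk_sum_sink[of E u W] walks_step[of u t E]
      by (auto simp: walk_sum_def)
    then have "(\<Sum>t \<in> T. walk_sum E W u t * \<phi> t) = (\<Sum>t \<in> T. if t = u then \<phi> t else 0)"
      by (intro sum.cong) auto
    with True T(1) show ?thesis by simp
  next
    case False
    then have "(\<Sum>t \<in> T. walk_sum E W u t * \<phi> t)
      = (\<Sum>t \<in> T. \<Sum>x \<in> E `` {u}. W (u, x) * (walk_sum E W x t * \<phi> t))"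
      by (intro sum.cong refl, subst walk_sum_step[OF rank fin])
        (auto simp: sum_distrib_right mult.assoc)
    also have "\<dots> = (\<Sum>x \<in> E `` {u}. W (u, x) * (\<Sum>t \<in> T. walk_sum E W x t * \<phi> t))"
      by (subst sum.swap) (simp add: sum_distrib_left)
    also have "\<dots> = (\<Sum>x \<in> E `` {u}. W (u, x) * \<phi> x)"
      using less rank closed by (intro sum.cong refl) auto
    also have "\<dots> = \<phi> u" using harmonic[OF less.prems False] by simp
    finally show ?thesis .
  qed
qed

text \<open>Kernel vectors are indexed by labels instead of positions in the sorted lists, so that
  the order of rows and columns disappears from the later arguments.\<close>

lemma det_eq_0_iff_kernel:
  fixes f :: "nat \<Rightarrow> nat \<Rightarrow> real"
  assumes X: "finite X" "card X = k" and Y: "finite Y" "card Y = k"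
  shows "det (mat k k (\<lambda>(a, b). f (sorted_list_of_set X ! a) (sorted_list_of_set Y ! b))) = 0
    \<longleftrightarrow> (\<exists>v. (\<exists>y\<in>Y. v y \<noteq> 0) \<and> (\<forall>x\<in>X. (\<Sum>y\<in>Y. f x y * v y) = 0))"
    (is "det ?M = 0 \<longleftrightarrow> ?R")
proof -
  let ?xs = "sorted_list_of_set X" and ?ys = "sorted_list_of_set Y"
  have bX: "bij_betw ((!) ?xs) {..<k} X" and bY: "bij_betw ((!) ?ys) {..<k} Y"
    using X Y by (auto intro!: bij_betw_nth)
  have entry: "(?M *\<^sub>v vec k (\<lambda>b. v (?ys ! b))) $ a = (\<Sum>y\<in>Y. f (?xs ! a) y * v y)"
    if "a < k" for a v
  proof -
    have "(?M *\<^sub>v vec k (\<lambda>b. v (?ys ! b))) $ a = (\<Sum>b<k. f (?xs ! a) (?ys ! b) * v (?ys ! b))"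
      using that by (simp add: scalar_prod_def lessThan_atLeast0)
    also have "\<dots> = (\<Sum>y\<in>Y. f (?xs ! a) y * v y)"
      by (rule sum.reindex_bij_betw[OF bY])
    finally show ?thesis .
  qed
  have "det ?M = 0 \<longleftrightarrow> (\<exists>v. v \<in> carrier_vec k \<and> v \<noteq> 0\<^sub>v k \<and> ?M *\<^sub>v v = 0\<^sub>v k)"
    by (rule det_0_iff_vec_prod_zero) simp
  also have "\<dots> \<longleftrightarrow> ?R"
  proof
    assume "\<exists>v. v \<in> carrier_vec k \<and> v \<noteq> 0\<^sub>v k \<and> ?M *\<^sub>v v = 0\<^sub>v k"
    then obtain v where v: "v \<in> carrier_vec k" "v \<noteq> 0\<^sub>v k" "?M *\<^sub>v v = 0\<^sub>v k" by blast
    define u where "u y = v $ (inv_into {..<k} ((!) ?ys) y)" for y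
    have u: "u (?ys ! b) = v $ b" if "b < k" for b
      using that bY by (simp add: u_def bij_betw_inv_into_left)
    have vu: "v = vec k (\<lambda>b. u (?ys ! b))" using v(1) u by (intro eq_vecI) auto
    have "\<exists>b<k. v $ b \<noteq> 0"
    proof (rule ccontr)
      assume "\<not> ?thesis"
      with v(1) have "v = 0\<^sub>v k" by (intro eq_vecI) auto
      with v(2) show False ..
    qed
    then obtain b where b: "b < k" "v $ b \<noteq> 0" by blast
    then have "\<exists>y\<in>Y. u y \<noteq> 0" using u bY by (intro bexI[of _ "?ys ! b"]) (auto dest: bij_betwE)
    moreover have "(\<Sum>y\<in>Y. f x y * u y) = 0" if x: "x \<in> X" for x
    proof -
      from x bX obtain a where "a < k" "x = ?xs ! a" by (auto simp: bij_betw_def)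
      from v(3) have "?M *\<^sub>v vec k (\<lambda>b. u (?ys ! b)) = 0\<^sub>v k" by (simp only: flip: vu)
      with entry[OF \<open>a < k\<close>, of u] \<open>a < k\<close> \<open>x = ?xs ! a\<close> show ?thesis by (metis index_zero_vec(1))
    qed
    ultimately show ?R by blast
  next
    assume ?R
    then obtain u y where u: "y \<in> Y" "u y \<noteq> 0" "\<And>x. x \<in> X \<Longrightarrow> (\<Sum>y\<in>Y. f x y * u y) = 0"
      by blast
    from u(1) bY obtain b where b: "b < k" "y = ?ys ! b" by (auto simp: bij_betw_def)
    let ?v = "vec k (\<lambda>b. u (?ys ! b))"
    have "?v $ b \<noteq> 0" using b u by simp
    then have "?v \<noteq> 0\<^sub>v k" using b by (metis index_zero_vec(1))
    moreover have "?M *\<^sub>v ?v = 0\<^sub>v k"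
      using entry u(3) bX by (intro eq_vecI) (auto dest: bij_betwE)
    ultimately show "\<exists>v. v \<in> carrier_vec k \<and> v \<noteq> 0\<^sub>v k \<and> ?M *\<^sub>v v = 0\<^sub>v k"
      by (intro exI[of _ ?v]) auto
  qed
  finally show ?thesis .
qed

section \<open>Potentials on the network of a filling\<close>

definition prev_dot :: "filling \<Rightarrow> nat \<Rightarrow> nat \<Rightarrow> nat" where
  "prev_dot D i j = Max {j'. j' < j \<and> (i, j') \<in> dots D}"

definition last_dot :: "filling \<Rightarrow> nat \<Rightarrow> nat" where
  "last_dot D i = Max {j. (i, j) \<in> dots D}"

text \<open>The default 0 covers empty boxes and leftmost dots alike, so the row rule needs no case
  distinction: where \<open>prev_dot\<close> is the unspecified \<open>Max {}\<close>, or where the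
  box is empty, its value is multiplied by 0.\<close>

definition left_weight :: "filling \<Rightarrow> (vertex \<times> vertex \<Rightarrow> real) \<Rightarrow> nat \<Rightarrow> nat \<Rightarrow> real" where
  "left_weight D w i j =
     (if (i, j) \<in> dots D \<and> (\<exists>j'<j. (i, j') \<in> dots D)
      then w (Internal i j, Internal i (prev_dot D i j)) else 0)"

text \<open>\<open>G i j\<close> is the potential of the network just above row \<open>i\<close> in column \<open>j\<close>.\<close>

definition row_rule :: "nat \<Rightarrow> filling \<Rightarrow> (vertex \<times> vertex \<Rightarrow> real) \<Rightarrow> nat \<Rightarrow> (nat \<Rightarrow> nat \<Rightarrow> real) \<Rightarrow> bool" where
  "row_rule c D w i G \<longleftrightarrow>
     (\<forall>j\<in>{1..c}. G (Suc i) j = G i j - left_weight D w i j * G i (prev_dot D i j))"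

lemma prev_dot:
  assumes "j' < j" "(i, j') \<in> dots D"
  shows "prev_dot D i j < j" "(i, prev_dot D i j) \<in> dots D" "j' \<le> prev_dot D i j"
proof -
  have fin: "finite {j'. j' < j \<and> (i, j') \<in> dots D}" by simp
  have "prev_dot D i j \<in> {j'. j' < j \<and> (i, j') \<in> dots D}"
    unfolding prev_dot_def using assms by (intro Max_in fin) auto
  then show "prev_dot D i j < j" "(i, prev_dot D i j) \<in> dots D" by auto
  show "j' \<le> prev_dot D i j"
    unfolding prev_dot_def using assms by (intro Max_ge fin) auto
qed

text \<open>Serves to construct explicit potentials that start as a unit vector in row
  \<open>s\<close>; the rows above \<open>s\<close> stay unconstrained.\<close>

lemma exists_potential_from_top: "\<exists>G. G s = g \<and> (\<forall>i\<ge>s. row_rule c D w i G)"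
proof -
  define H where
    "H = rec_nat g (\<lambda>t h j. h j - left_weight D w (s + t) j * h (prev_dot D (s + t) j))"
  have "H 0 = g" "\<And>t j. H (Suc t) j = H t j - left_weight D w (s + t) j * H t (prev_dot D (s + t) j)"
    by (simp_all add: H_def)
  then show ?thesis
    by (intro exI[of _ "\<lambda>i. H (i - s)"]) (auto simp: row_rule_def Suc_diff_le)
qed

text \<open>The row is solved from left to right, because \<open>prev_dot\<close> lies strictly to
  the left wherever the weight is nonzero. The relation \<open>R\<close> drops the columns of weight
  zero, where \<open>prev_dot\<close> may be unspecified.\<close>

lemma exists_potential_row:
  "\<exists>g. \<forall>j. g j = h j + left_weight D w i j * g (prev_dot D i j)"
proof -
  define R where "R = {(j', j). j' < j \<and> j' = prev_dot D i j \<and> left_weight D w i j \<noteq> 0}"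
  have "wf R" by (rule wf_subset[OF wf_less]) (auto simp: R_def)
  define g where "g = wfrec R (\<lambda>g j. h j +
     (if left_weight D w i j = 0 then 0 else left_weight D w i j * g (prev_dot D i j)))"
  have *: "prev_dot D i j < j" if "left_weight D w i j \<noteq> 0" for j
    using that prev_dot(1)[of _ j i D] by (auto simp: left_weight_def split: if_splits)
  have "g j = h j + left_weight D w i j * g (prev_dot D i j)" for j
    unfolding g_def
    by (subst wfrec[OF \<open>wf R\<close>]) (use * in \<open>auto simp: cut_def R_def\<close>)
  then show ?thesis by blast
qed

text \<open>Each row rule is unitriangular, so arbitrary sink values extend upward; this turns a
  kernel vector into a potential. \<open>H\<close> counts the rows from the bottom.\<close>

lemma exists_potential_from_bottom: "\<exists>G. G (Suc k) = u \<and> (\<forall>i\<in>{1..k}. row_rule c D w i G)"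
proof -
  define f where "f i h = (SOME g. \<forall>j. g j = h j + left_weight D w i j * g (prev_dot D i j))" for i h
  have f: "f i h j = h j + left_weight D w i j * f i h (prev_dot D i j)" for i h j
    unfolding f_def using someI_ex[OF exists_potential_row[of h D w i]] by blast
  define H where "H = rec_nat u (\<lambda>t. f (k - t))"
  have H: "H 0 = u" "\<And>t. H (Suc t) = f (k - t) (H t)" by (simp_all add: H_def)
  have "row_rule c D w i (\<lambda>i. H (Suc k - i))" if i: "i \<in> {1..k}" for i
  proof -
    from i have *: "Suc k - i = Suc (k - i)" "k - (k - i) = i" by auto
    have "H (Suc k - i) = f i (H (k - i))" using H(2)[of "k - i"] * by simp
    moreover have "Suc k - Suc i = k - i" by simp
    moreover have "H (k - i) j = f i (H (k - i)) j
        - left_weight D w i j * f i (H (k - i)) (prev_dot D i j)" for j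
      by (subst (1) f) simp
    ultimately show ?thesis unfolding row_rule_def by (metis (no_types))
  qed
  with H(1) show ?thesis by (intro exI[of _ "\<lambda>i. H (Suc k - i)"]) auto
qed

text \<open>Boundary vertices are identified by their labels only, so the labels must tell all
  sources and sinks apart.\<close>

locale network =
  fixes k c :: nat and D :: filling and w :: "vertex \<times> vertex \<Rightarrow> real"
  assumes dots: "dots D \<subseteq> {1..k} \<times> {1..c}"
    and inj_row: "inj_on (row_label c D) {1..k}"
    and inj_col: "inj_on (col_label c D) {1..c}"
    and row_col: "i \<in> {1..k} \<Longrightarrow> j \<in> {1..c} \<Longrightarrow> row_label c D i \<noteq> col_label c D j"
begin

abbreviation edges where "edges \<equiv> left_edges k c D \<union> down_edges c D"

definition path_sum :: "nat \<Rightarrow> nat \<Rightarrow> real" where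
  "path_sum i j = (\<Sum>p \<in> paths k c D (row_label c D i) (col_label c D j). path_weight k c D w p)"

lemma path_sum_eq:
  "path_sum i j =
     walk_sum edges (edge_weight k c D w) (Boundary (row_label c D i)) (Boundary (col_label c D j))"
  by (simp add: path_sum_def walk_sum_def walks_def paths_def path_weight_def)

lemma dotsD: "(i, j) \<in> dots D \<Longrightarrow> i \<in> {1..k} \<and> j \<in> {1..c}"
  using dots by auto

lemma last_dot:
  assumes "(i, j) \<in> dots D"
  shows "(i, last_dot D i) \<in> dots D" "j \<le> last_dot D i"
proof -
  have fin: "finite {j. (i, j) \<in> dots D}"
    by (rule finite_subset[of _ "{1..c}"]) (use dots in auto)
  from Max_in[OF fin] assms show "(i, last_dot D i) \<in> dots D" by (auto simp: last_dot_def)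
  from Max_ge[OF fin] assms show "j \<le> last_dot D i" by (auto simp: last_dot_def)
qed

lemma last_dot_greater: "last_dot D i < j \<Longrightarrow> (i, j) \<notin> dots D"
  using last_dot(2) leD by blast

text \<open>Decreases along every edge: left edges lower \<open>j\<close>, down edges lower
  \<open>k - i\<close>, sources lie above all dots and sinks below. This certifies that the network
  is acyclic.\<close>

definition rank :: "vertex \<Rightarrow> nat" where
  "rank v = (case v of Internal i j \<Rightarrow> (k - i) + j + 1
     | Boundary l \<Rightarrow> if l \<in> row_label c D ` {1..k} then k + c + 2 else 0)"

lemma edge_cases:
  assumes "(x, y) \<in> edges"
  obtains (source) i where "i \<in> {1..k}" "(i, last_dot D i) \<in> dots D"
      "x = Boundary (row_label c D i)" "y = Internal i (last_dot D i)"
  | (left) i j j' where "x = Internal i j'" "y = Internal i j" "(i, j) \<in> dots D" "(i, j') \<in> dots D" "j < j'"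
  | (down) i i' j where "x = Internal i j" "y = Internal i' j" "(i, j) \<in> dots D" "(i', j) \<in> dots D" "i < i'"
  | (sink) i j where "x = Internal i j" "y = Boundary (col_label c D j)" "(i, j) \<in> dots D"
proof -
  have "j = last_dot D i" if "(i, j) \<in> dots D" "\<forall>j'>j. (i, j') \<notin> dots D" for i j
    using last_dot[OF that(1)] that(2) by (meson le_neq_implies_less)
  note last = this
  from assms consider
    i j where "i \<in> {1..k}" "(i, j) \<in> dots D" "\<forall>j'>j. (i, j') \<notin> dots D"
      "x = Boundary (row_label c D i)" "y = Internal i j"
  | i j j' where "x = Internal i j'" "y = Internal i j" "(i, j) \<in> dots D" "(i, j') \<in> dots D" "j < j'"
  | i i' j where "x = Internal i j" "y = Internal i' j" "(i, j) \<in> dots D" "(i', j) \<in> dots D" "i < i'"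
  | i j where "x = Internal i j" "y = Boundary (col_label c D j)" "(i, j) \<in> dots D"
    unfolding left_edges_def down_edges_def by blast
  then show ?thesis
  proof cases
    case (1 i j)
    with last[of i j] source[of i] show ?thesis by metis
  qed (rule left down sink; assumption)+
qed

lemma rank_edge:
  assumes "(x, y) \<in> edges"
  shows "rank y < rank x"
  using assms
proof (cases rule: edge_cases)
  case (source i)
  with dotsD[of i "last_dot D i"] show ?thesis by (auto simp: rank_def)
next
  case (left i j j')
  then show ?thesis by (simp add: rank_def)
next
  case (down i i' j)
  with dotsD[of i j] dotsD[of i' j] show ?thesis by (auto simp: rank_def)
next
  case (sink i j)
  with dotsD[of i j] have "j \<in> {1..c}" by simp
  then have "col_label c D j \<notin> row_label c D ` {1..k}" using row_col by fastforce
  with sink show ?thesis by (simp add: rank_def)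
qed

lemma sink_no_edge:
  assumes "j \<in> {1..c}"
  shows "edges `` {Boundary (col_label c D j)} = {}"
proof -
  have False if "(Boundary (col_label c D j), y) \<in> edges" for y
    using that
  proof (cases rule: edge_cases)
    case (source i)
    with row_col[OF source(1) assms] show False by simp
  qed auto
  then show ?thesis by blast
qed

lemma source_edges:
  assumes "i \<in> {1..k}" "(i, j) \<in> dots D"
  shows "edges `` {Boundary (row_label c D i)} = {Internal i (last_dot D i)}"
proof -
  have "x = Internal i (last_dot D i)" if x: "(Boundary (row_label c D i), x) \<in> left_edges k c D" for x
  proof -
    from x obtain i' j' where *: "row_label c D i = row_label c D i'" "x = Internal i' j'"
      "i' \<in> {1..k}" "(i', j') \<in> dots D" "\<forall>j''>j'. (i', j'') \<notin> dots D"
      unfolding left_edges_def by blast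
    with inj_onD[OF inj_row *(1)] assms(1) have "i' = i" by simp
    moreover have "j' = last_dot D i'"
      using last_dot[OF *(4)] *(5) by (meson le_neq_implies_less)
    ultimately show ?thesis using *(2) by simp
  qed
  then have "left_edges k c D `` {Boundary (row_label c D i)} \<subseteq> {Internal i (last_dot D i)}"
    by blast
  moreover have "down_edges c D `` {Boundary (row_label c D i)} = {}"
    by (auto simp: down_edges_def)
  moreover have "(Boundary (row_label c D i), Internal i (last_dot D i)) \<in> left_edges k c D"
    using assms last_dot(1)[OF assms(2)] last_dot_greater by (auto simp: left_edges_def)
  ultimately show ?thesis by blast
qed

lemma source_edge_left:
  assumes "i \<in> {1..k}" "(i, j) \<in> dots D"
  shows "(Boundary (row_label c D i), Internal i (last_dot D i)) \<in> left_edges k c D"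
  using source_edges[OF assms] by (auto simp: down_edges_def)

definition below :: "nat \<Rightarrow> nat \<Rightarrow> vertex" where
  "below i j = (if \<exists>i'>i. (i', j) \<in> dots D
     then Internal (LEAST i'. i < i' \<and> (i', j) \<in> dots D) j else Boundary (col_label c D j))"

lemma down_edges_internal:
  assumes "(i, j) \<in> dots D"
  shows "down_edges c D `` {Internal i j} = {below i j}"
proof (cases "\<exists>i'>i. (i', j) \<in> dots D")
  case True
  define i\<^sub>0 where "i\<^sub>0 = (LEAST i'. i < i' \<and> (i', j) \<in> dots D)"
  have i0: "i < i\<^sub>0" "(i\<^sub>0, j) \<in> dots D"
    using LeastI_ex[OF True] by (auto simp: i\<^sub>0_def)
  have least: "i\<^sub>0 \<le> i'" if "i < i'" "(i', j) \<in> dots D" for i'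
    using that by (auto simp: i\<^sub>0_def intro: Least_le)
  have "i' = i\<^sub>0" if "i < i'" "(i', j) \<in> dots D" "\<forall>i''. i < i'' \<and> i'' < i' \<longrightarrow> (i'', j) \<notin> dots D" for i'
    using that i0 least[OF that(1,2)] le_neq_implies_less by blast
  then have "down_edges c D `` {Internal i j} \<subseteq> {Internal i\<^sub>0 j}"
    using True unfolding down_edges_def by blast
  moreover have "\<forall>i''. i < i'' \<and> i'' < i\<^sub>0 \<longrightarrow> (i'', j) \<notin> dots D"
    using least leD by blast
  then have "(Internal i j, Internal i\<^sub>0 j) \<in> down_edges c D"
    using i0 assms by (auto simp: down_edges_def)
  ultimately show ?thesis
    using True by (auto simp: below_def i\<^sub>0_def[symmetric])
next
  case False
  with assms show ?thesis by (auto simp: down_edges_def below_def)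
qed

lemma left_edges_internal:
  assumes "(i, j) \<in> dots D"
  shows "left_edges k c D `` {Internal i j} =
    (if \<exists>j'<j. (i, j') \<in> dots D then {Internal i (prev_dot D i j)} else {})"
proof (cases "\<exists>j'<j. (i, j') \<in> dots D")
  case True
  then obtain j' where j': "j' < j" "(i, j') \<in> dots D" by blast
  have "j'' = prev_dot D i j"
    if "j'' < j" "(i, j'') \<in> dots D" "\<forall>l. j'' < l \<and> l < j \<longrightarrow> (i, l) \<notin> dots D" for j''
    using that prev_dot[OF that(1,2)] by (meson le_neq_implies_less)
  then have "left_edges k c D `` {Internal i j} \<subseteq> {Internal i (prev_dot D i j)}"
    unfolding left_edges_def by blast
  moreover have "\<forall>l. prev_dot D i j < l \<and> l < j \<longrightarrow> (i, l) \<notin> dots D"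
    using prev_dot(3) by (meson leD)
  then have "(Internal i j, Internal i (prev_dot D i j)) \<in> left_edges k c D"
    using assms prev_dot(1,2)[OF j'] unfolding left_edges_def by blast
  ultimately show ?thesis
    using True by auto
qed (use assms in \<open>auto simp: left_edges_def\<close>)

lemma finite_edges: "finite (edges `` {x})"
proof (cases x)
  case (Internal i j)
  show ?thesis
  proof (cases "(i, j) \<in> dots D")
    case True
    then show ?thesis
      by (simp add: Internal Un_Image down_edges_internal left_edges_internal)
  next
    case False
    then have "edges `` {x} = {}"
      unfolding Internal left_edges_def down_edges_def by blast
    then show ?thesis by simp
  qed
next
  case (Boundary l)
  have "edges `` {x} \<subseteq> (\<lambda>(i, j). Internal i j) ` ({1..k} \<times> {1..c})"
    using dots by (auto simp: Boundary left_edges_def down_edges_def)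
  then show ?thesis by (rule finite_subset) auto
qed

lemma potential_below:
  assumes rule: "\<And>i'. i \<le> i' \<Longrightarrow> i' \<le> k \<Longrightarrow> row_rule c D w i' G" and ij: "i \<le> k" "j \<in> {1..c}"
  shows "G (Suc i) j = (case below i j of Internal i' j' \<Rightarrow> G i' j' | Boundary _ \<Rightarrow> G (Suc k) j)"
proof -
  have skip: "G l j = G (Suc i) j"
    if "Suc i \<le> l" "l \<le> Suc k" "\<And>i'. i < i' \<Longrightarrow> i' < l \<Longrightarrow> (i', j) \<notin> dots D" for l
    using that
  proof (induction l)
    case (Suc l)
    show ?case
    proof (cases "l = i")
      case False
      with Suc have "G l j = G (Suc i) j" "(l, j) \<notin> dots D" "row_rule c D w l G"
        by (auto intro: rule)
      with ij show ?thesis by (auto simp: row_rule_def left_weight_def)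
    qed simp
  qed simp
  show ?thesis
  proof (cases "\<exists>i'>i. (i', j) \<in> dots D")
    case True
    define i\<^sub>0 where "i\<^sub>0 = (LEAST i'. i < i' \<and> (i', j) \<in> dots D)"
    have i0: "i < i\<^sub>0" "(i\<^sub>0, j) \<in> dots D"
      using LeastI_ex[OF True] by (auto simp: i\<^sub>0_def)
    have "(i', j) \<notin> dots D" if "i < i'" "i' < i\<^sub>0" for i'
      using that not_less_Least by (auto simp: i\<^sub>0_def)
    with skip[of i\<^sub>0] i0 dotsD[OF i0(2)] have "G i\<^sub>0 j = G (Suc i) j" by auto
    with True show ?thesis by (auto simp: below_def i\<^sub>0_def[symmetric])
  next
    case False
    with skip[of "Suc k"] ij show ?thesis by (auto simp: below_def)
  qed
qed

text \<open>The source has a single outgoing edge, to the last dot of its row, so its potential is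
  the weight of this edge times the potential at that dot. Thus a vanishing row of the kernel
  equation becomes a zero of \<open>G i\<close>.\<close>

lemma path_sum_potential:
  assumes rule: "\<And>i. s \<le> i \<Longrightarrow> i \<le> k \<Longrightarrow> row_rule c D w i G"
    and i: "s \<le> i" "i \<in> {1..k}" and row: "(i, j\<^sub>0) \<in> dots D"
  shows "(\<Sum>j\<in>{1..c}. path_sum i j * G (Suc k) j) =
    w (Boundary (row_label c D i), Internal i (last_dot D i)) * G i (last_dot D i)"
proof -
  let ?src = "Boundary (row_label c D i)"
  let ?T = "(\<lambda>j. Boundary (col_label c D j)) ` {1..c}"
  let ?W = "edge_weight k c D w"
  define \<phi> where "\<phi> v = (case v of Internal i j \<Rightarrow> G i j
     | Boundary l \<Rightarrow> if l = row_label c D i then w (?src, Internal i (last_dot D i)) * G i (last_dot D i)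
        else G (Suc k) (inv_into {1..c} (col_label c D) l))" for v
  \<comment> \<open>\<open>Q\<close> omits the other sources, for which \<open>\<phi>\<close> takes
    a meaningless value from \<open>inv_into\<close>, and the dots above row \<open>s\<close>, where
    the row rule is not assumed.\<close>
  define Q where "Q = {?src} \<union> {Internal i' j | i' j. s \<le> i' \<and> (i', j) \<in> dots D} \<union> ?T"
  have src: "edges `` {?src} = {Internal i (last_dot D i)}" using source_edges[OF i(2) row] .
  have last: "(i, last_dot D i) \<in> dots D" using last_dot[OF row] by simp
  have \<phi>T: "\<phi> (Boundary (col_label c D j)) = G (Suc k) j" if "j \<in> {1..c}" for j
    using row_col[OF i(2) that] inv_into_f_f[OF inj_col that] by (auto simp: \<phi>_def)
  have closed: "edges `` Q \<subseteq> Q"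
  proof
    fix y assume "y \<in> edges `` Q"
    then obtain x where x: "x \<in> Q" "(x, y) \<in> edges" by blast
    from x(1) consider "x = ?src" | i' j where "x = Internal i' j" "s \<le> i'" "(i', j) \<in> dots D"
      | j where "j \<in> {1..c}" "x = Boundary (col_label c D j)" by (auto simp: Q_def)
    then show "y \<in> Q"
    proof cases
      case 1
      with src x(2) have "y = Internal i (last_dot D i)" by auto
      with last i show ?thesis by (auto simp: Q_def)
    next
      case 2
      from x(2) show ?thesis
      proof (cases rule: edge_cases)
        case (left a j j')
        with 2 show ?thesis by (auto simp: Q_def)
      next
        case (down a a' j)
        with 2 have "s \<le> a'" by auto
        with down show ?thesis by (auto simp: Q_def)
      next
        case (sink a j)
        with dotsD[of a j] show ?thesis by (auto simp: Q_def)
      qed (use 2 in auto)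
    next
      case 3
      with x(2) sink_no_edge show ?thesis by blast
    qed
  qed
  have harmonic: "\<phi> x = (\<Sum>y \<in> edges `` {x}. ?W (x, y) * \<phi> y)" if x: "x \<in> Q" "x \<notin> ?T" for x
  proof -
    from x consider "x = ?src" | i' j where "x = Internal i' j" "s \<le> i'" "(i', j) \<in> dots D"
      by (auto simp: Q_def)
    then show ?thesis
    proof cases
      case 1
      then show ?thesis
        unfolding 1 src using source_edge_left[OF i(2) row] by (simp add: edge_weight_def \<phi>_def)
    next
      case 2
      with dotsD have i': "i' \<in> {1..k}" and j: "j \<in> {1..c}" by auto
      have "below i' j = Boundary (col_label c D j) \<or> (\<exists>i''. below i' j = Internal i'' j)"
        by (auto simp: below_def)
      then have below: "\<phi> (below i' j) = G (Suc i') j"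
        using potential_below[of i' G j] rule 2 i' j \<phi>T[OF j] by (auto simp: \<phi>_def)
      have "(x, below i' j) \<notin> left_edges k c D"
      proof
        assume "(x, below i' j) \<in> left_edges k c D"
        then have "below i' j = Internal i' (prev_dot D i' j)" and "\<exists>j'<j. (i', j') \<in> dots D"
          using left_edges_internal[OF 2(3)] 2(1) by (auto split: if_splits)
        with prev_dot(1)[of _ j i' D] show False by (auto simp: below_def split: if_splits)
      qed
      then have W: "?W (x, below i' j) = 1" by (simp add: edge_weight_def)
      have rr: "G i' j = G (Suc i') j + left_weight D w i' j * G i' (prev_dot D i' j)"
        using rule[of i'] 2 i' j by (simp add: row_rule_def)
      show ?thesis
      proof (cases "\<exists>j'<j. (i', j') \<in> dots D")
        case True
        have le: "(x, Internal i' (prev_dot D i' j)) \<in> left_edges k c D"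
          using left_edges_internal[OF 2(3)] True 2(1) by auto
        with \<open>(x, below i' j) \<notin> left_edges k c D\<close>
        have ne: "Internal i' (prev_dot D i' j) \<noteq> below i' j" by auto
        have "edges `` {x} = {Internal i' (prev_dot D i' j), below i' j}"
          using True by (auto simp: 2(1) Un_Image down_edges_internal[OF 2(3)] left_edges_internal[OF 2(3)])
        then show ?thesis
          using ne W below rr le True 2 by (simp add: edge_weight_def \<phi>_def left_weight_def)
      next
        case False
        have "edges `` {x} = {below i' j}"
          using False by (auto simp: 2(1) Un_Image down_edges_internal[OF 2(3)] left_edges_internal[OF 2(3)])
        then show ?thesis
          using W below rr False 2 by (simp add: \<phi>_def left_weight_def)
      qed
    qed
  qed
  have "(\<Sum>t \<in> ?T. walk_sum edges ?W ?src t * \<phi> t) = \<phi> ?src"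
  proof (rule walk_sum_potential[where rank=rank, OF rank_edge finite_edges _ _ closed harmonic])
    show "edges `` {t} = {}" if "t \<in> ?T" for t
      using that sink_no_edge by blast
    show "finite ?T" by simp
    show "?src \<in> Q" unfolding Q_def by blast
  qed
  moreover have "inj_on (\<lambda>j. Boundary (col_label c D j)) {1..c}"
    using inj_col unfolding inj_on_def by blast
  ultimately have "(\<Sum>j\<in>{1..c}. path_sum i j * \<phi> (Boundary (col_label c D j))) = \<phi> ?src"
    by (simp add: sum.reindex path_sum_eq)
  moreover have "(\<Sum>j\<in>{1..c}. path_sum i j * \<phi> (Boundary (col_label c D j)))
      = (\<Sum>j\<in>{1..c}. path_sum i j * G (Suc k) j)"
    using \<phi>T by (intro sum.cong) auto
  ultimately show ?thesis by (simp add: \<phi>_def)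
qed

end

section \<open>The positroid of \<open>D\<^sub>k\<^sub>,\<^sub>m(A)\<close>\<close>

text \<open>For \<open>p\<close> in \<open>{1..m}\<close> and \<open>l \<le> m\<close> this is the
  cyclic interval of \<open>l\<close> elements from \<open>p\<close> on; the last disjunct collects
  the part that wraps past \<open>m\<close>.\<close>

definition arc :: "nat \<Rightarrow> nat \<Rightarrow> nat \<Rightarrow> nat set" where
  "arc m p l = {x \<in> {1..m}. p \<le> x \<and> x < p + l \<or> x + m < p + l}"

lemma last_two_edge:
  assumes "successively P p" "2 \<le> length p"
  shows "P (last (butlast p)) (last p)"
proof -
  from assms(2) obtain q y where q: "p = q @ [y]" "q \<noteq> []"
    by (cases p rule: rev_cases) force+
  then obtain r x where "q = r @ [x]" by (cases q rule: rev_cases) auto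
  moreover from this q have "butlast p = r @ [x]" by (metis butlast_snoc)
  ultimately show ?thesis using q assms(1) by (simp add: successively_append_iff)
qed

text \<open>The conditions on \<open>A\<close> exclude cyclically consecutive elements, the pair of
  \<open>m\<close> and 1 included. As 1 belongs to \<open>A\<close>, the corner box is always
  removed.\<close>

locale le_positroid =
  fixes k m :: nat and A :: "nat set" and w :: "vertex \<times> vertex \<Rightarrow> real"
  assumes k: "3 \<le> k" and m: "k + 2 \<le> m"
    and A: "A \<subseteq> {1..m}" "1 \<in> A" "m \<notin> A" "\<And>l. l \<in> A \<Longrightarrow> Suc l \<notin> A"
    and w: "\<And>e. e \<in> left_edges k (m - k) (D_diagram k m A) \<Longrightarrow> 0 < w e"
begin

abbreviation c where "c \<equiv> m - k"
abbreviation D where "D \<equiv> D_diagram k m A"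

text \<open>Box \<open>(i, j)\<close> of the first row or column, other than the corner labeled 1, has label
  \<open>c + 1 + i - j\<close>.\<close>

definition missing :: "nat \<Rightarrow> nat \<Rightarrow> bool" where
  "missing i j \<longleftrightarrow> (i = 1 \<or> j = 1) \<and> c + 1 + i - j \<in> A"

lemma boxes_D: "(i, j) \<in> boxes D \<longleftrightarrow> i \<in> {1..k} \<and> j \<in> {1..c} \<and> (i, j) \<noteq> (k, c)"
  using A(2) by (auto simp: D_diagram_def D_boxes_def labeled_box_def)

lemma dots_D:
  "(i, j) \<in> dots D \<longleftrightarrow> i \<in> {1..k} \<and> j \<in> {1..c} \<and> (i, j) \<noteq> (k, c) \<and> \<not> missing i j"
proof (cases "i \<in> {1..k} \<and> j \<in> {1..c} \<and> (i, j) \<noteq> (k, c)")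
  case True
  have "(i, j) \<in> labeled_box k m ` A \<longleftrightarrow> missing i j"
  proof
    assume "(i, j) \<in> labeled_box k m ` A"
    then obtain l where l: "l \<in> A" "(i, j) = labeled_box k m l" by auto
    then have "1 \<le> l" "l \<le> m" using A(1) by auto
    with l True m have "(i = 1 \<or> j = 1) \<and> c + 1 + i - j = l"
      by (auto simp: labeled_box_def split: if_splits)
    with l(1) show "missing i j" by (auto simp: missing_def)
  next
    assume mis: "missing i j"
    have "labeled_box k m (c + 1 + i - j) = (i, j)"
      using True mis m k by (auto simp: missing_def labeled_box_def)
    with mis show "(i, j) \<in> labeled_box k m ` A" unfolding missing_def by (metis imageI)
  qed
  with True show ?thesis by (auto simp: D_diagram_def)
next
  case False
  with A(2) show ?thesis by (auto simp: D_diagram_def labeled_box_def)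
qed

text \<open>Removing the corner box swaps two steps of the border: the step of column
  \<open>c\<close> now comes before that of row \<open>k\<close>, so row \<open>k\<close> has label
  \<open>k + 1\<close> and column \<open>c\<close> has label \<open>k\<close>.\<close>

lemma row_label_D: "i \<in> {1..k} \<Longrightarrow> row_label c D i = (if i = k then k + 1 else i)"
proof -
  assume i: "i \<in> {1..k}"
  have "{j. (i, j) \<in> boxes D} = (if i = k then {1..c - 1} else {1..c})"
    using i m by (auto simp: boxes_D)
  with i m show ?thesis by (auto simp: row_label_def)
qed

lemma col_label_D: "j \<in> {1..c} \<Longrightarrow> col_label c D j = (if j = c then k else m - j + 1)"
proof -
  assume j: "j \<in> {1..c}"
  have "{i. (i, j) \<in> boxes D} = (if j = c then {1..k - 1} else {1..k})"
    using j k by (auto simp: boxes_D)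
  with j m k show ?thesis by (auto simp: col_label_def)
qed

sublocale network k c D w
proof
  show "dots D \<subseteq> {1..k} \<times> {1..c}" using dots_D by auto
  show "inj_on (row_label c D) {1..k}" by (auto simp: inj_on_def row_label_D split: if_splits)
  show "inj_on (col_label c D) {1..c}"
    using m by (auto simp: inj_on_def col_label_D split: if_splits)
  show "row_label c D i \<noteq> col_label c D j" if "i \<in> {1..k}" "j \<in> {1..c}" for i j
    using that m by (auto simp: col_label_D row_label_D)
qed

lemma labels: "row_label c D ` {1..k} \<union> col_label c D ` {1..c} = {1..m}"
proof (intro equalityI subsetI)
  fix x assume "x \<in> row_label c D ` {1..k} \<union> col_label c D ` {1..c}"
  then show "x \<in> {1..m}" using m k by (auto simp: row_label_D col_label_D)
next
  fix x assume x: "x \<in> {1..m}"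
  then consider "x < k" | "x = k" | "x = k + 1" | "k + 1 < x" by linarith
  then show "x \<in> row_label c D ` {1..k} \<union> col_label c D ` {1..c}"
  proof cases
    case 1
    then have "row_label c D x = x" "x \<in> {1..k}" using x by (auto simp: row_label_D)
    then show ?thesis by (metis UnI1 imageI)
  next
    case 2
    then have "col_label c D c = x" "c \<in> {1..c}" using m by (auto simp: col_label_D)
    then show ?thesis by (metis UnI2 imageI)
  next
    case 3
    then have "row_label c D k = x" "k \<in> {1..k}" using k by (auto simp: row_label_D)
    then show ?thesis by (metis UnI1 imageI)
  next
    case 4
    then have "m + 1 - x \<in> {1..c}" "m + 1 - x \<noteq> c" using x by auto
    moreover from this have "col_label c D (m + 1 - x) = x" using x by (simp add: col_label_D)
    ultimately have "col_label c D (m + 1 - x) = x" "m + 1 - x \<in> {1..c}" by auto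
    then show ?thesis by (metis UnI2 imageI)
  qed
qed

lemma sum_labels:
  assumes "I \<subseteq> {1..m}"
  shows "sum F I = (\<Sum>i\<in>{1..k}. if row_label c D i \<in> I then F (row_label c D i) else 0)
    + (\<Sum>j\<in>{1..c}. if col_label c D j \<in> I then F (col_label c D j) else 0)"
proof -
  have "sum F I = (\<Sum>x\<in>{1..m}. if x \<in> I then F x else 0)"
    using assms by (simp add: sum.inter_restrict[symmetric] Int_absorb1)
  also have "\<dots> = (\<Sum>x\<in>row_label c D ` {1..k}. if x \<in> I then F x else 0)
      + (\<Sum>x\<in>col_label c D ` {1..c}. if x \<in> I then F x else 0)"
    unfolding labels[symmetric] using row_col by (intro sum.union_disjoint) auto
  finally show ?thesis by (simp only: sum.reindex[OF inj_row] sum.reindex[OF inj_col] o_def)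
qed

lemma sources_D: "sources k c D = insert (k + 1) {1..k - 1}"
  unfolding sources_def using k by (auto simp: row_label_D image_iff Bex_def)

lemma card_sources: "finite (sources k c D)" "card (sources k c D) = k"
  using k by (auto simp: sources_D)

text \<open>The rightmost box of every row keeps its dot. Box \<open>(1, c)\<close> has label 2,
  which is not in \<open>A\<close> next to 1; box \<open>(k, c - 1)\<close> lies in the first column
  only if \<open>c = 2\<close>, and then its label is \<open>m\<close>, again not in
  \<open>A\<close>.\<close>

lemma last_dot_D: "i \<in> {1..k} \<Longrightarrow> last_dot D i = (if i = k then c - 1 else c)"
  and last_dot_dot: "i \<in> {1..k} \<Longrightarrow> (i, last_dot D i) \<in> dots D"
proof -
  assume i: "i \<in> {1..k}"
  have "Suc (Suc 0) \<notin> A" using A(2) A(4)[of 1] by auto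
  with i A(3) m k have dot: "(i, if i = k then c - 1 else c) \<in> dots D"
    by (cases "k + 2 = m") (auto simp: dots_D missing_def)
  then show "(i, last_dot D i) \<in> dots D" by (rule last_dot(1))
  with last_dot(2)[OF dot] i m show "last_dot D i = (if i = k then c - 1 else c)"
    by (auto simp: dots_D split: if_splits)
qed

text \<open>Below the first row, boxes without a dot occur only in column 1 and at the corner, so
  the nearest dot to the left is adjacent. This fails in the first row, where an edge can jump over
  a missing dot.\<close>

lemma prev_dot_D:
  assumes "2 \<le> i" "2 \<le> j" "left_weight D w i j \<noteq> 0"
  shows "prev_dot D i j = j - 1"
proof -
  from assms(3) obtain j' where j': "(i, j) \<in> dots D" "j' < j" "(i, j') \<in> dots D"
    by (auto simp: left_weight_def split: if_splits)
  note pd = prev_dot[OF j'(2,3)]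
  show ?thesis
  proof (cases "j = 2")
    case True
    with pd(1) dotsD[OF pd(2)] show ?thesis by auto
  next
    case False
    with assms j'(1) have "(i, j - 1) \<in> dots D" by (auto simp: dots_D missing_def)
    with prev_dot(3)[of "j - 1" j i D] pd(1) assms show ?thesis by auto
  qed
qed

lemma left_weight_pos:
  assumes "(i, j) \<in> dots D" "j' < j" "(i, j') \<in> dots D"
  shows "0 < left_weight D w i j"
  using left_edges_internal[OF assms(1)] assms w by (auto simp: left_weight_def split: if_splits)

lemma left_weight_nonneg: "0 \<le> left_weight D w i j"
proof (cases "(i, j) \<in> dots D \<and> (\<exists>j'<j. (i, j') \<in> dots D)")
  case True
  then show ?thesis using left_weight_pos[of i j] by (auto intro: less_imp_le)
qed (auto simp: left_weight_def)

text \<open>The two exceptions are the removed corner and a dot of column 2 that is leftmost in its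
  row because box \<open>(i, 1)\<close>, of label \<open>i + c\<close>, is missing.\<close>

lemma left_weight_pos_iff:
  assumes "i \<in> {2..k}" "j \<in> {2..c}"
  shows "0 < left_weight D w i j \<longleftrightarrow> (i, j) \<noteq> (k, c) \<and> \<not> (j = 2 \<and> i + c \<in> A)"
proof
  assume "0 < left_weight D w i j"
  then obtain j' where "(i, j) \<in> dots D" "j' < j" "(i, j') \<in> dots D"
    by (auto simp: left_weight_def split: if_splits)
  then show "(i, j) \<noteq> (k, c) \<and> \<not> (j = 2 \<and> i + c \<in> A)"
    by (cases "j' = 1") (auto simp: dots_D missing_def add.commute)
next
  assume *: "(i, j) \<noteq> (k, c) \<and> \<not> (j = 2 \<and> i + c \<in> A)"
  with assms have "(i, j) \<in> dots D" by (auto simp: dots_D missing_def)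
  moreover have "(i, j - 1) \<in> dots D"
    using * assms by (cases "j = 2") (auto simp: dots_D missing_def add.commute)
  ultimately show "0 < left_weight D w i j" using assms by (intro left_weight_pos[of i j "j - 1"]) auto
qed

lemma bidiagonal_row:
  assumes "row_rule c D w i G" "2 \<le> i"
  shows "bidiagonal (left_weight D w i) (G i) (G (Suc i)) c"
proof
  show "0 \<le> left_weight D w i j" for j by (rule left_weight_nonneg)
  have "left_weight D w i 1 = 0" by (auto simp: left_weight_def dots_D)
  with assms(1) m show "G (Suc i) 1 = G i 1" by (auto simp: row_rule_def)
  show "G (Suc i) j = G i j - left_weight D w i j * G i (j - 1)" if "j \<in> {2..c}" for j
    using assms that prev_dot_D[of i j]
    by (cases "left_weight D w i j = 0") (auto simp: row_rule_def)
qed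

section \<open>Signs of the measurement matrix and the kernel criterion\<close>

text \<open>No edge enters a source, so only the empty path contributes.\<close>

lemma Meas_source:
  assumes "i \<in> {1..k}" "i' \<in> {1..k}"
  shows "Meas k c D w (row_label c D i) (row_label c D i') = (if i = i' then 1 else 0)"
proof -
  have single: "length p = 1" if p: "p \<in> paths k c D (row_label c D i) (row_label c D i')" for p
  proof (rule ccontr)
    assume "length p \<noteq> 1"
    with p have "2 \<le> length p" by (cases p; cases "tl p") (auto simp: paths_def)
    with p have "(last (butlast p), Boundary (row_label c D i')) \<in> edges"
      using last_two_edge[of "\<lambda>u v. (u, v) \<in> edges" p] by (auto simp: paths_def)
    then show False
    proof (cases rule: edge_cases)
      case (sink l j)
      with dotsD[OF sink(3)] row_col[of i' j] assms show ?thesis by auto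
    qed auto
  qed
  have "paths k c D (row_label c D i) (row_label c D i') =
      (if i = i' then {[Boundary (row_label c D i)]} else {})"
  proof (cases "i = i'")
    case True
    have "p = [Boundary (row_label c D i)]"
      if "p \<in> paths k c D (row_label c D i) (row_label c D i)" for p
      using that single[of p] True by (auto simp: paths_def length_Suc_conv)
    with True show ?thesis by (auto simp: paths_def)
  next
    case False
    then have "row_label c D i \<noteq> row_label c D i'" using assms inj_row by (auto dest: inj_onD)
    then have "p \<notin> paths k c D (row_label c D i) (row_label c D i')" for p
      using single[of p] by (auto simp: paths_def length_Suc_conv)
    with False show ?thesis by auto
  qed
  note paths = this
  have none: "{s \<in> sources k c D. min x x < s \<and> s < max x x} = {}" for x by auto
  show ?thesis
  proof (cases "i = i'")
    case True
    with paths show ?thesis unfolding Meas_def True none by (simp add: path_weight_def)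
  qed (simp add: Meas_def paths)
qed

text \<open>All dots of row \<open>k\<close> and all steps from there lie left of column
  \<open>c\<close>, so no path exists. A potential that is a unit vector at column \<open>c\<close>
  shows this without inspecting paths.\<close>

lemma path_sum_corner: "path_sum k c = 0"
proof -
  have "\<exists>G. G k = (\<lambda>j. if j = c then 1 else 0) \<and> (\<forall>i\<ge>k. row_rule c D w i G)"
    by (rule exists_potential_from_top)
  then obtain G where G: "G k = (\<lambda>j. if j = c then 1 else 0)" "\<And>i. i \<ge> k \<Longrightarrow> row_rule c D w i G"
    by blast
  have "G (Suc k) j = (if j = c then 1 else 0)" if j: "j \<in> {1..c}" for j
  proof -
    interpret bidiagonal "left_weight D w k" "G k" "G (Suc k)" c
      using bidiagonal_row[of k G] G(2) k by simp
    show ?thesis using h_1 h_eq[of j] j m by (cases "j = 1") (auto simp: G(1))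
  qed
  moreover have "(\<Sum>j\<in>{1..c}. path_sum k j * G (Suc k) j) = 0"
    using path_sum_potential[of k G k "last_dot D k"] G last_dot_dot[of k] last_dot_D[of k] k m by auto
  ultimately have "(\<Sum>j\<in>{1..c}. path_sum k j * (if j = c then 1 else 0)) = 0" by simp
  moreover have "(\<Sum>j\<in>{1..c}. path_sum k j * (if j = c then 1 else 0))
      = (\<Sum>j\<in>{1..c}. if j = c then path_sum k j else 0)"
    by (intro sum.cong) auto
  moreover have "\<dots> = path_sum k c" using m by (subst sum.delta) auto
  ultimately show ?thesis by simp
qed

text \<open>The label \<open>k\<close> of column \<open>c\<close> lies before the source
  \<open>k + 1\<close>, the other column labels lie after it. So for a source above row
  \<open>k\<close> one source fewer lies between it and column \<open>c\<close>.\<close>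

definition col_sign :: "nat \<Rightarrow> real" where
  "col_sign j = (if j = c then - 1 else 1)"

text \<open>The sign splits into a factor for the row and a factor for the column. Both can be
  absorbed when the kernel vector is rescaled, so no signs are left in the criterion for singular
  minors.\<close>

lemma Meas_sink:
  assumes i: "i \<in> {1..k}" and j: "j \<in> {1..c}"
  shows "Meas k c D w (row_label c D i) (col_label c D j) = (- 1) ^ (k - i) * col_sign j * path_sum i j"
proof (cases "i = k \<and> j = c")
  case True
  with path_sum_corner show ?thesis
    by (simp add: Meas_def path_sum_def flip: sum_distrib_left)
next
  case False
  let ?S = "{s \<in> sources k c D. min (row_label c D i) (col_label c D j) < s
      \<and> s < max (row_label c D i) (col_label c D j)}"
  have S: "?S = (if i = k then {} else if j = c then {i + 1..k - 1} else insert (k + 1) {i + 1..k - 1})"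
  proof (cases "i = k")
    case True
    with False i j have "row_label c D i = k + 1" "col_label c D j = m - j + 1" "k + 1 < m - j + 1"
      by (auto simp: row_label_D col_label_D)
    with True show ?thesis by (auto simp: sources_D)
  next
    case ik: False
    then have r: "row_label c D i = i" "i < k" using i by (auto simp: row_label_D)
    show ?thesis
    proof (cases "j = c")
      case True
      with j have "col_label c D j = k" by (simp add: col_label_D)
      with r True show ?thesis by (auto simp: sources_D)
    next
      case False
      with j have "col_label c D j = m - j + 1" "k + 1 < m - j + 1" by (auto simp: col_label_D)
      with r False show ?thesis by (auto simp: sources_D)
    qed
  qed
  then have "card ?S = (if i = k then 0 else if j = c then k - 1 - i else Suc (k - 1 - i))"
    unfolding S by (auto simp: card_insert_if)
  moreover have "k - i = Suc (k - 1 - i)" if "i \<noteq> k" using i that by auto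
  ultimately have "(- 1 :: real) ^ card ?S = (- 1) ^ (k - i) * col_sign j"
    using False by (simp add: col_sign_def)
  then show ?thesis unfolding Meas_def path_sum_def by (simp only: sum_distrib_left)
qed

text \<open>The source columns of \<open>Meas\<close> form an identity matrix. Hence a row whose
  source is in \<open>I\<close> merely determines the coordinate at that source, and only the rows
  outside of \<open>I\<close> restrict the coordinates at the sinks.\<close>

lemma singular_iff:
  assumes I: "I \<subseteq> {1..m}" "card I = k"
  shows "det (Meas_submatrix k c D w I) = 0 \<longleftrightarrow>
    (\<exists>u. (\<exists>j\<in>{1..c}. u j \<noteq> 0) \<and> (\<forall>j\<in>{1..c}. col_label c D j \<notin> I \<longrightarrow> u j = 0) \<and>
      (\<forall>i\<in>{1..k}. row_label c D i \<notin> I \<longrightarrow> (\<Sum>j\<in>{1..c}. path_sum i j * u j) = 0))"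
    (is "_ \<longleftrightarrow> ?R")
proof -
  have finI: "finite I" using I(1) finite_subset by blast
  have Meas_sum: "(\<Sum>l\<in>I. Meas k c D w (row_label c D i) l * v l) =
      (if row_label c D i \<in> I then v (row_label c D i) else 0) + (- 1) ^ (k - i) *
        (\<Sum>j\<in>{1..c}. path_sum i j * (if col_label c D j \<in> I then col_sign j * v (col_label c D j) else 0))"
    if i: "i \<in> {1..k}" for i v
  proof -
    have "(\<Sum>i'\<in>{1..k}. if row_label c D i' \<in> I
        then Meas k c D w (row_label c D i) (row_label c D i') * v (row_label c D i') else 0)
      = (\<Sum>i'\<in>{1..k}. if i' = i then (if row_label c D i \<in> I then v (row_label c D i) else 0) else 0)"
      using i by (intro sum.cong) (auto simp: Meas_source)
    also have "\<dots> = (if row_label c D i \<in> I then v (row_label c D i) else 0)"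
      using i by simp
    finally show ?thesis
      unfolding sum_labels[OF I(1)] sum_distrib_left
      by (intro arg_cong2[where f="(+)"] sum.cong) (use i in \<open>auto simp: Meas_sink\<close>)
  qed
  have "det (Meas_submatrix k c D w I) = 0 \<longleftrightarrow>
      (\<exists>v. (\<exists>y\<in>I. v y \<noteq> 0) \<and> (\<forall>x\<in>sources k c D. (\<Sum>y\<in>I. Meas k c D w x y * v y) = 0))"
    unfolding Meas_submatrix_def
    by (rule det_eq_0_iff_kernel) (use card_sources finI I(2) in auto)
  also have "\<dots> \<longleftrightarrow> ?R"
  proof
    assume "\<exists>v. (\<exists>y\<in>I. v y \<noteq> 0) \<and> (\<forall>x\<in>sources k c D. (\<Sum>y\<in>I. Meas k c D w x y * v y) = 0)"
    then obtain v where v: "\<exists>y\<in>I. v y \<noteq> 0"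
      "\<And>i. i \<in> {1..k} \<Longrightarrow> (\<Sum>y\<in>I. Meas k c D w (row_label c D i) y * v y) = 0"
      unfolding sources_def by blast
    define u where "u j = (if col_label c D j \<in> I then col_sign j * v (col_label c D j) else 0)" for j
    have eq: "(if row_label c D i \<in> I then v (row_label c D i) else 0)
        + (- 1) ^ (k - i) * (\<Sum>j\<in>{1..c}. path_sum i j * u j) = 0" if "i \<in> {1..k}" for i
      using v(2)[OF that] Meas_sum[OF that, of v] by (simp add: u_def)
    have "\<exists>j\<in>{1..c}. u j \<noteq> 0"
    proof (rule ccontr)
      assume "\<not> ?thesis"
      then have u0: "\<And>j. j \<in> {1..c} \<Longrightarrow> u j = 0" by blast
      from v(1) obtain y where y: "y \<in> I" "v y \<noteq> 0" by blast
      with I(1) labels consider i where "i \<in> {1..k}" "y = row_label c D i"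
        | j where "j \<in> {1..c}" "y = col_label c D j" by blast
      then show False
      proof cases
        case 1
        with eq[of i] y u0 show ?thesis by simp
      next
        case 2
        with u0[of j] y show ?thesis by (auto simp: u_def col_sign_def split: if_splits)
      qed
    qed
    moreover have "\<forall>i\<in>{1..k}. row_label c D i \<notin> I \<longrightarrow> (\<Sum>j\<in>{1..c}. path_sum i j * u j) = 0"
    proof (intro ballI impI)
      fix i assume "i \<in> {1..k}" "row_label c D i \<notin> I"
      with eq[of i] show "(\<Sum>j\<in>{1..c}. path_sum i j * u j) = 0" by simp
    qed
    ultimately show ?R by (intro exI[of _ u]) (auto simp: u_def)
  next
    assume ?R
    then obtain u j\<^sub>0 where u: "j\<^sub>0 \<in> {1..c}" "u j\<^sub>0 \<noteq> 0"
      "\<And>j. j \<in> {1..c} \<Longrightarrow> col_label c D j \<notin> I \<Longrightarrow> u j = 0"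
      "\<And>i. i \<in> {1..k} \<Longrightarrow> row_label c D i \<notin> I \<Longrightarrow> (\<Sum>j\<in>{1..c}. path_sum i j * u j) = 0"
      by blast
    \<comment> \<open>The coordinate at a source is chosen to cancel the sum over the sinks in its
      row.\<close>
    define v where "v y = (if y \<in> sources k c D
      then (let i = inv_into {1..k} (row_label c D) y
            in - ((- 1) ^ (k - i) * (\<Sum>j\<in>{1..c}. path_sum i j * u j)))
      else (let j = inv_into {1..c} (col_label c D) y in col_sign j * u j))" for y
    have v_row: "v (row_label c D i) = - ((- 1) ^ (k - i) * (\<Sum>j\<in>{1..c}. path_sum i j * u j))"
      if "i \<in> {1..k}" for i
      using that inv_into_f_f[OF inj_row that] by (auto simp: v_def sources_def)
    have v_col: "v (col_label c D j) = col_sign j * u j" if "j \<in> {1..c}" for j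
    proof -
      have "col_label c D j \<notin> sources k c D" using row_col[OF _ that] by (fastforce simp: sources_def)
      with inv_into_f_f[OF inj_col that] show ?thesis by (simp add: v_def)
    qed
    have "(\<Sum>y\<in>I. Meas k c D w (row_label c D i) y * v y) = 0" if i: "i \<in> {1..k}" for i
    proof -
      have "(\<Sum>j\<in>{1..c}. path_sum i j * (if col_label c D j \<in> I then col_sign j * v (col_label c D j) else 0))
        = (\<Sum>j\<in>{1..c}. path_sum i j * u j)"
        by (intro sum.cong) (auto simp: v_col u(3) col_sign_def)
      with Meas_sum[OF i, of v] v_row[OF i] u(4)[OF i] show ?thesis by auto
    qed
    moreover have "\<exists>y\<in>I. v y \<noteq> 0"
      using u(1-3) v_col[OF u(1)] by (intro bexI[of _ "col_label c D j\<^sub>0"]) (auto simp: col_sign_def)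
    ultimately show "\<exists>v. (\<exists>y\<in>I. v y \<noteq> 0) \<and> (\<forall>x\<in>sources k c D. (\<Sum>y\<in>I. Meas k c D w x y * v y) = 0)"
      by (intro exI[of _ v]) (auto simp: sources_def)
  qed
  finally show ?thesis .
qed

lemma singular_potential:
  assumes I: "I \<subseteq> {1..m}" "card I = k" and det: "det (Meas_submatrix k c D w I) = 0"
  obtains G where "\<And>i. i \<in> {1..k} \<Longrightarrow> row_rule c D w i G"
    "\<exists>j\<in>{1..c}. G (Suc k) j \<noteq> 0"
    "\<And>j. j \<in> {1..c} \<Longrightarrow> col_label c D j \<notin> I \<Longrightarrow> G (Suc k) j = 0"
    "\<And>i. i \<in> {1..k} \<Longrightarrow> row_label c D i \<notin> I \<Longrightarrow> G i (last_dot D i) = 0"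
proof -
  from det singular_iff[OF I] obtain u where u: "\<exists>j\<in>{1..c}. u j \<noteq> 0"
      "\<And>j. j \<in> {1..c} \<Longrightarrow> col_label c D j \<notin> I \<Longrightarrow> u j = 0"
      "\<And>i. i \<in> {1..k} \<Longrightarrow> row_label c D i \<notin> I \<Longrightarrow> (\<Sum>j\<in>{1..c}. path_sum i j * u j) = 0"
    by blast
  have "\<exists>G. G (Suc k) = u \<and> (\<forall>i\<in>{1..k}. row_rule c D w i G)" by (rule exists_potential_from_bottom)
  then obtain G where G: "G (Suc k) = u" "\<And>i. i \<in> {1..k} \<Longrightarrow> row_rule c D w i G" by blast
  have "G i (last_dot D i) = 0" if i: "i \<in> {1..k}" "row_label c D i \<notin> I" for i
  proof -
    have "(Boundary (row_label c D i), Internal i (last_dot D i)) \<in> left_edges k c D"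
      by (rule source_edge_left[OF i(1) last_dot_dot[OF i(1)]])
    then have "w (Boundary (row_label c D i), Internal i (last_dot D i)) > 0" by (rule w)
    with path_sum_potential[of 1 G i "last_dot D i"] G u(3)[OF i] i(1) last_dot_dot[OF i(1)]
    show ?thesis by auto
  qed
  with that[of G] G u show ?thesis by blast
qed

text \<open>The sources of the rows above \<open>s\<close> belong to \<open>I\<close> and impose no
  condition, so the potential may start in row \<open>s\<close>.\<close>

lemma singularI:
  assumes I: "I \<subseteq> {1..m}" "card I = k"
    and G: "\<And>i. s \<le> i \<Longrightarrow> i \<le> k \<Longrightarrow> row_rule c D w i G"
      "\<exists>j\<in>{1..c}. G (Suc k) j \<noteq> 0"
      "\<And>j. j \<in> {1..c} \<Longrightarrow> col_label c D j \<notin> I \<Longrightarrow> G (Suc k) j = 0"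
      "\<And>i. i \<in> {1..k} \<Longrightarrow> row_label c D i \<notin> I \<Longrightarrow> s \<le> i \<and> G i (last_dot D i) = 0"
  shows "det (Meas_submatrix k c D w I) = 0"
proof -
  have "(\<Sum>j\<in>{1..c}. path_sum i j * G (Suc k) j) = 0"
    if "i \<in> {1..k}" "row_label c D i \<notin> I" for i
    using path_sum_potential[of s G i "last_dot D i"] G(1,4) that last_dot_dot[of i] by auto
  with G(2,3) show ?thesis unfolding singular_iff[OF I] by blast
qed

end

lemma alternating_on_single:
  assumes "g p \<noteq> 0" "\<And>j. j \<in> {1..c} \<Longrightarrow> j \<noteq> p \<Longrightarrow> g j = 0"
  shows "alternating_on c g p p"
proof -
  have "0 < ((- 1) ^ p * g p) * (- 1) ^ p * g p"
    using assms(1) by (cases "even p") (auto simp: zero_less_mult_iff neq_iff)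
  with assms(2) show ?thesis
    unfolding alternating_on_def by (intro exI[of _ "(- 1) ^ p * g p"]) auto
qed

section \<open>Sign blocks of a potential, row by row\<close>

context le_positroid
begin

text \<open>\<open>R\<close> is the set of rows whose sources are not in the tested basis. Each of these rows costs one
  sign block, so \<open>surplus\<close> rules out a kernel vector; \<open>tight\<close> describes the only way in which a
  missing dot can prevent this.\<close>

definition surplus :: "nat set \<Rightarrow> (nat \<Rightarrow> nat \<Rightarrow> real) \<Rightarrow> nat \<Rightarrow> bool" where
  "surplus R G i \<longleftrightarrow> card (R \<inter> {1..<i}) < sign_blocks (G i) c"

definition tight :: "nat set \<Rightarrow> (nat \<Rightarrow> nat \<Rightarrow> real) \<Rightarrow> nat \<Rightarrow> bool" where
  "tight R G i \<longleftrightarrow> (\<exists>s p q. missing s p \<and> 1 \<le> s \<and> 1 \<le> p \<and> p < c \<and> p \<le> q \<and> q \<le> c \<and>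
     alternating_on c (G i) p q \<and> R \<inter> {1..<i} = {s..s + (q - p)} \<and> s + (q - p) < i \<and>
     (q = c \<or> s + (q - p) + 1 = i))"

lemma tightI:
  assumes "missing s p" "1 \<le> s" "1 \<le> p" "p < c" "p \<le> q" "q \<le> c" "alternating_on c (G i) p q"
    "R \<inter> {1..<i} = {s..s + (q - p)}" "s + (q - p) < i" "q = c \<or> s + (q - p) + 1 = i"
  shows "tight R G i"
  unfolding tight_def using assms by blast

lemma potential_row_nonzero:
  assumes "row_rule c D w i G" "\<exists>j\<in>{1..c}. G (Suc i) j \<noteq> 0"
  shows "\<exists>j\<in>{1..c}. G i j \<noteq> 0"
proof (rule ccontr)
  assume "\<not> ?thesis"
  then have 0: "\<And>j. j \<in> {1..c} \<Longrightarrow> G i j = 0" by blast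
  have "left_weight D w i j * G i (prev_dot D i j) = 0" for j
  proof (cases "left_weight D w i j = 0")
    case False
    then obtain j' where "j' < j" "(i, j') \<in> dots D"
      by (auto simp: left_weight_def split: if_splits)
    then have "(i, prev_dot D i j) \<in> dots D" by (rule prev_dot(2))
    with dotsD 0 show ?thesis by simp
  qed simp
  with assms 0 show False by (auto simp: row_rule_def)
qed

lemma missing_neighbour:
  assumes "missing s 1"
  shows "Suc s + c \<notin> A"
  using assms A(4)[of "c + s"] by (auto simp: missing_def add.commute)

text \<open>A row in \<open>R\<close> has a zero in the last column and hence gains a block, unless
  all nonzero entries are cut off from the columns to their right. This happens only for a multiple
  of the unit vector at a missing box \<open>(i, 1)\<close>; it has a single block, so no earlier
  row is in \<open>R\<close>, and a tight phase begins.\<close>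

lemma surplus_step:
  assumes i: "2 \<le> i" "i < k" and rule: "row_rule c D w i G"
    and F: "i \<in> R \<Longrightarrow> G i c = 0" and nz: "\<exists>j\<in>{1..c}. G i j \<noteq> 0" and sur: "surplus R G i"
  shows "surplus R G (Suc i) \<or> tight R G (Suc i)"
proof -
  interpret bidiagonal "left_weight D w i" "G i" "G (Suc i)" c
    using rule i(1) by (rule bidiagonal_row)
  have mono: "sign_blocks (G i) c \<le> sign_blocks (G (Suc i)) c" by (rule sign_blocks_le) simp
  show ?thesis
  proof (cases "i \<in> R")
    case False
    with i have "R \<inter> {1..<Suc i} = R \<inter> {1..<i}" by (auto simp: less_Suc_eq)
    with sur mono show ?thesis by (simp add: surplus_def)
  next
    case True
    with i have R: "R \<inter> {1..<Suc i} = insert i (R \<inter> {1..<i})" by (auto simp: less_Suc_eq)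
    then have card_R: "card (R \<inter> {1..<Suc i}) = Suc (card (R \<inter> {1..<i}))" by simp
    \<comment> \<open>If box \<open>(i, 1)\<close> is missing, column 1 passes nothing to column 2,
      so only a nonzero entry from column 2 on yields a new block.\<close>
    define b where "b = (if i + c \<in> A then 2 else 1 :: nat)"
    show ?thesis
    proof (cases "\<exists>j\<in>{b..c}. G i j \<noteq> 0")
      case ex: True
      have pos: "0 < left_weight D w i j" if "b < j" "j \<le> c" for j
        using that i left_weight_pos_iff[of i j] by (auto simp: b_def split: if_splits)
      have "sign_blocks (G i) c < sign_blocks (G (Suc i)) c"
        by (rule sign_blocks_less_aux[OF _ pos _ F[OF True] ex]; (assumption | simp add: b_def))
      with sur card_R show ?thesis by (simp add: surplus_def)
    next
      case False
      with nz have iA: "i + c \<in> A" by (auto simp: b_def split: if_splits)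
      with False have G0: "\<And>j. j \<in> {2..c} \<Longrightarrow> G i j = 0" by (auto simp: b_def)
      have G1: "G i 1 \<noteq> 0"
      proof
        assume "G i 1 = 0"
        with G0 have "G i j = 0" if "j \<in> {1..c}" for j using that by (cases "j = 1") auto
        with nz show False by blast
      qed
      have supp: "{j \<in> {1..c}. G i j \<noteq> 0} \<subseteq> {1}"
      proof
        fix j assume "j \<in> {j \<in> {1..c}. G i j \<noteq> 0}"
        with G0[of j] show "j \<in> {1}" by (cases "j = 1") auto
      qed
      have "card {j \<in> {1..c}. G i j \<noteq> 0} \<le> 1"
        using card_mono[OF _ supp] by simp
      with sign_blocks_le_card_support[of "G i" c] sur have "card (R \<inter> {1..<i}) = 0"
        unfolding surplus_def by linarith
      have "alternating_on c (G i) 1 1"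
        by (rule alternating_on_single[of "G i" 1, OF G1]) (use G0 in force)
      from alternating_step[OF this, unfolded one_add_one] m
      have "alternating_on c (G (Suc i)) 1 (if 2 \<le> c \<and> 0 < left_weight D w i 2 then 2 else 1)"
        by simp
      moreover have "\<not> 0 < left_weight D w i 2"
        using left_weight_pos_iff[of i 2] iA i m by auto
      ultimately have "alternating_on c (G (Suc i)) 1 1" by simp
      moreover have "missing i 1" using iA by (simp add: missing_def add.commute)
      moreover have "R \<inter> {1..<Suc i} = {i..i + (1 - 1)}" using R \<open>card (R \<inter> {1..<i}) = 0\<close> by simp
      ultimately have "tight R G (Suc i)"
        using i m by (intro tightI[of i 1 1]) simp_all
      then show ?thesis ..
    qed
  qed
qed

text \<open>In the tight state the unit vector at the missing box \<open>(s, p)\<close> has spread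
  to the columns \<open>p\<close> to \<open>q\<close>, with exactly as many blocks as rows spent.
  While \<open>q < c\<close> the support grows in every row: a row in \<open>R\<close> keeps the
  balance, any other row turns it into a surplus. Once \<open>q = c\<close> the last entry is
  nonzero, so no further row is in \<open>R\<close>.\<close>

lemma tight_step:
  assumes i: "2 \<le> i" "i < k" and rule: "row_rule c D w i G"
    and F: "i \<in> R \<Longrightarrow> G i c = 0" and tight: "tight R G i"
  shows "surplus R G (Suc i) \<or> tight R G (Suc i)"
proof -
  interpret bidiagonal "left_weight D w i" "G i" "G (Suc i)" c
    using rule i(1) by (rule bidiagonal_row)
  from tight obtain s p q where spq: "missing s p" "1 \<le> s" "1 \<le> p" "p < c" "p \<le> q" "q \<le> c"
    "alternating_on c (G i) p q" "R \<inter> {1..<i} = {s..s + (q - p)}" "s + (q - p) < i"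
    "q = c \<or> s + (q - p) + 1 = i"
    unfolding tight_def by blast
  have alt: "alternating_on c (G (Suc i)) p
      (if q + 1 \<le> c \<and> 0 < left_weight D w i (q + 1) then q + 1 else q)"
    using spq by (intro alternating_step) auto
  have R: "R \<inter> {1..<Suc i} = (if i \<in> R then insert i (R \<inter> {1..<i}) else R \<inter> {1..<i})"
    using i by (cases "i \<in> R") (auto simp: less_Suc_eq)
  show ?thesis
  proof (cases "q = c")
    case True
    have "G i c \<noteq> 0" using alternating_on_nonzero_iff[OF spq(7), of c] spq(3-6) True by simp
    with F have "i \<notin> R" by blast
    with R spq(8) have R': "R \<inter> {1..<Suc i} = {s..s + (q - p)}" by simp
    from alt True have "alternating_on c (G (Suc i)) p q" by simp
    from tightI[where G=G and i="Suc i", OF spq(1-6) this R'] spq(9) True show ?thesis by simp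
  next
    case False
    with spq have q: "q + 1 \<le> c" "s + (q - p) + 1 = i" by auto
    \<comment> \<open>Here column 2 could be cut off only by a missing box \<open>(i, 1)\<close>,
      directly below the missing box \<open>(s, 1)\<close>, contrary to the separation of
      \<open>A\<close>.\<close>
    have "\<not> (q + 1 = 2 \<and> i + c \<in> A)"
    proof
      assume *: "q + 1 = 2 \<and> i + c \<in> A"
      with spq q have "p = 1" "i = Suc s" by auto
      with spq(1) missing_neighbour * show False by auto
    qed
    with left_weight_pos_iff[of i "q + 1"] i spq q have "0 < left_weight D w i (q + 1)" by auto
    with alt q have alt: "alternating_on c (G (Suc i)) p (q + 1)" by simp
    show ?thesis
    proof (cases "i \<in> R")
      case True
      have "s + (q + 1 - p) = i" using spq(5) q(2) by linarith
      moreover have "insert i {s..s + (q - p)} = {s..i}" using q(2) by auto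
      ultimately have R': "R \<inter> {1..<Suc i} = {s..s + (q + 1 - p)}"
        using R True spq(8) by simp
      have "p \<le> q + 1" using spq(5) by simp
      from tightI[where G=G and i="Suc i", OF spq(1-4) this q(1) alt R'] \<open>s + (q + 1 - p) = i\<close> show ?thesis by simp
    next
      case False
      with R spq(8) have "card (R \<inter> {1..<Suc i}) = q - p + 1" by simp
      moreover have "q + 1 - p + 1 \<le> sign_blocks (G (Suc i)) c"
        using alt spq q by (intro sign_blocks_alternating) auto
      ultimately have "surplus R G (Suc i)" unfolding surplus_def using spq(5) by linarith
      then show ?thesis ..
    qed
  qed
qed

text \<open>Solved for \<open>G 1\<close>, the row rule only adds, with positive weights. If
  \<open>G 2\<close> has one sign, nothing cancels, and a zero of \<open>G 1\<close> at a dot forces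
  zeros of \<open>G 2\<close> at all dots up to it.\<close>

lemma first_row_sign:
  assumes rule: "row_rule c D w 1 G" and pos: "\<And>j. j \<in> {1..c} \<Longrightarrow> 0 \<le> \<sigma> * G 2 j"
    and "\<sigma> \<noteq> 0" and "(1, j) \<in> dots D"
  shows "0 \<le> \<sigma> * G 1 j \<and> (G 1 j = 0 \<longrightarrow> (\<forall>j'\<le>j. (1, j') \<in> dots D \<longrightarrow> G 2 j' = 0))"
  using assms(4)
proof (induction j rule: less_induct)
  case (less j)
  have j: "j \<in> {1..c}" using dotsD[OF less.prems] by simp
  have eq: "\<sigma> * G 1 j = \<sigma> * G 2 j + left_weight D w 1 j * (\<sigma> * G 1 (prev_dot D 1 j))"
  proof -
    have "G 1 j = G 2 j + left_weight D w 1 j * G 1 (prev_dot D 1 j)"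
      using rule j by (simp add: row_rule_def numeral_2_eq_2)
    then show ?thesis by (simp only: distrib_left) simp
  qed
  show ?case
  proof (cases "\<exists>j'<j. (1, j') \<in> dots D")
    case False
    then have "left_weight D w 1 j = 0" by (auto simp: left_weight_def)
    with eq pos[OF j] \<open>\<sigma> \<noteq> 0\<close> False show ?thesis by (auto simp: le_less)
  next
    case True
    then obtain j' where j': "j' < j" "(1, j') \<in> dots D" by blast
    note pd = prev_dot[OF j']
    note IH = less.IH[OF pd(1,2)]
    have lw: "0 < left_weight D w 1 j" by (rule left_weight_pos[OF less.prems j'])
    with IH have nn: "0 \<le> left_weight D w 1 j * (\<sigma> * G 1 (prev_dot D 1 j))" by simp
    show ?thesis
    proof (intro conjI impI allI)
      show "0 \<le> \<sigma> * G 1 j" using eq nn pos[OF j] by simp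
      fix l assume *: "G 1 j = 0" "l \<le> j" "(1, l) \<in> dots D"
      have "\<sigma> * G 1 j = 0" using *(1) by simp
      with eq nn pos[OF j] have "\<sigma> * G 2 j = 0" "left_weight D w 1 j * (\<sigma> * G 1 (prev_dot D 1 j)) = 0"
        by linarith+
      with lw \<open>\<sigma> \<noteq> 0\<close> have "G 2 j = 0" "G 1 (prev_dot D 1 j) = 0" by auto
      with IH * prev_dot(3)[of l j 1 D] show "G 2 l = 0" by (cases "l = j") auto
    qed
  qed
qed

text \<open>If row 1 is in \<open>R\<close> and \<open>G 2\<close> has a single block, then
  \<open>G 2\<close> lives on missing boxes of the first row, no two of them adjacent. One such box
  starts a tight phase with \<open>s = 1\<close>. With two or more, row 2 inserts an entry of the
  opposite sign between them, which makes three blocks; this is why the invariant starts at row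
  3.\<close>

lemma surplus_or_tight_3:
  assumes rule: "row_rule c D w 1 G" "row_rule c D w 2 G"
    and F: "1 \<in> R \<Longrightarrow> G 1 c = 0" "2 \<in> R \<Longrightarrow> G 2 c = 0" and nz: "\<exists>j\<in>{1..c}. G 2 j \<noteq> 0"
  shows "surplus R G 3 \<or> tight R G 3"
proof -
  have k2: "(2::nat) < k" using k by simp
  have R2: "R \<inter> {1..<2} = (if 1 \<in> R then {1} else {})" by (auto simp: less_Suc_eq numeral_2_eq_2)
  have "sign_blocks (G 2) c \<noteq> 0" using nz by (auto simp: sign_blocks_eq_0_iff)
  then consider "surplus R G 2" | "1 \<in> R" "sign_blocks (G 2) c \<le> 1"
    using R2 by (fastforce simp: surplus_def split: if_splits)
  then show ?thesis
  proof cases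
    case 1
    with surplus_step[of 2 G R] rule F nz k2 show ?thesis by (simp add: numeral_3_eq_3 numeral_2_eq_2)
  next
    case 2
    from sign_blocks_one_sign[OF 2(2)] obtain \<sigma> :: real where
      \<sigma>: "\<sigma> = 1 \<or> \<sigma> = -1" "\<And>j. j \<in> {1..c} \<Longrightarrow> 0 \<le> \<sigma> * G 2 j" by blast
    have "(1, c) \<in> dots D" using last_dot_dot[of 1] last_dot_D[of 1] k by auto
    with first_row_sign[OF rule(1) \<sigma>(2), of c] F(1)[OF 2(1)] \<sigma>(1)
    have dot0: "\<And>j. j \<le> c \<Longrightarrow> (1, j) \<in> dots D \<Longrightarrow> G 2 j = 0" by auto
    have mis: "missing 1 j \<and> j < c" if "j \<in> {1..c}" "G 2 j \<noteq> 0" for j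
    proof -
      have "j \<noteq> c" using that(2) dot0 \<open>(1, c) \<in> dots D\<close> by auto
      with that dot0[of j] k show ?thesis by (auto simp: dots_D)
    qed
    have adj: "G 2 (Suc j) = 0" if "j \<in> {1..c}" "Suc j \<le> c" "G 2 j \<noteq> 0" for j
    proof (rule ccontr)
      assume "G 2 (Suc j) \<noteq> 0"
      with mis[of j] mis[of "Suc j"] that have "c + 2 - j \<in> A" "c + 1 - j \<in> A" "j < c"
        by (auto simp: missing_def)
      moreover from this have "c + 2 - j = Suc (c + 1 - j)" by simp
      ultimately show False using A(4) by metis
    qed
    interpret bidiagonal "left_weight D w 2" "G 2" "G (Suc 2)" c
      using rule(2) by (intro bidiagonal_row) auto
    have h: "G (Suc 2) j = G 2 j" if j: "j \<in> {1..c}" "G 2 j \<noteq> 0" for j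
    proof (cases "j = 1")
      case False
      with j adj[of "j - 1"] have "G 2 (j - 1) = 0" by fastforce
      with False j h_eq[of j] show ?thesis by auto
    qed (use h_1 in simp)
    from nz obtain p where p: "p \<in> {1..c}" "G 2 p \<noteq> 0" by blast
    show ?thesis
    proof (cases "\<forall>j\<in>{1..c}. j \<noteq> p \<longrightarrow> G 2 j = 0")
      case True
      have "alternating_on c (G 2) p p" by (rule alternating_on_single[of "G 2" p, OF p(2)]) (use True in auto)
      moreover have "R \<inter> {1..<2} = {1..1 + (p - p)}" using R2 2(1) by simp
      ultimately have "tight R G 2"
        using mis[OF p] p by (intro tightI[of 1 p p]) auto
      with tight_step[of 2 G R] rule F k2 show ?thesis by (simp add: numeral_3_eq_3 numeral_2_eq_2)
    next
      case False
      then obtain p' where p': "p' \<in> {1..c}" "G 2 p' \<noteq> 0" "p' \<noteq> p" by blast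
      define x y where "x = min p p'" and "y = max p p'"
      have xy: "x \<in> {1..c}" "G 2 x \<noteq> 0" "y \<in> {1..c}" "G 2 y \<noteq> 0" "x < y"
        using p p' by (auto simp: x_def y_def min_def max_def)
      with adj[of x] have xy': "Suc x < y" by (metis Suc_leI atLeastAtMost_iff le_neq_implies_less)
      have "\<not> (Suc x = 2 \<and> 2 + c \<in> A)"
        using mis[OF xy(1,2)] missing_neighbour[of 1] by auto
      with left_weight_pos_iff[of 2 "Suc x"] xy xy' k2 have lw: "0 < left_weight D w 2 (Suc x)" by auto
      have hs: "G (Suc 2) (Suc x) = - left_weight D w 2 (Suc x) * G 2 x"
      proof -
        have x: "Suc x \<le> c" "1 \<le> x" using xy(1,3) xy' by auto
        have "G 2 (Suc x) = 0" by (rule adj[OF xy(1) x(1) xy(2)])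
        then show ?thesis unfolding h_Suc[OF x] by (simp only: diff_0 mult_minus_left)
      qed
      have same: "0 < G 2 x * G 2 y"
        using \<sigma>(1) \<sigma>(2)[OF xy(1)] \<sigma>(2)[OF xy(3)] xy(2,4)
        by (auto simp: zero_less_mult_iff)
      have "G (Suc 2) x * G (Suc 2) (Suc x) = - (left_weight D w 2 (Suc x) * (G 2 x)\<^sup>2)"
        using hs h[OF xy(1,2)] by (simp add: power2_eq_square)
      also have "\<dots> < 0" using lw xy by simp
      finally have "sign_blocks (G (Suc 2)) x < sign_blocks (G (Suc 2)) (Suc x)"
        using xy by (intro sign_blocks_less) auto
      moreover have "G (Suc 2) (Suc x) * G (Suc 2) y = - (left_weight D w 2 (Suc x) * (G 2 x * G 2 y))"
        using hs h[OF xy(3,4)] by simp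
      then have "G (Suc 2) (Suc x) * G (Suc 2) y < 0" using lw same by simp
      then have "sign_blocks (G (Suc 2)) (Suc x) < sign_blocks (G (Suc 2)) y"
        using xy' by (intro sign_blocks_less) auto
      moreover have "sign_blocks (G (Suc 2)) y \<le> sign_blocks (G (Suc 2)) c"
        using xy by (intro sign_blocks_mono) auto
      moreover have "sign_blocks (G (Suc 2)) x \<noteq> 0"
        using xy(1,2) h[OF xy(1,2)] by (auto simp: sign_blocks_eq_0_iff intro!: bexI[of _ x])
      moreover have "card (R \<inter> {1..<3}) \<le> card {1..<3::nat}" by (intro card_mono) auto
      ultimately show ?thesis by (simp add: surplus_def numeral_3_eq_3 numeral_2_eq_2)
    qed
  qed
qed

lemma surplus_or_tight_last:
  assumes rule: "\<And>i. i \<in> {1..k} \<Longrightarrow> row_rule c D w i G"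
    and F: "\<And>i. i \<in> R \<Longrightarrow> G i (last_dot D i) = 0" and R: "R \<subseteq> {1..k}"
    and nz: "\<exists>j\<in>{1..c}. G (Suc k) j \<noteq> 0"
  shows "\<exists>j\<in>{1..c}. G k j \<noteq> 0" "surplus R G k \<or> tight R G k"
proof -
  have nz_row: "\<exists>j\<in>{1..c}. G i j \<noteq> 0" if "1 \<le> i" "i \<le> k" for i
    using that(2,1)
  proof (induction i rule: inc_induct)
    case base
    then show ?case using potential_row_nonzero[OF rule nz] by simp
  next
    case (step n)
    then show ?case using potential_row_nonzero[OF rule] by simp
  qed
  then show "\<exists>j\<in>{1..c}. G k j \<noteq> 0" using k by simp
  have F': "i \<in> R \<Longrightarrow> i < k \<Longrightarrow> G i c = 0" for i
    using F[of i] R last_dot_D[of i] by auto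
  have "surplus R G i \<or> tight R G i" if "3 \<le> i" "i \<le> k" for i
    using that
  proof (induction i rule: dec_induct)
    case base
    show ?case using k by (intro surplus_or_tight_3 rule F' nz_row) auto
  next
    case (step n)
    with surplus_step[of n G R] tight_step[of n G R] rule[of n] F'[of n] nz_row[of n] show ?case by auto
  qed
  with k show "surplus R G k \<or> tight R G k" by simp
qed

text \<open>The rows whose labels are missing from, and the columns whose labels lie in, the cyclic interval
  that starts at the label of box \<open>(s, p)\<close>.\<close>

definition arc_rows :: "nat \<Rightarrow> nat \<Rightarrow> nat set" where
  "arc_rows s p = {i \<in> {1..k}. s \<le> i \<and> (if i = k then k + 1 \<le> s + (c - p) else i \<le> s + (c - p))}"

definition arc_cols :: "nat \<Rightarrow> nat \<Rightarrow> nat set" where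
  "arc_cols s p = {j \<in> {1..c}. p \<le> j \<and> (if j = c then s + (c - p) < k else j \<le> p + (k - s))}"

lemma row_label_in_arc:
  assumes sp: "s = 1 \<or> p = 1" "1 \<le> s" "s < k" "1 \<le> p" "p < c" and i: "i \<in> {1..k}"
  shows "row_label c D i \<in> arc m (c + 1 + s - p) k \<longleftrightarrow> i \<notin> arc_rows s p"
proof -
  obtain d where d: "m = k + d" using m by (metis add_leE le_Suc_ex)
  then have c: "c = d" by simp
  define x where "x = (if i = k then k + 1 else i)"
  have x: "row_label c D i = x" "1 \<le> x" "x \<le> k + 1" using i m by (auto simp: row_label_D x_def)
  have "x \<in> arc m (d + 1 + s - p) k \<longleftrightarrow> \<not> (s \<le> x \<and> x \<le> s + (d - p))"
    using sp(1)
  proof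
    assume "s = 1"
    with sp x(2,3) m show ?thesis unfolding c d by (auto simp: arc_def)
  next
    assume "p = 1"
    with sp x(2,3) m show ?thesis unfolding c d by (auto simp: arc_def)
  qed
  with i sp(3) show ?thesis unfolding x(1) unfolding c by (auto simp: x_def arc_rows_def c)
qed

lemma col_label_in_arc:
  assumes sp: "s = 1 \<or> p = 1" "1 \<le> s" "s < k" "1 \<le> p" "p < c" and j: "j \<in> {1..c}"
  shows "col_label c D j \<in> arc m (c + 1 + s - p) k \<longleftrightarrow> j \<in> arc_cols s p"
proof -
  obtain d where d: "m = k + d" using m by (metis add_leE le_Suc_ex)
  then have c: "c = d" by simp
  show ?thesis
  proof (cases "j = c")
    case True
    then have x: "col_label c D j = k" using j by (simp add: col_label_D)
    from sp(1) show ?thesis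
    proof
      assume "s = 1"
      with sp j True show ?thesis unfolding x arc_cols_def arc_def unfolding c d by auto
    next
      assume "p = 1"
      with sp j True show ?thesis unfolding x arc_cols_def arc_def unfolding c d by auto
    qed
  next
    case False
    then have "col_label c D j = m - j + 1" using j by (simp add: col_label_D)
    then have x: "col_label c D j = k + d - j + 1" using d by simp
    from sp(1) show ?thesis
    proof
      assume "s = 1"
      with sp j False show ?thesis unfolding x arc_cols_def arc_def unfolding c d by auto
    next
      assume "p = 1"
      with sp j False show ?thesis unfolding x arc_cols_def arc_def unfolding c d by auto
    qed
  qed
qed

lemma eq_arcI:
  assumes I: "I \<subseteq> {1..m}"
    and rows: "\<And>i. i \<in> {1..k} \<Longrightarrow> row_label c D i \<in> I \<longleftrightarrow> row_label c D i \<in> arc m l k"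
    and cols: "\<And>j. j \<in> {1..c} \<Longrightarrow> col_label c D j \<in> I \<longleftrightarrow> col_label c D j \<in> arc m l k"
  shows "I = arc m l k"
proof -
  have "x \<in> I \<longleftrightarrow> x \<in> arc m l k" if "x \<in> {1..m}" for x
    using that rows cols unfolding labels[symmetric] by blast
  with I show ?thesis by (auto simp: arc_def)
qed

lemma card_rows_cols:
  assumes I: "I \<subseteq> {1..m}" "card I = k"
  shows "card {j \<in> {1..c}. col_label c D j \<in> I} = card {i \<in> {1..k}. row_label c D i \<notin> I}"
proof -
  have "card I = (\<Sum>x\<in>I. 1)" by simp
  also have "\<dots> = (\<Sum>i\<in>{1..k}. if row_label c D i \<in> I then 1 else 0)
      + (\<Sum>j\<in>{1..c}. if col_label c D j \<in> I then 1 else 0)"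
    by (rule sum_labels[OF I(1)])
  also have "\<dots> = card {i \<in> {1..k}. row_label c D i \<in> I} + card {j \<in> {1..c}. col_label c D j \<in> I}"
    by (simp add: sum.inter_filter[symmetric])
  finally have "k = card {i \<in> {1..k}. row_label c D i \<in> I} + card {j \<in> {1..c}. col_label c D j \<in> I}"
    using I(2) by simp
  moreover have "card ({i \<in> {1..k}. row_label c D i \<in> I} \<union> {i \<in> {1..k}. row_label c D i \<notin> I})
      = card {i \<in> {1..k}. row_label c D i \<in> I} + card {i \<in> {1..k}. row_label c D i \<notin> I}"
    by (rule card_Un_disjoint) auto
  moreover have "{i \<in> {1..k}. row_label c D i \<in> I} \<union> {i \<in> {1..k}. row_label c D i \<notin> I} = {1..k}"
    by auto
  ultimately show ?thesis by simp
qed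

lemma last_row_pos: "1 < j \<Longrightarrow> j \<le> c - 1 \<Longrightarrow> 0 < left_weight D w k j"
  using left_weight_pos_iff[of k j] k m A(3) by auto

lemma last_row_corner: "left_weight D w k c = 0"
  by (auto simp: left_weight_def dots_D)

text \<open>If \<open>k\<close> is not in \<open>R\<close>, there are more blocks than
  \<open>C\<close> has columns. Otherwise any nonzero entry before column \<open>c\<close> gives a
  further block there, again too many for \<open>C\<close>. What remains is a multiple of the unit
  vector at the removed corner, the box labeled 1.\<close>

lemma surplus_last_row:
  assumes rule: "row_rule c D w k G" and F: "k \<in> R \<Longrightarrow> G k (c - 1) = 0"
    and nz: "\<exists>j\<in>{1..c}. G k j \<noteq> 0" and R: "R \<subseteq> {1..k}"
    and C: "C \<subseteq> {1..c}" "card C = card R" "\<And>j. j \<in> {1..c} \<Longrightarrow> G (Suc k) j \<noteq> 0 \<Longrightarrow> j \<in> C"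
    and sur: "surplus R G k"
  shows "R = {k} \<and> C = {c}"
proof -
  interpret bidiagonal "left_weight D w k" "G k" "G (Suc k)" c
    using rule k by (intro bidiagonal_row) auto
  have finC: "finite C" using C(1) finite_subset by blast
  have R_split: "R = (if k \<in> R then insert k (R \<inter> {1..<k}) else R \<inter> {1..<k})"
    using R by (auto simp: le_less)
  have supp: "card {j \<in> {1..c}. G (Suc k) j \<noteq> 0} \<le> card R"
    unfolding C(2)[symmetric] using C(3) by (intro card_mono finC) auto
  have kR: "k \<in> R"
  proof (rule ccontr)
    assume "k \<notin> R"
    with R_split have "R \<inter> {1..<k} = R" by simp
    with sur have "card R < sign_blocks (G k) c" by (simp add: surplus_def)
    with sign_blocks_le[of c] sign_blocks_le_card_support[of "G (Suc k)" c] supp show False by simp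
  qed
  have "card R = Suc (card (R \<inter> {1..<k}))"
    using R_split kR by (metis card_insert_disjoint finite_Int finite_atLeastLessThan
        IntE atLeastLessThan_iff less_irrefl)
  with sur have card_R: "card R \<le> sign_blocks (G k) c" by (simp add: surplus_def)
  obtain d where d: "c = Suc d" "1 \<le> d" using m by (cases c) auto
  have supp_Suc: "{j \<in> {1..Suc d}. g j \<noteq> 0} =
      (if g (Suc d) = 0 then {j \<in> {1..d}. g j \<noteq> 0} else insert (Suc d) {j \<in> {1..d}. g j \<noteq> 0})"
    for g :: "nat \<Rightarrow> real"
    by (auto simp: le_Suc_eq)
  \<comment> \<open>Row \<open>k\<close> has no box in column \<open>c\<close>, so the zero in
    column \<open>c - 1\<close> is exploited on the first \<open>d\<close> columns, and the last
    column is carried along unchanged.\<close>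
  have h_last: "G (Suc k) (Suc d) = G k (Suc d)"
    using h_eq[of "Suc d"] d last_row_corner by simp
  have zero: "G k j = 0" if j: "j \<in> {1..d}" for j
  proof (rule ccontr)
    assume "G k j \<noteq> 0"
    have "sign_blocks (G k) d < sign_blocks (G (Suc k)) d"
    proof (rule sign_blocks_less_aux[of 1])
      show "0 < left_weight D w k i" if "1 < i" "i \<le> d" for i
        using that d by (intro last_row_pos) auto
      show "G k d = 0" using F[OF kR] d by simp
    qed (use j \<open>G k j \<noteq> 0\<close> d in auto)
    also have "\<dots> \<le> card {j \<in> {1..d}. G (Suc k) j \<noteq> 0}" by (rule sign_blocks_le_card_support)
    finally have "sign_blocks (G k) (Suc d) < card {j \<in> {1..Suc d}. G (Suc k) j \<noteq> 0}"
      unfolding supp_Suc h_last by auto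
    with supp card_R d(1) show False by simp
  qed
  have "{j \<in> {1..c}. G k j \<noteq> 0} \<subseteq> {c}"
    using zero d(1) by (auto simp: le_Suc_eq)
  then have "card {j \<in> {1..c}. G k j \<noteq> 0} \<le> 1"
    using card_mono[of "{c}"] by fastforce
  with card_R sign_blocks_le_card_support[of "G k" c] have "card R \<le> 1" by simp
  with kR have Rk: "R = {k}"
    using R finite_subset by (metis One_nat_def card_le_Suc0_iff_eq finite_atLeastAtMost is_singletonI' is_singleton_the_elem singletonD empty_iff)
  from nz zero d(1) have "G k c \<noteq> 0" by (auto simp: le_Suc_eq)
  with h_last d C(3)[of c] have "c \<in> C" by auto
  moreover have "card C = 1" using C(2) Rk by simp
  ultimately have "C = {c}" by (metis card_1_singletonE singletonD)
  with Rk show ?thesis by simp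
qed

text \<open>The nonzero sink values fill \<open>{p..q'}\<close>, and \<open>card C = card R\<close>
  leaves no room beyond this interval. If \<open>k\<close> is not in \<open>R\<close>, the support
  may not grow, so \<open>q\<close> is \<open>c\<close> or \<open>c - 1\<close>; if \<open>k\<close>
  is in \<open>R\<close>, the zero in column \<open>c - 1\<close> forces \<open>q < c - 1\<close>
  and the support grows to \<open>q + 1\<close>.\<close>

lemma tight_last_row:
  assumes rule: "row_rule c D w k G" and F: "k \<in> R \<Longrightarrow> G k (c - 1) = 0" and R: "R \<subseteq> {1..k}"
    and C: "C \<subseteq> {1..c}" "card C = card R" "\<And>j. j \<in> {1..c} \<Longrightarrow> G (Suc k) j \<noteq> 0 \<Longrightarrow> j \<in> C"
    and tight: "tight R G k"
  shows "\<exists>s p. missing s p \<and> 1 \<le> s \<and> s < k \<and> 1 \<le> p \<and> p < c \<and> R = arc_rows s p \<and> C = arc_cols s p"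
proof -
  interpret bidiagonal "left_weight D w k" "G k" "G (Suc k)" c
    using rule k by (intro bidiagonal_row) auto
  have finC: "finite C" using C(1) finite_subset by blast
  from tight obtain s p q where spq: "missing s p" "1 \<le> s" "1 \<le> p" "p < c" "p \<le> q" "q \<le> c"
    "alternating_on c (G k) p q" "R \<inter> {1..<k} = {s..s + (q - p)}" "s + (q - p) < k"
    "q = c \<or> s + (q - p) + 1 = k"
    unfolding tight_def by blast
  define q' where "q' = (if q + 1 \<le> c \<and> 0 < left_weight D w k (q + 1) then q + 1 else q)"
  have alt: "alternating_on c (G (Suc k)) p q'"
    unfolding q'_def using spq(3-7) by (intro alternating_step) auto
  have q': "q' = (if q + 1 < c then q + 1 else q)"
  proof (cases "q + 1 < c")
    case True
    then show ?thesis using last_row_pos[of "q + 1"] spq(3,5) by (simp add: q'_def)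
  next
    case False
    then have "\<not> (q + 1 \<le> c \<and> 0 < left_weight D w k (q + 1))"
      using last_row_corner by (metis le_neq_implies_less less_irrefl)
    with False show ?thesis by (simp add: q'_def)
  qed
  have sub: "{p..q'} \<subseteq> C"
  proof
    fix j assume j: "j \<in> {p..q'}"
    with spq(3,6) q' have "j \<in> {1..c}" by (auto split: if_splits)
    with alternating_on_nonzero_iff[OF alt this] j C(3) show "j \<in> C" by simp
  qed
  have R_split: "R = (if k \<in> R then insert k (R \<inter> {1..<k}) else R \<inter> {1..<k})"
    using R by (auto simp: le_less)
  have sk: "s < k" using spq(9) by simp
  have "R = arc_rows s p \<and> C = arc_cols s p"
  proof (cases "k \<in> R")
    case False
    with R_split spq(8) have R': "R = {s..s + (q - p)}" by simp
    with card_mono[OF finC sub] C(2) spq(5) have "q' - p + 1 \<le> q - p + 1" by simp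
    with q' spq(5) have qc: "c \<le> q + 1" and "q' = q" by (auto split: if_splits)
    have "card {p..q'} = card C" using R' C(2) \<open>q' = q\<close> spq(5) by simp
    with card_subset_eq[OF finC sub] have C': "C = {p..q}" using \<open>q' = q\<close> by simp
    consider "q = c" | "q + 1 = c" using qc spq(6) by linarith
    then show ?thesis
    proof cases
      case 1
      with spq(9) have *: "s + (c - p) < k" by simp
      have "arc_rows s p = {s..s + (c - p)}"
        unfolding arc_rows_def using * spq(2) by auto
      moreover have "arc_cols s p = {p..c}"
        unfolding arc_cols_def using * spq(3,4) by auto
      ultimately show ?thesis using R' C' 1 by simp
    next
      case 2
      then have *: "s + (c - p) = k" "q = c - 1" using spq(5,10) by auto
      have "R = {s..k - 1}" using R' 2 spq(5,10) by auto
      moreover have "arc_rows s p = {s..k - 1}"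
        using * sk spq(2) by (auto simp: arc_rows_def)
      moreover have "arc_cols s p = {p..q}"
        using * sk spq(3,4) by (auto simp: arc_cols_def)
      ultimately show ?thesis using C' by simp
    qed
  next
    case True
    have "\<not> q + 1 \<ge> c"
    proof
      assume "c \<le> q + 1"
      then have "p \<le> c - 1 \<and> c - 1 \<le> q" "c - 1 \<in> {1..c}" using spq(3,4) by auto
      with alternating_on_nonzero_iff[OF spq(7)] F[OF True] show False by metis
    qed
    then have q: "q + 1 < c" "q' = q + 1" "s + (q - p) + 1 = k" using q' spq(10) by auto
    have "insert k {s..s + (q - p)} = {s..k}" using q(3) by auto
    with R_split True spq(8) have R': "R = {s..k}" by simp
    have "card {p..q'} = card C" unfolding C(2) R' using q spq(5) by simp
    with card_subset_eq[OF finC sub] q have C': "C = {p..q + 1}" by simp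
    have "s + (c - p) \<ge> k + 1" using q spq(5) by linarith
    then have "arc_rows s p = {s..k}" using spq(2) by (auto simp: arc_rows_def)
    moreover have "p + (k - s) = q + 1" using q(3) spq(5) by linarith
    then have "arc_cols s p = {p..q + 1}"
      using \<open>s + (c - p) \<ge> k + 1\<close> q(1) spq(3) by (auto simp: arc_cols_def)
    ultimately show ?thesis using R' C' by simp
  qed
  with spq sk show ?thesis by blast
qed

lemma arc_of_singular:
  assumes I: "I \<subseteq> {1..m}" "card I = k" and det: "det (Meas_submatrix k c D w I) = 0"
  shows "\<exists>l\<in>A. I = arc m l k"
proof -
  obtain G where G: "\<And>i. i \<in> {1..k} \<Longrightarrow> row_rule c D w i G" "\<exists>j\<in>{1..c}. G (Suc k) j \<noteq> 0"
    "\<And>j. j \<in> {1..c} \<Longrightarrow> col_label c D j \<notin> I \<Longrightarrow> G (Suc k) j = 0"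
    "\<And>i. i \<in> {1..k} \<Longrightarrow> row_label c D i \<notin> I \<Longrightarrow> G i (last_dot D i) = 0"
    by (rule singular_potential[OF I det]) blast
  define R where "R = {i \<in> {1..k}. row_label c D i \<notin> I}"
  define C where "C = {j \<in> {1..c}. col_label c D j \<in> I}"
  have RC: "R \<subseteq> {1..k}" "C \<subseteq> {1..c}" "card C = card R"
    using card_rows_cols[OF I] by (auto simp: R_def C_def)
  have supp: "j \<in> C" if "j \<in> {1..c}" "G (Suc k) j \<noteq> 0" for j
    using that G(3) by (auto simp: C_def)
  have F: "G i (last_dot D i) = 0" if "i \<in> R" for i using that G(4) by (auto simp: R_def)
  have Fk: "G k (c - 1) = 0" if "k \<in> R" using F[OF that] last_dot_D[of k] k by simp
  have rule_k: "row_rule c D w k G" using G(1) k by simp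
  have nz: "\<exists>j\<in>{1..c}. G k j \<noteq> 0" and sur_or_tight: "surplus R G k \<or> tight R G k"
    using surplus_or_tight_last[of G R] G(1,2) F RC(1) by blast+
  from sur_or_tight have "R = {k} \<and> C = {c} \<or> (\<exists>s p. missing s p \<and> 1 \<le> s \<and> s < k \<and> 1 \<le> p \<and> p < c \<and>
      R = arc_rows s p \<and> C = arc_cols s p)"
    using surplus_last_row[OF rule_k Fk nz RC supp] tight_last_row[OF rule_k Fk RC supp] by blast
  then consider "R = {k}" "C = {c}" | s p where "missing s p" "1 \<le> s" "s < k" "1 \<le> p" "p < c"
      "R = arc_rows s p" "C = arc_cols s p"
    by blast
  then show ?thesis
  proof cases
    case 1
    have "I = arc m 1 k"
    proof (rule eq_arcI[OF I(1)])
      show "row_label c D i \<in> I \<longleftrightarrow> row_label c D i \<in> arc m 1 k" if i: "i \<in> {1..k}" for i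
      proof -
        have "row_label c D i \<in> I \<longleftrightarrow> i \<noteq> k" using 1(1) i unfolding R_def by blast
        with i m show ?thesis by (auto simp: row_label_D arc_def)
      qed
      show "col_label c D j \<in> I \<longleftrightarrow> col_label c D j \<in> arc m 1 k" if j: "j \<in> {1..c}" for j
      proof -
        have "col_label c D j \<in> I \<longleftrightarrow> j = c" using 1(2) j unfolding C_def by blast
        with j m k show ?thesis by (auto simp: col_label_D arc_def)
      qed
    qed
    with A(2) show ?thesis by blast
  next
    case 2
    then have sp: "s = 1 \<or> p = 1" and l: "c + 1 + s - p \<in> A" by (auto simp: missing_def)
    have "I = arc m (c + 1 + s - p) k"
    proof (rule eq_arcI[OF I(1)])
      show "row_label c D i \<in> I \<longleftrightarrow> row_label c D i \<in> arc m (c + 1 + s - p) k" if i: "i \<in> {1..k}" for i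
        using row_label_in_arc[OF sp 2(2-5) i] 2(6) i unfolding R_def by blast
      show "col_label c D j \<in> I \<longleftrightarrow> col_label c D j \<in> arc m (c + 1 + s - p) k" if j: "j \<in> {1..c}" for j
        using col_label_in_arc[OF sp 2(2-5) j] 2(7) j unfolding C_def by blast
    qed
    with l show ?thesis by blast
  qed
qed

text \<open>A unit vector at an empty box is left unchanged by its own row and then spreads by one
  column per row. The sources it passes before it reaches their last dots have value zero; they are
  the sources outside of the interval. For label 1 the vector starts at the corner, in the last
  row.\<close>

lemma singular_arc:
  assumes l: "l \<in> A" and card: "card (arc m l k) = k"
  shows "det (Meas_submatrix k c D w (arc m l k)) = 0"
proof (cases "l = 1")
  case True
  have "\<exists>G. G k = (\<lambda>j. if j = c then 1 else 0) \<and> (\<forall>i\<ge>k. row_rule c D w i G)"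
    by (rule exists_potential_from_top)
  then obtain G where G: "G k = (\<lambda>j. if j = c then 1 else 0)" "\<And>i. i \<ge> k \<Longrightarrow> row_rule c D w i G"
    by blast
  have h: "G (Suc k) j = (if j = c then 1 else 0)" if j: "j \<in> {1..c}" for j
  proof -
    interpret bidiagonal "left_weight D w k" "G k" "G (Suc k)" c
      using bidiagonal_row[of k G] G(2) k by simp
    show ?thesis using h_1 h_eq[of j] j m by (cases "j = 1") (auto simp: G(1))
  qed
  show ?thesis
  proof (rule singularI[of _ k G])
    show "arc m l k \<subseteq> {1..m}" by (auto simp: arc_def)
    show "card (arc m l k) = k" by fact
    show "row_rule c D w i G" if "k \<le> i" for i by (rule G(2)[OF that])
    show "\<exists>j\<in>{1..c}. G (Suc k) j \<noteq> 0" using h[of c] m by (intro bexI[of _ c]) auto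
    show "G (Suc k) j = 0" if j: "j \<in> {1..c}" "col_label c D j \<notin> arc m l k" for j
    proof -
      have "j \<noteq> c" using j True k m by (auto simp: col_label_D arc_def)
      with h[OF j(1)] show ?thesis by simp
    qed
    show "k \<le> i \<and> G i (last_dot D i) = 0" if i: "i \<in> {1..k}" "row_label c D i \<notin> arc m l k" for i
    proof -
      have "i = k" using i True k m by (auto simp: row_label_D arc_def split: if_splits)
      with G(1) last_dot_D[of k] m k show ?thesis by auto
    qed
  qed
next
  case False
  have "Suc 1 \<notin> A" using A(2,4) by blast
  then have "l \<noteq> 2" using l by (metis Suc_1)
  moreover have "l \<noteq> m" using A(3) l by metis
  moreover have "1 \<le> l" "l \<le> m" using A(1) l by auto
  ultimately have lb: "3 \<le> l" "l \<le> m - 1" using False by linarith+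
  \<comment> \<open>\<open>(s, p)\<close> is the box labeled \<open>l\<close>; the label
    \<open>c + 1\<close> belongs to box \<open>(1, 1)\<close>, where the first row ends and the
    first column begins. As \<open>l\<close> is none of 1, 2 and \<open>m\<close>, both
    \<open>p < c\<close> and \<open>s < k\<close> hold.\<close>
  define s p where "s = (if l \<le> c + 1 then 1 else l - c)" and "p = (if l \<le> c + 1 then c + 2 - l else 1)"
  have sp: "s = 1 \<or> p = 1" "1 \<le> s" "s < k" "1 \<le> p" "p < c" and l_eq: "c + 1 + s - p = l"
    using lb k m by (auto simp: s_def p_def)
  have mis: "missing s p" using sp(1) l l_eq by (simp add: missing_def)
  have "\<exists>G. G s = (\<lambda>j. if j = p then 1 else 0) \<and> (\<forall>i\<ge>s. row_rule c D w i G)"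
    by (rule exists_potential_from_top)
  then obtain G where G: "G s = (\<lambda>j. if j = p then 1 else 0)" "\<And>i. i \<ge> s \<Longrightarrow> row_rule c D w i G"
    by blast
  have alt_s: "alternating_on c (G (Suc s)) p p"
  proof (rule alternating_on_single)
    have *: "left_weight D w s j * G s (prev_dot D s j) = 0" for j
    proof (cases "left_weight D w s j = 0")
      case False
      then obtain j' where "j' < j" "(s, j') \<in> dots D"
        by (auto simp: left_weight_def split: if_splits)
      then have "(s, prev_dot D s j) \<in> dots D" by (rule prev_dot(2))
      with mis have "prev_dot D s j \<noteq> p" by (auto simp: dots_D)
      then show ?thesis by (simp add: G(1))
    qed simp
    have eq: "G (Suc s) j = G s j" if "j \<in> {1..c}" for j
      using G(2)[of s] that * by (simp add: row_rule_def)
    show "G (Suc s) p \<noteq> 0" using eq[of p] sp by (simp add: G(1))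
    show "G (Suc s) j = 0" if "j \<in> {1..c}" "j \<noteq> p" for j using eq[OF that(1)] that by (simp add: G(1))
  qed
  have alt: "alternating_on c (G i) p (min c (p + (i - Suc s)))" if "Suc s \<le> i" "i \<le> k" for i
    using that
  proof (induction i rule: dec_induct)
    case base
    show ?case using alt_s sp by (simp add: min_def)
  next
    case (step i)
    define q where "q = min c (p + (i - Suc s))"
    interpret bidiagonal "left_weight D w i" "G i" "G (Suc i)" c
      using bidiagonal_row[of i G] G(2)[of i] step sp by simp
    have q: "p \<le> q" "q \<le> c" using sp by (auto simp: q_def)
    have alt_i: "alternating_on c (G i) p q" using step by (simp add: q_def)
    have "0 < left_weight D w i (q + 1)" if "q + 1 \<le> c"
    proof -
      have "\<not> (q + 1 = 2 \<and> i + c \<in> A)"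
      proof
        assume *: "q + 1 = 2 \<and> i + c \<in> A"
        with sp that have "p = 1" "i = Suc s" using step(1) by (auto simp: q_def min_def split: if_splits)
        with mis missing_neighbour * show False by auto
      qed
      with left_weight_pos_iff[of i "q + 1"] that step sp q show ?thesis by auto
    qed
    with alternating_step[OF alt_i sp(4) q] have "alternating_on c (G (Suc i)) p (if q + 1 \<le> c then q + 1 else q)"
      by (auto split: if_splits)
    moreover have "(if q + 1 \<le> c then q + 1 else q) = min c (p + (Suc i - Suc s))"
      using step(1) sp by (auto simp: q_def min_def)
    ultimately show ?case by simp
  qed
  define q where "q = min c (p + (k - Suc s))"
  interpret bidiagonal "left_weight D w k" "G k" "G (Suc k)" c
    using bidiagonal_row[of k G] G(2)[of k] k sp by simp
  define q' where "q' = (if q + 1 \<le> c \<and> 0 < left_weight D w k (q + 1) then q + 1 else q)"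
  have q: "p \<le> q" "q \<le> c" using sp by (auto simp: q_def)
  have alt_k: "alternating_on c (G k) p q" using alt[of k] sp by (simp add: q_def)
  have alt_last: "alternating_on c (G (Suc k)) p q'"
    using alternating_step[OF alt_k sp(4) q] by (simp add: q'_def)
  have q': "q' = (if q + 1 < c then q + 1 else q)"
  proof (cases "q + 1 < c")
    case True
    then show ?thesis using last_row_pos[of "q + 1"] sp q by (simp add: q'_def)
  next
    case False
    then have "\<not> (q + 1 \<le> c \<and> 0 < left_weight D w k (q + 1))"
      using last_row_corner by (metis le_neq_implies_less less_irrefl)
    with False show ?thesis by (simp add: q'_def)
  qed
  show ?thesis
  proof (rule singularI[of _ s G])
    show "arc m l k \<subseteq> {1..m}" by (auto simp: arc_def)
    show "card (arc m l k) = k" by fact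
    show "row_rule c D w i G" if "s \<le> i" for i by (rule G(2)[OF that])
    show "\<exists>j\<in>{1..c}. G (Suc k) j \<noteq> 0"
      using alternating_on_nonzero_iff[OF alt_last, of p] q q' sp by (intro bexI[of _ p]) auto
    show "G (Suc k) j = 0" if j: "j \<in> {1..c}" "col_label c D j \<notin> arc m l k" for j
    proof -
      from j have "j \<notin> arc_cols s p" using col_label_in_arc[OF sp j(1)] l_eq by simp
      with j(1) have "\<not> (p \<le> j \<and> j \<le> q')"
        unfolding arc_cols_def q' q_def using sp by (auto simp: min_def split: if_splits)
      with alternating_on_nonzero_iff[OF alt_last j(1)] show ?thesis by blast
    qed
    show "s \<le> i \<and> G i (last_dot D i) = 0" if i: "i \<in> {1..k}" "row_label c D i \<notin> arc m l k" for i
    proof -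
      from i have iR: "i \<in> arc_rows s p" using row_label_in_arc[OF sp i(1)] l_eq by simp
      show ?thesis
      proof (cases "i = k")
        case True
        with iR have "\<not> c - 1 \<le> q" unfolding arc_rows_def q_def using sp by auto
        then show ?thesis
          using alternating_on_nonzero_iff[OF alt_k, of "c - 1"] last_dot_D[OF i(1)] True sp by auto
      next
        case False
        with iR have i': "s \<le> i" "i < k" "i \<le> s + (c - p)" by (auto simp: arc_rows_def)
        show ?thesis
        proof (cases "i = s")
          case True
          then show ?thesis using last_dot_D[OF i(1)] i' sp by (simp add: G(1))
        next
          case False
          with i' have "Suc s \<le> i" "\<not> c \<le> min c (p + (i - Suc s))" using sp by auto
          then show ?thesis
            using alternating_on_nonzero_iff[OF alt[of i], of c] last_dot_D[OF i(1)] i' sp by auto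
        qed
      qed
    qed
  qed
qed

theorem positroid_bases_D:
  "positroid_bases k m D w = {I. I \<subseteq> {1..m} \<and> card I = k \<and> (\<forall>l\<in>A. I \<noteq> arc m l k)}"
  unfolding positroid_bases_def using arc_of_singular singular_arc by blast

end

section \<open>Sparse paving matroids, Hall's theorem and cyclic intervals\<close>

lemma card_Int_insert_remove:
  assumes "finite X" "x \<in> X"
  shows "card X \<le> Suc (card (insert y (X - {x}) \<inter> X))"
proof -
  have "card (X - {x}) \<le> card (insert y (X - {x}) \<inter> X)"
    using assms(1) by (intro card_mono) auto
  with assms show ?thesis by (simp add: card_Diff_singleton)
qed

text \<open>Two members of \<open>N\<close> never differ by a single exchange. So exchanging an
  element of a member gives a basis, and of two sets obtained by putting different elements in the
  same place at most one is in \<open>N\<close>. In the exchange axiom two candidates for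
  \<open>y\<close> therefore suffice, and a sole candidate yields the second basis itself.\<close>

lemma sparse_paving_of_separated:
  assumes E: "finite E" and k: "1 \<le> k" "k < card E"
    and N: "\<And>X. X \<in> N \<Longrightarrow> X \<subseteq> E \<and> card X = k"
    and sep: "\<And>X Y. X \<in> N \<Longrightarrow> Y \<in> N \<Longrightarrow> X \<noteq> Y \<Longrightarrow> card (X \<inter> Y) + 2 \<le> k"
  shows "sparse_paving k E {X. X \<subseteq> E \<and> card X = k \<and> X \<notin> N}" (is "sparse_paving k E ?B")
proof -
  have fin: "finite X" if "X \<subseteq> E" for X using that E finite_subset by blast
  have card_swap: "card (insert y (X - {x})) = card X" if "finite X" "x \<in> X" "y \<notin> X" for x y and X :: "'a set"
  proof -
    have "card (insert y (X - {x})) = Suc (card (X - {x}))" using that by (intro card_insert_disjoint) auto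
    then show ?thesis using that card_Suc_Diff1 by metis
  qed
  have swap: "insert y (X - {x}) \<in> ?B" if X: "X \<in> N" and xy: "x \<in> X" "y \<in> E - X" for X x y
  proof -
    have "insert y (X - {x}) \<notin> N"
    proof
      assume "insert y (X - {x}) \<in> N"
      from sep[OF this X] xy N[OF X] card_Int_insert_remove[OF fin xy(1), of y] show False by auto
    qed
    with xy N[OF X] card_swap[OF fin, of X x y] show ?thesis by auto
  qed
  have two: "insert y (X - {x}) \<in> ?B \<or> insert z (X - {x}) \<in> ?B"
    if X: "X \<subseteq> E" "card X = k" and xyz: "x \<in> X" "y \<in> E - X" "z \<in> E - X" "y \<noteq> z" for X x y z
  proof (rule ccontr)
    assume neg: "\<not> ?thesis"
    have "card (X - {x}) \<le> card (insert y (X - {x}) \<inter> insert z (X - {x}))"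
      using fin[OF X(1)] by (intro card_mono) auto
    moreover have "insert y (X - {x}) \<in> N" "insert z (X - {x}) \<in> N"
      using neg xyz X card_swap[OF fin[OF X(1)]] by auto
    moreover have "insert y (X - {x}) \<noteq> insert z (X - {x})" using xyz by auto
    ultimately show False
      using sep[of "insert y (X - {x})" "insert z (X - {x})"] X xyz fin[OF X(1)] by auto
  qed
  have "?B \<noteq> {}"
  proof -
    obtain X where X: "X \<subseteq> E" "card X = k" using obtain_subset_with_card_n[of k E] k by auto
    show ?thesis
    proof (cases "X \<in> N")
      case True
      obtain x where "x \<in> X" using X k by fastforce
      moreover have "X \<noteq> E" using X k by auto
      then obtain y where "y \<in> E - X" using X by blast
      ultimately show ?thesis using swap[OF True] by blast
    qed (use X in auto)
  qed
  moreover have "\<exists>y\<in>B\<^sub>2 - B\<^sub>1. insert y (B\<^sub>1 - {x}) \<in> ?B"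
    if B: "B\<^sub>1 \<in> ?B" "B\<^sub>2 \<in> ?B" and x: "x \<in> B\<^sub>1 - B\<^sub>2" for B\<^sub>1 B\<^sub>2 x
  proof -
    have f: "finite B\<^sub>1" "finite B\<^sub>2" using B fin by auto
    have "B\<^sub>2 - B\<^sub>1 \<noteq> {}"
    proof
      assume "B\<^sub>2 - B\<^sub>1 = {}"
      then have "B\<^sub>2 \<subset> B\<^sub>1" using x by auto
      with psubset_card_mono[OF f(1) this] B show False by auto
    qed
    then obtain y where y: "y \<in> B\<^sub>2 - B\<^sub>1" by blast
    show ?thesis
    proof (cases "\<exists>z\<in>B\<^sub>2 - B\<^sub>1. z \<noteq> y")
      case True
      then obtain z where z: "z \<in> B\<^sub>2 - B\<^sub>1" "y \<noteq> z" by auto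
      with two[of B\<^sub>1 x y z] B x y show ?thesis by auto
    next
      case False
      then have sub: "B\<^sub>2 \<subseteq> insert y (B\<^sub>1 - {x})" using x by auto
      have "card (insert y (B\<^sub>1 - {x})) = card B\<^sub>2" using card_swap[OF f(1), of x y] x y B by auto
      with card_subset_eq[OF _ sub] f have "B\<^sub>2 = insert y (B\<^sub>1 - {x})" by auto
      with B(2) y show ?thesis by auto
    qed
  qed
  ultimately have matroid: "matroid_bases E ?B"
    unfolding matroid_bases_def using E by blast
  have circ: "circuit E ?B X \<and> hyperplane E ?B X" if X: "X \<in> N" for X
  proof -
    have XE: "X \<subseteq> E" "card X = k" "finite X" using N[OF X] fin by auto
    have "X \<noteq> E" using XE k by auto
    then obtain y where y: "y \<in> E - X" using XE by blast
    obtain x where x: "x \<in> X" using XE k by fastforce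
    have finB: "finite ?B" by (rule finite_subset[of _ "Pow E"]) (use E in auto)
    have le: "card (Y \<inter> B) \<le> k" if "B \<in> ?B" for Y B
      using that card_mono[of B "Y \<inter> B"] fin by auto
    have rank_eqI: "rank_of ?B Y = r"
      if "\<And>B. B \<in> ?B \<Longrightarrow> card (Y \<inter> B) \<le> r" "B \<in> ?B" "card (Y \<inter> B) = r" for Y B r
      unfolding rank_of_def
      by (rule Max_eqI) (use that finB in \<open>auto intro!: image_eqI[of _ _ B]\<close>)
    have indep: "independent ?B Y" if "Y \<subset> X" for Y
    proof -
      obtain x' where x': "x' \<in> X" "x' \<notin> Y" using \<open>Y \<subset> X\<close> by blast
      have "Y \<subseteq> insert y (X - {x'})" using \<open>Y \<subset> X\<close> x' by auto
      with swap[OF X x'(1) y] show ?thesis unfolding independent_def by blast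
    qed
    have notX: "\<not> X \<subseteq> B" if "B \<in> ?B" for B
    proof
      assume "X \<subseteq> B"
      with that XE fin have "X = B" using card_subset_eq[of B X] by auto
      with that X show False by auto
    qed
    then have dep: "\<not> independent ?B X" by (auto simp: independent_def)
    have rX: "rank_of ?B X = k - 1"
    proof (rule rank_eqI[OF _ swap[OF X x y]])
      show "card (X \<inter> B) \<le> k - 1" if B: "B \<in> ?B" for B
      proof -
        have "X \<inter> B \<subset> X" using notX[OF B] by auto
        from psubset_card_mono[OF XE(3) this] XE show ?thesis by simp
      qed
      have "X \<inter> insert y (X - {x}) = X - {x}" using y by auto
      with XE x show "card (X \<inter> insert y (X - {x})) = k - 1" by simp
    qed
    have full: "rank_of ?B Y = k" if "B \<in> ?B" "B \<subseteq> Y" for Y B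
    proof (rule rank_eqI[OF _ that(1)])
      show "card (Y \<inter> B') \<le> k" if "B' \<in> ?B" for B' using le[OF that] .
      show "card (Y \<inter> B) = k" using that by (simp add: Int_absorb1)
    qed
    have "rank_of ?B (insert z X) = k" if z: "z \<in> E - X" for z
      using swap[OF X x z] by (rule full) auto
    moreover have "rank_of ?B E = k"
      using swap[OF X x y] by (rule full) (use swap[OF X x y] in auto)
    ultimately show ?thesis
      unfolding circuit_def hyperplane_def flat_def using indep dep rX XE k(1) by auto
  qed
  show ?thesis
    unfolding sparse_paving_def using matroid circ by auto
qed

text \<open>Induction on the number of sets: split at a nonempty proper subfamily with equality in
  Hall's condition, or, if there is none, choose a value for one set freely and delete it from the
  others.\<close>

theorem Hall:
  assumes "finite J" "\<And>j. j \<in> J \<Longrightarrow> finite (F j)"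
    and "\<And>K. K \<subseteq> J \<Longrightarrow> card K \<le> card (\<Union>j\<in>K. F j)"
  shows "\<exists>\<phi>. inj_on \<phi> J \<and> (\<forall>j\<in>J. \<phi> j \<in> F j)"
  using assms
proof (induction "card J" arbitrary: J F rule: less_induct)
  case less
  show ?case
  proof (cases "J = {}")
    case False
    show ?thesis
    proof (cases "\<exists>K. K \<subset> J \<and> K \<noteq> {} \<and> card (\<Union>j\<in>K. F j) \<le> card K")
      case True
      then obtain K where K: "K \<subset> J" "K \<noteq> {}" "card (\<Union>j\<in>K. F j) \<le> card K" by blast
      have finK: "finite K" using K(1) less.prems(1) finite_subset by blast
      let ?U = "\<Union>j\<in>K. F j"
      have finU: "finite ?U" using finK K(1) less.prems(2) by auto
      have "\<exists>\<phi>. inj_on \<phi> K \<and> (\<forall>j\<in>K. \<phi> j \<in> F j)"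
        using less K finK psubset_card_mono[OF less.prems(1) K(1)] by (intro less.hyps) auto
      then obtain \<phi> where \<phi>: "inj_on \<phi> K" "\<And>j. j \<in> K \<Longrightarrow> \<phi> j \<in> F j" by blast
      have "\<exists>\<psi>. inj_on \<psi> (J - K) \<and> (\<forall>j\<in>J - K. \<psi> j \<in> F j - ?U)"
      proof (rule less.hyps)
        show "card (J - K) < card J"
          using K less.prems(1) by (intro psubset_card_mono) auto
        show "finite (J - K)" using less.prems(1) by simp
        show "finite (F j - ?U)" if "j \<in> J - K" for j using that less.prems(2) by simp
        show "card L \<le> card (\<Union>j\<in>L. F j - ?U)" if L: "L \<subseteq> J - K" for L
        proof -
          have finL: "finite L" using L less.prems(1) finite_subset by blast
          have "card (K \<union> L) \<le> card (\<Union>j\<in>K \<union> L. F j)" using L K(1) by (intro less.prems(3)) auto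
          also have "(\<Union>j\<in>K \<union> L. F j) = ?U \<union> (\<Union>j\<in>L. F j - ?U)" by auto
          also have "card \<dots> \<le> card ?U + card (\<Union>j\<in>L. F j - ?U)" by (rule card_Un_le)
          finally have "card (K \<union> L) \<le> card K + card (\<Union>j\<in>L. F j - ?U)" using K(3) by simp
          moreover have "card (K \<union> L) = card K + card L"
            using finK finL L by (intro card_Un_disjoint) auto
          ultimately show ?thesis by simp
        qed
      qed
      then obtain \<psi> where \<psi>: "inj_on \<psi> (J - K)" "\<And>j. j \<in> J - K \<Longrightarrow> \<psi> j \<in> F j - ?U" by blast
      let ?\<chi> = "\<lambda>j. if j \<in> K then \<phi> j else \<psi> j"
      have "inj_on ?\<chi> J"
      proof (rule inj_onI)
        fix x y assume xy: "x \<in> J" "y \<in> J" "?\<chi> x = ?\<chi> y"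
        have "x \<in> K \<longleftrightarrow> y \<in> K"
        proof (rule ccontr)
          assume "(x \<in> K) \<noteq> (y \<in> K)"
          then show False using xy \<phi>(2) \<psi>(2) by (auto split: if_splits) (metis DiffI)+
        qed
        with xy \<phi>(1) \<psi>(1) show "x = y" by (auto dest: inj_onD split: if_splits)
      qed
      moreover have "\<forall>j\<in>J. ?\<chi> j \<in> F j" using \<phi>(2) \<psi>(2) by auto
      ultimately show ?thesis by blast
    next
      case noK: False
      from False obtain j where j: "j \<in> J" by blast
      have "card {j} \<le> card (\<Union>i\<in>{j}. F i)" using j by (intro less.prems(3)) auto
      then obtain x where x: "x \<in> F j" by fastforce
      have "\<exists>\<psi>. inj_on \<psi> (J - {j}) \<and> (\<forall>i\<in>J - {j}. \<psi> i \<in> F i - {x})"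
      proof (rule less.hyps)
        show "card (J - {j}) < card J" using j less.prems(1) by (rule card_Diff1_less[rotated])
        show "finite (J - {j})" using less.prems(1) by simp
        show "finite (F i - {x})" if "i \<in> J - {j}" for i using that less.prems(2) by simp
        show "card K \<le> card (\<Union>i\<in>K. F i - {x})" if K: "K \<subseteq> J - {j}" for K
        proof (cases "K = {}")
          case False
          have "K \<subset> J" using K j by auto
          with noK False have "\<not> card (\<Union>i\<in>K. F i) \<le> card K" by blast
          then have "card K < card (\<Union>i\<in>K. F i)" by simp
          moreover have "card (\<Union>i\<in>K. F i) \<le> Suc (card ((\<Union>i\<in>K. F i) - {x}))"
            unfolding card_Diff_singleton_if by (cases "x \<in> (\<Union>i\<in>K. F i)") simp_all
          moreover have "(\<Union>i\<in>K. F i - {x}) = (\<Union>i\<in>K. F i) - {x}" by auto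
          ultimately show ?thesis by simp
        qed simp
      qed
      then obtain \<psi> where \<psi>: "inj_on \<psi> (J - {j})" "\<And>i. i \<in> J - {j} \<Longrightarrow> \<psi> i \<in> F i - {x}" by blast
      have "inj_on (\<psi>(j := x)) (insert j (J - {j}))"
        using \<psi> by (auto simp: inj_on_def)
      then have "inj_on (\<psi>(j := x)) J" using j by (simp add: insert_absorb)
      moreover have "\<forall>i\<in>J. (\<psi>(j := x)) i \<in> F i" using \<psi>(2) x by auto
      ultimately show ?thesis by blast
    qed
  qed simp
qed

section \<open>Rotations and unions of cyclic intervals\<close>

definition rot :: "nat \<Rightarrow> nat \<Rightarrow> nat \<Rightarrow> nat" where
  "rot m p t = (if p + t \<le> m then p + t else p + t - m)"

lemma rot_in: "p \<in> {1..m} \<Longrightarrow> t \<le> m \<Longrightarrow> rot m p t \<in> {1..m}"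
  by (auto simp: rot_def)

lemma rot_rot: "p \<in> {1..m} \<Longrightarrow> s + t \<le> m \<Longrightarrow> rot m (rot m p s) t = rot m p (s + t)"
  by (auto simp: rot_def)

lemma inj_on_rot: "inj_on (rot m p) {a..<a + m}"
  by (auto simp: inj_on_def rot_def split: if_splits)

lemma rot_surj:
  assumes "p \<in> {1..m}" "x \<in> {1..m}"
  obtains t where "t < m" "x = rot m p t"
proof (cases "p \<le> x")
  case True
  with assms that[of "x - p"] show ?thesis by (auto simp: rot_def)
next
  case False
  with assms that[of "x + m - p"] show ?thesis by (auto simp: rot_def)
qed

lemma rot_in_arc_iff:
  assumes "p \<in> {1..m}" "t < m" "l \<le> m"
  shows "rot m p t \<in> arc m p l \<longleftrightarrow> t < l"
  using assms by (auto simp: rot_def arc_def)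

lemma arc_eq_rot_image:
  assumes p: "p \<in> {1..m}" and l: "l \<le> m"
  shows "arc m p l = rot m p ` {..<l}"
proof (intro equalityI subsetI)
  fix x assume x: "x \<in> arc m p l"
  then have "x \<in> {1..m}" by (auto simp: arc_def)
  with p obtain t where "t < m" "x = rot m p t" by (rule rot_surj)
  with x rot_in_arc_iff[OF p _ l] show "x \<in> rot m p ` {..<l}" by auto
next
  fix x assume "x \<in> rot m p ` {..<l}"
  then show "x \<in> arc m p l" using rot_in_arc_iff[OF p _ l] l by auto
qed

lemma card_arc:
  assumes "p \<in> {1..m}" "l \<le> m"
  shows "card (arc m p l) = l"
  using assms inj_on_subset[OF inj_on_rot[of m p 0], of "{..<l}"]
  by (simp add: arc_eq_rot_image card_image lessThan_atLeast0)

text \<open>Adding the intervals from left to right, the last \<open>g\<close> points of each new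
  one lie beyond all previous ones.\<close>

lemma card_Union_intervals:
  fixes Q :: "nat set"
  assumes "finite Q" "Q \<noteq> {}" "\<And>p q. p \<in> Q \<Longrightarrow> q \<in> Q \<Longrightarrow> p < q \<Longrightarrow> p + g \<le> q" and gl: "g \<le> l"
  shows "l + g * (card Q - 1) \<le> card (\<Union>q\<in>Q. {q..<q + l})"
  using assms(1-3)
proof (induction rule: finite_linorder_max_induct)
  case (insert b Q)
  show ?case
  proof (cases "Q = {}")
    case False
    let ?U = "\<Union>q\<in>Q. {q..<q + l}"
    have IH: "l + g * (card Q - 1) \<le> card ?U" using insert False by auto
    have "q + l \<le> b + l - g" if "q \<in> Q" for q
      using insert.prems(2)[of q b] insert.hyps(2) that gl by auto
    then have "card (?U \<union> {b + l - g..<b + l}) = card ?U + card {b + l - g..<b + l}"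
      using insert.hyps(1) by (intro card_Un_disjoint) fastforce+
    moreover have "card (?U \<union> {b + l - g..<b + l}) \<le> card (\<Union>q\<in>insert b Q. {q..<q + l})"
      using insert.hyps(1) gl by (intro card_mono) auto
    ultimately have "l + g * (card Q - 1) + g \<le> card (\<Union>q\<in>insert b Q. {q..<q + l})"
      using IH gl by simp
    moreover have "card Q = Suc (card Q - 1)" using False insert.hyps(1) by (simp add: card_gt_0_iff)
    then have "g * (card Q - 1) + g = g * card Q" by (metis mult_Suc_right add.commute)
    ultimately show ?thesis using insert.hyps by auto
  qed simp
qed simp

text \<open>If the arcs miss a point, cutting the circle there turns them into intervals.\<close>

lemma card_Union_arcs:
  assumes T: "T \<subseteq> {1..m}" "T \<noteq> {}"
    and sep: "\<And>p q. p \<in> T \<Longrightarrow> q \<in> T \<Longrightarrow> p < q \<Longrightarrow> p + g \<le> q \<and> q + g \<le> p + m"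
    and gl: "g \<le> l" "1 \<le> l" "l \<le> m"
  shows "min m (l + g * (card T - 1)) \<le> card (\<Union>p\<in>T. arc m p l)"
proof (cases "{1..m} \<subseteq> (\<Union>p\<in>T. arc m p l)")
  case True
  have "finite (\<Union>p\<in>T. arc m p l)" by (rule finite_subset[of _ "{1..m}"]) (auto simp: arc_def)
  from card_mono[OF this True] show ?thesis by simp
next
  case False
  then obtain x where x: "x \<in> {1..m}" "\<And>p. p \<in> T \<Longrightarrow> x \<notin> arc m p l" by blast
  have finT: "finite T" using T(1) finite_subset by blast
  define r where "r p = (if x < p then p - x else p + m - x)" for p
  have r: "1 \<le> r p" "r p + l \<le> m" "p = rot m x (r p)" if "p \<in> T" for p
    using x(1) x(2)[OF that] T(1) that gl by (auto simp: r_def arc_def rot_def)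
  have inj: "inj_on r T" using r(3) by (metis inj_onI)
  have sep_r: "p + g \<le> q" if "p \<in> r ` T" "q \<in> r ` T" "p < q" for p q
  proof -
    from that obtain p' q' where *: "p' \<in> T" "q' \<in> T" "p = r p'" "q = r q'" by auto
    with that(3) have "p' \<noteq> q'" by auto
    then consider "p' < q'" | "q' < p'" by linarith
    then have le: "p' < q' \<and> p' + g \<le> q' \<and> q' + g \<le> p' + m \<or>
        q' < p' \<and> q' + g \<le> p' \<and> p' + g \<le> q' + m"
      using sep[OF *(1,2)] sep[OF *(2,1)] by auto
    have "p' \<noteq> x" "q' \<noteq> x" "p' \<le> m" "q' \<le> m" "x \<le> m"
      using x(1) x(2)[OF *(1)] x(2)[OF *(2)] T(1) *(1,2) gl by (auto simp: arc_def)
    with le that(3) show ?thesis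
      unfolding *(3,4) r_def by (cases "x < p'"; cases "x < q'"; simp; linarith)
  qed
  let ?U = "\<Union>q\<in>r ` T. {q..<q + l}"
  have "?U \<subseteq> {1..<1 + m}" using r by fastforce
  then have "card ?U = card (rot m x ` ?U)"
    using inj_on_subset[OF inj_on_rot[of m x 1]] by (metis card_image)
  also have "\<dots> \<le> card (\<Union>p\<in>T. arc m p l)"
  proof (rule card_mono)
    show "finite (\<Union>p\<in>T. arc m p l)" by (rule finite_subset[of _ "{1..m}"]) (auto simp: arc_def)
    show "rot m x ` ?U \<subseteq> (\<Union>p\<in>T. arc m p l)"
    proof
      fix y assume "y \<in> rot m x ` ?U"
      then obtain p t where p: "p \<in> T" "t < l" "y = rot m x (r p + t)"
        by (auto simp: nat_le_iff_add)
      have "y = rot m p t"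
        using rot_rot[OF x(1), of "r p" t] r[OF p(1)] p by simp
      moreover have "p \<in> {1..m}" "t < m" using p(1,2) T(1) gl by auto
      ultimately have "y \<in> arc m p l" using rot_in_arc_iff[of p m t l] p(2) gl by simp
      with p(1) show "y \<in> (\<Union>p\<in>T. arc m p l)" by blast
    qed
  qed
  finally have "card ?U \<le> card (\<Union>p\<in>T. arc m p l)" .
  moreover have "l + g * (card (r ` T) - 1) \<le> card ?U"
    using finT T(2) sep_r gl(1) by (intro card_Union_intervals) auto
  ultimately show ?thesis by (simp add: card_image[OF inj])
qed

text \<open>The order is read from the third point because \<open>crosses\<close> is not symmetric:
  only its second point has to avoid the first set, and in the application this is the point at
  \<open>t\<^sub>4\<close>.\<close>

lemma cyc_less_rot:
  assumes "p \<in> {1..m}" "t\<^sub>1 < t\<^sub>2" "t\<^sub>2 < t\<^sub>3" "t\<^sub>3 < t\<^sub>4" "t\<^sub>4 < m"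
  defines "a \<equiv> rot m p t\<^sub>3"
  shows "cyc_less a a (rot m p t\<^sub>4)" "cyc_less a (rot m p t\<^sub>4) (rot m p t\<^sub>1)"
    "cyc_less a (rot m p t\<^sub>1) (rot m p t\<^sub>2)"
  using assms by (auto simp: rot_def cyc_less_def)

section \<open>Presentations\<close>

locale odd_arcs =
  fixes n :: nat
  assumes n: "7 \<le> n"
begin

definition A :: "nat set" where
  "A = {i \<in> {1..2 * n}. odd i}"

definition H :: "nat \<Rightarrow> nat set" where
  "H i = arc (2 * n) i (n + 1)"

text \<open>\<open>C i\<close> is the complement of \<open>H i\<close>, and \<open>G i\<close> is the intersection of \<open>H i\<close> and \<open>H (i + 2)\<close>.\<close>

definition C_start :: "nat \<Rightarrow> nat" where
  "C_start i = (if i + n + 1 \<le> 2 * n then i + n + 1 else i + 1 - n)"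

definition C :: "nat \<Rightarrow> nat set" where
  "C i = arc (2 * n) (C_start i) (n - 1)"

definition succ2 :: "nat \<Rightarrow> nat" where
  "succ2 i = (if i + 2 \<le> 2 * n then i + 2 else 1)"

definition G :: "nat \<Rightarrow> nat set" where
  "G i = arc (2 * n) (succ2 i) (n - 1)"

definition bases :: "nat set set" where
  "bases = {X. X \<subseteq> {1..2 * n} \<and> card X = n + 1 \<and> X \<notin> H ` A}"

text \<open>A basis misses \<open>n - 1\<close> points, so for \<open>S\<close> and \<open>t\<close>
  of the sets \<open>C i\<close> a union of \<open>n + t\<close> points is enough for Hall's
  condition. Since \<open>C i\<close> has \<open>n - 1\<close> points and two neighbouring ones
  cover exactly the \<open>n + 1\<close> points outside of \<open>G i\<close>, the cases
  \<open>t = 0, 1, 2\<close> give these bounds.\<close>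

definition valid :: "nat set \<Rightarrow> bool" where
  "valid S \<longleftrightarrow> S \<subseteq> {1..2 * n} \<and> n \<le> card S \<and> (\<forall>i\<in>A. 2 \<le> card (S - C i)) \<and> (\<forall>i\<in>A. S \<inter> G i \<noteq> {})"

lemma AD: "i \<in> A \<Longrightarrow> 1 \<le> i \<and> i < 2 * n \<and> odd i"
  by (auto simp: A_def le_less)

lemma card_A: "card A = n"
proof -
  have "A = (\<lambda>i. 2 * i + 1) ` {..<n}"
    by (auto simp: A_def elim!: oddE)
  moreover have "inj_on (\<lambda>i. 2 * i + 1) {..<n}" by (auto simp: inj_on_def)
  ultimately show ?thesis by (simp add: card_image)
qed

lemma finite_A: "finite A" by (simp add: A_def)

lemma succ2: "i \<in> A \<Longrightarrow> succ2 i \<in> A" "i \<in> A \<Longrightarrow> succ2 i \<noteq> i"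
  using n by (auto simp: A_def succ2_def)

lemma subsets: "H i \<subseteq> {1..2 * n}" "C i \<subseteq> {1..2 * n}" "G i \<subseteq> {1..2 * n}"
  by (auto simp: H_def C_def G_def arc_def)

lemma finite_subsets [simp]: "finite (H i)" "finite (C i)" "finite (G i)"
  by (rule subsets[THEN finite_subset], simp)+

lemma C_start_in: "i \<in> A \<Longrightarrow> C_start i \<in> {1..2 * n}"
  using AD[of i] by (auto simp: C_start_def)

lemma C_eq: "i \<in> A \<Longrightarrow> C i = {1..2 * n} - H i"
  using AD[of i] n by (auto simp: C_def H_def C_start_def arc_def)

lemma card_H: "i \<in> A \<Longrightarrow> card (H i) = n + 1"
  unfolding H_def using AD[of i] n by (intro card_arc) auto

lemma card_C: "i \<in> A \<Longrightarrow> card (C i) = n - 1"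
  unfolding C_def using C_start_in[of i] n by (intro card_arc) auto

lemma card_G: "i \<in> A \<Longrightarrow> card (G i) = n - 1"
  unfolding G_def using AD[OF succ2(1)[of i]] n by (intro card_arc) auto

lemma separated:
  assumes "i \<in> A" "j \<in> A" "i < j"
  shows "i + 2 \<le> j" "j + 2 \<le> i + 2 * n"
proof -
  from assms have "odd i" "odd j" "1 \<le> i" "j < 2 * n" using AD by auto
  with assms(3) show "i + 2 \<le> j" "j + 2 \<le> i + 2 * n" by presburger+
qed

lemma C_start_inj: "inj_on C_start A"
proof (rule inj_onI)
  fix i j assume "i \<in> A" "j \<in> A" "C_start i = C_start j"
  with AD[of i] AD[of j] show "i = j" by (auto simp: C_start_def split: if_splits)
qed

lemma C_start_separated:
  assumes "i \<in> A" "j \<in> A" "C_start i < C_start j"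
  shows "C_start i + 2 \<le> C_start j \<and> C_start j + 2 \<le> C_start i + 2 * n"
proof -
  from assms have "i \<noteq> j" by auto
  then consider "i < j" | "j < i" by linarith
  then show ?thesis
  proof cases
    case 1
    with separated[OF assms(1,2)] AD[OF assms(1)] AD[OF assms(2)] assms(3) n show ?thesis
      by (auto simp: C_start_def split: if_splits)
  next
    case 2
    with separated[OF assms(2,1)] AD[OF assms(1)] AD[OF assms(2)] assms(3) n show ?thesis
      by (auto simp: C_start_def split: if_splits)
  qed
qed

lemma card_Union_C:
  assumes T: "T \<subseteq> A" "T \<noteq> {}"
  shows "min (2 * n) (n - 1 + 2 * (card T - 1)) \<le> card (\<Union>i\<in>T. C i)"
proof -
  have "min (2 * n) (n - 1 + 2 * (card (C_start ` T) - 1)) \<le> card (\<Union>p\<in>C_start ` T. arc (2 * n) p (n - 1))"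
  proof (rule card_Union_arcs)
    show "p + 2 \<le> q \<and> q + 2 \<le> p + 2 * n" if "p \<in> C_start ` T" "q \<in> C_start ` T" "p < q" for p q
      using that C_start_separated T(1) by blast
  qed (use T C_start_in n in auto)
  moreover have "card (C_start ` T) = card T"
    using inj_on_subset[OF C_start_inj T(1)] by (rule card_image)
  ultimately show ?thesis by (simp add: C_def)
qed

lemma card_Union_G:
  assumes T: "T \<subseteq> A" "card T = 3"
  shows "n + 3 \<le> card (\<Union>i\<in>T. G i)"
proof -
  have inj: "inj_on succ2 A"
  proof (rule inj_onI)
    fix i j assume ij: "i \<in> A" "j \<in> A" "succ2 i = succ2 j"
    then have "1 \<le> i" "i < 2 * n" "1 \<le> j" "j < 2 * n" using AD by blast+
    with ij(3) show "i = j"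
      unfolding succ2_def by (cases "i + 2 \<le> 2 * n"; cases "j + 2 \<le> 2 * n"; simp)
  qed
  have "T \<noteq> {}" using T(2) by auto
  have "min (2 * n) (n - 1 + 2 * (card (succ2 ` T) - 1)) \<le> card (\<Union>p\<in>succ2 ` T. arc (2 * n) p (n - 1))"
  proof (rule card_Union_arcs)
    show "p + 2 \<le> q \<and> q + 2 \<le> p + 2 * n" if "p \<in> succ2 ` T" "q \<in> succ2 ` T" "p < q" for p q
    proof -
      from that T(1) succ2(1) have "p \<in> A" "q \<in> A" by blast+
      with separated that(3) show ?thesis by blast
    qed
    show "succ2 ` T \<subseteq> {1..2 * n}" using T(1) succ2(1) AD by fastforce
  qed (use \<open>T \<noteq> {}\<close> n in auto)
  moreover have "card (succ2 ` T) = 3"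
    using inj_on_subset[OF inj T(1)] T(2) by (simp add: card_image)
  ultimately show ?thesis using n by (simp add: G_def)
qed

lemma card_C_Un_C:
  assumes "i \<in> A" "j \<in> A" "i \<noteq> j"
  shows "n + 1 \<le> card (C i \<union> C j)"
  using card_Union_C[of "{i, j}"] assms n by auto

lemma C_Un_C_succ2:
  assumes "i \<in> A"
  shows "C i \<union> C (succ2 i) = {1..2 * n} - G i"
  using AD[OF assms] n unfolding C_eq[OF assms] C_eq[OF succ2(1)[OF assms]] H_def G_def arc_def
  by (auto simp: succ2_def)

lemma card_C_Un_C_not_adjacent:
  assumes "i \<in> A" "j \<in> A" "i \<noteq> j" "j \<noteq> succ2 i" "i \<noteq> succ2 j"
  shows "n + 2 \<le> card (C i \<union> C j)"
proof -
  \<comment> \<open>The starting points are even 4 apart; a gap of 3 already gives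
    \<open>n - 1 + 3\<close> points.\<close>
  have far: "p + 3 \<le> q \<and> q + 3 \<le> p + 2 * n"
    if "p \<in> {C_start i, C_start j}" "q \<in> {C_start i, C_start j}" "p < q" for p q
  proof -
    have "a + 4 \<le> b \<and> b + 4 \<le> a + 2 * n"
      if ab: "a \<in> A" "b \<in> A" "a < b" "b \<noteq> succ2 a" "a \<noteq> succ2 b" for a b
    proof -
      have "odd a" "odd b" "1 \<le> a" "b < 2 * n" using AD[OF ab(1)] AD[OF ab(2)] by auto
      moreover have "b \<noteq> a + 2" using ab(4) \<open>b < 2 * n\<close> by (auto simp: succ2_def)
      moreover have "\<not> (a = 1 \<and> b = 2 * n - 1)" using ab(5) n by (auto simp: succ2_def split: if_splits)
      ultimately show ?thesis using ab(3) by presburger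
    qed
    from this[of i j] this[of j i] assms have
      "i + 4 \<le> j \<and> j + 4 \<le> i + 2 * n \<or> j + 4 \<le> i \<and> i + 4 \<le> j + 2 * n" by linarith
    with that AD[OF assms(1)] AD[OF assms(2)] show ?thesis
      by (auto simp: C_start_def split: if_splits)
  qed
  have "min (2 * n) (n - 1 + 3 * (card {C_start i, C_start j} - 1))
      \<le> card (\<Union>p\<in>{C_start i, C_start j}. arc (2 * n) p (n - 1))"
    by (rule card_Union_arcs[OF _ _ far]) (use assms C_start_in n in auto)
  moreover have "C_start i \<noteq> C_start j" using C_start_inj assms by (auto dest: inj_onD)
  ultimately show ?thesis using n by (simp add: C_def)
qed

lemma H_Int_C: "i \<in> A \<Longrightarrow> H i \<inter> C i = {}"
  by (auto simp: C_eq)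

lemma card_H_Int_H:
  assumes "i \<in> A" "j \<in> A" "i \<noteq> j"
  shows "card (H i \<inter> H j) + 2 \<le> n + 1"
proof -
  have "H i \<inter> H j = {1..2 * n} - (C i \<union> C j)"
    using subsets(1) by (auto simp: C_eq assms)
  then have "card (H i \<inter> H j) = 2 * n - card (C i \<union> C j)"
    using subsets(2) by (simp add: card_Diff_subset)
  with card_C_Un_C[OF assms] n show ?thesis by linarith
qed

lemma sparse_paving_bases: "sparse_paving (n + 1) {1..2 * n} bases"
  unfolding bases_def
proof (rule sparse_paving_of_separated)
  show "X \<subseteq> {1..2 * n} \<and> card X = n + 1" if "X \<in> H ` A" for X
    using that subsets(1) card_H by blast
  show "card (X \<inter> Y) + 2 \<le> n + 1" if "X \<in> H ` A" "Y \<in> H ` A" "X \<noteq> Y" for X Y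
    using that card_H_Int_H by blast
qed (use n in auto)

lemma card_basis_Int:
  assumes "X \<in> bases" "V \<subseteq> {1..2 * n}"
  shows "card V \<le> card (X \<inter> V) + (n - 1)"
proof -
  have X: "X \<subseteq> {1..2 * n}" "card X = n + 1" using assms by (auto simp: bases_def)
  have fin: "finite X" "finite V" using X assms(2) finite_subset by blast+
  have "card (X \<union> V) \<le> card {1..2 * n}" using X assms(2) by (intro card_mono) auto
  with card_Un_Int[OF fin] X(2) show ?thesis by simp
qed

lemma card_Union_C_ge:
  assumes T: "T \<subseteq> A"
  shows "T \<noteq> {} \<Longrightarrow> card T \<noteq> 1 \<Longrightarrow> n - 1 + card T \<le> card (\<Union>i\<in>T. C i)"
    "3 \<le> card T \<Longrightarrow> n + card T \<le> card (\<Union>i\<in>T. C i)"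
proof -
  have "card T \<le> n" using card_mono[OF finite_A T] card_A by simp
  moreover have "card T \<noteq> 0" if "T \<noteq> {}" using that T finite_A finite_subset by fastforce
  ultimately show "T \<noteq> {} \<Longrightarrow> card T \<noteq> 1 \<Longrightarrow> n - 1 + card T \<le> card (\<Union>i\<in>T. C i)"
    using card_Union_C[OF T] n by (simp add: min_def split: if_splits)
  show "3 \<le> card T \<Longrightarrow> n + card T \<le> card (\<Union>i\<in>T. C i)"
    using card_Union_C[OF T] n \<open>card T \<le> n\<close> by (fastforce simp: min_def split: if_splits)
qed

text \<open>Two or more of the sets cover enough points for any set of \<open>n + 1\<close>
  elements; a single \<open>C i\<close> is the only place where \<open>X \<noteq> H i\<close> is
  needed.\<close>

lemma hall_C:
  assumes "X \<in> bases" "T \<subseteq> A"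
  shows "card T \<le> card (X \<inter> (\<Union>i\<in>T. C i))"
proof -
  have finT: "finite T" using assms(2) finite_A finite_subset by blast
  have sub: "(\<Union>i\<in>T. C i) \<subseteq> {1..2 * n}" using subsets(2) by blast
  consider "T = {}" | "T \<noteq> {}" "card T \<noteq> 1" | i where "T = {i}"
    by (metis card_1_singletonE)
  then show ?thesis
  proof cases
    case 2
    with card_Union_C_ge(1)[OF assms(2)] card_basis_Int[OF assms(1) sub] show ?thesis by linarith
  next
    case 3
    have X: "X \<subseteq> {1..2 * n}" "card X = n + 1" "X \<noteq> H i" using assms 3 by (auto simp: bases_def)
    have "X \<inter> C i \<noteq> {}"
    proof
      assume "X \<inter> C i = {}"
      then have "X \<subseteq> H i" using X(1) assms(2) 3 C_eq[of i] by auto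
      with X card_H[of i] assms(2) 3 show False using card_subset_eq[of "H i" X] by auto
    qed
    then have "1 \<le> card (X \<inter> C i)" by (simp add: Suc_le_eq card_gt_0_iff)
    with 3 show ?thesis by simp
  qed simp
qed

text \<open>For nonempty \<open>T\<close>, only one set or two neighbouring sets \<open>C i\<close>
  need help from \<open>S\<close>: two others already cover \<open>n + 2\<close> points, and three
  or more cover \<open>n + card T\<close>.\<close>

lemma hall_S:
  assumes "X \<in> bases" "T \<subseteq> A" and S: "valid S"
  shows "Suc (card T) \<le> card (X \<inter> (S \<union> (\<Union>i\<in>T. C i)))"
proof -
  let ?V = "S \<union> (\<Union>i\<in>T. C i)"
  have SE: "S \<subseteq> {1..2 * n}" "finite S" using S finite_subset by (auto simp: valid_def)
  have sub: "?V \<subseteq> {1..2 * n}" using subsets(2) SE by blast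
  have finT: "finite T" using assms(2) finite_A finite_subset by blast
  have finV: "finite ?V" using sub finite_subset by blast
  have "n + card T \<le> card ?V"
  proof -
    consider "card T = 0" | "card T = 1" | "card T = 2" | "3 \<le> card T" by linarith
    then show ?thesis
    proof cases
      case 1
      with S finT show ?thesis by (auto simp: valid_def)
    next
      case 2
      then obtain i where T: "T = {i}" by (rule card_1_singletonE)
      have "card ?V = card (S - C i) + card (C i)"
        using SE(2) card_Un_disjoint[of "S - C i" "C i"] by (simp add: T Un_Diff_cancel2 Diff_disjoint inf_commute)
      with S T assms(2) card_C[of i] n show ?thesis by (auto simp: valid_def)
    next
      case 3
      then obtain i j where T: "T = {i, j}" "i \<noteq> j" by (meson card_2_iff)
      with assms(2) have ij: "i \<in> A" "j \<in> A" by auto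
      have adj: "n + 2 \<le> card (S \<union> (C a \<union> C (succ2 a)))" if a: "a \<in> A" for a
      proof -
        have "S \<inter> G a \<noteq> {}" using S a by (auto simp: valid_def)
        then have "C a \<union> C (succ2 a) \<subset> S \<union> (C a \<union> C (succ2 a))"
          unfolding C_Un_C_succ2[OF a] by auto
        then have "card (C a \<union> C (succ2 a)) < card (S \<union> (C a \<union> C (succ2 a)))"
          using SE(2) by (intro psubset_card_mono) auto
        with card_C_Un_C[OF a succ2(1)[OF a]] succ2(2)[OF a] show ?thesis by auto
      qed
      have "n + 2 \<le> card (S \<union> (C i \<union> C j))"
      proof -
        consider "j = succ2 i" | "i = succ2 j" | "j \<noteq> succ2 i" "i \<noteq> succ2 j" by blast
        then show ?thesis
        proof cases
          case 1
          with adj[OF ij(1)] show ?thesis by simp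
        next
          case 2
          with adj[OF ij(2)] show ?thesis by (simp add: Un_commute)
        next
          case 3
          have "card (C i \<union> C j) \<le> card (S \<union> (C i \<union> C j))" using SE(2) by (intro card_mono) auto
          with card_C_Un_C_not_adjacent[OF ij T(2) 3] show ?thesis by simp
        qed
      qed
      with 3 T show ?thesis by simp
    next
      case 4
      have "card (\<Union>i\<in>T. C i) \<le> card ?V" using finV by (intro card_mono) auto
      with card_Union_C_ge(2)[OF assms(2) 4] show ?thesis by simp
    qed
  qed
  with card_basis_Int[OF assms(1) sub] n show ?thesis by linarith
qed

text \<open>Positions in the list are arbitrary, so \<open>f\<close> records where the complements
  stand, and \<open>z\<close> is the position of the free set.\<close>

definition arranged :: "nat set list \<Rightarrow> (nat \<Rightarrow> nat) \<Rightarrow> nat \<Rightarrow> bool" where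
  "arranged Ss f z \<longleftrightarrow> length Ss = n + 1 \<and> z < n + 1 \<and> bij_betw f A ({..<n + 1} - {z}) \<and>
     (\<forall>i\<in>A. Ss ! f i = C i)"

lemma presentation_of_valid:
  assumes arr: "arranged Ss f z" and S: "valid (Ss ! z)"
  shows "presentation {1..2 * n} bases Ss"
proof -
  have len: "length Ss = n + 1" "z < n + 1" and f: "bij_betw f A ({..<n + 1} - {z})"
    and Sf: "\<And>i. i \<in> A \<Longrightarrow> Ss ! f i = C i"
    using arr by (auto simp: arranged_def)
  have fA: "f ` A = {..<n + 1} - {z}" and injf: "inj_on f A" using f by (auto simp: bij_betw_def)
  have SE: "Ss ! j \<subseteq> {1..2 * n}" if "j < n + 1" for j
  proof (cases "j = z")
    case True
    with S show ?thesis by (auto simp: valid_def)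
  next
    case False
    with that fA obtain i where "i \<in> A" "j = f i" by (metis DiffI imageE lessThan_iff singletonD)
    with Sf subsets(2) show ?thesis by simp
  qed
  have "X \<in> transversals Ss \<longleftrightarrow> X \<in> bases" for X
  proof
    assume "X \<in> transversals Ss"
    then obtain \<phi> where \<phi>: "bij_betw \<phi> {..<n + 1} X" "\<And>j. j < n + 1 \<Longrightarrow> \<phi> j \<in> Ss ! j"
      using len by (auto simp: transversals_def)
    have "card X = n + 1" using bij_betw_same_card[OF \<phi>(1)] by simp
    moreover have "X \<subseteq> {1..2 * n}" using \<phi> SE by (fastforce simp: bij_betw_def)
    moreover have "X \<noteq> H i" if i: "i \<in> A" for i
    proof -
      have "f i < n + 1" using fA i by blast
      then have "\<phi> (f i) \<in> C i" "\<phi> (f i) \<in> X" using \<phi> Sf[OF i] by (auto simp: bij_betw_def)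
      with H_Int_C[OF i] show ?thesis by auto
    qed
    ultimately show "X \<in> bases" by (auto simp: bases_def)
  next
    assume X: "X \<in> bases"
    then have Xc: "card X = n + 1" "finite X" by (auto simp: bases_def intro: finite_subset)
    have "\<exists>\<phi>. inj_on \<phi> {..<n + 1} \<and> (\<forall>j\<in>{..<n + 1}. \<phi> j \<in> X \<inter> Ss ! j)"
    proof (rule Hall)
      fix K :: "nat set" assume K: "K \<subseteq> {..<n + 1}"
      define T where "T = {i \<in> A. f i \<in> K}"
      have T: "T \<subseteq> A" "finite T" using finite_A by (auto simp: T_def)
      have "f ` T = f ` A \<inter> K" unfolding T_def by blast
      also have "\<dots> = K - {z}" unfolding fA using K by blast
      finally have fT: "f ` T = K - {z}" .
      then have cT: "card T = card (K - {z})"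
        using inj_on_subset[OF injf T(1)] by (metis card_image)
      have UT: "(\<Union>j\<in>K - {z}. Ss ! j) = (\<Union>i\<in>T. C i)"
        unfolding fT[symmetric] using Sf T(1) by auto
      show "card K \<le> card (\<Union>j\<in>K. X \<inter> Ss ! j)"
      proof (cases "z \<in> K")
        case True
        have "(\<Union>j\<in>K. X \<inter> Ss ! j) = X \<inter> (Ss ! z \<union> (\<Union>j\<in>K - {z}. Ss ! j))" using True by auto
        moreover have "card K = Suc (card T)"
          unfolding cT by (rule card.remove[OF finite_subset[OF K] True]) simp
        ultimately show ?thesis using hall_S[OF X T(1) S] UT by simp
      next
        case False
        then have "(\<Union>j\<in>K. X \<inter> Ss ! j) = X \<inter> (\<Union>j\<in>K - {z}. Ss ! j)" "K - {z} = K" by auto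
        then show ?thesis using hall_C[OF X T(1)] UT cT by simp
      qed
    qed (use Xc in auto)
    then obtain \<phi> where \<phi>: "inj_on \<phi> {..<n + 1}" "\<And>j. j < n + 1 \<Longrightarrow> \<phi> j \<in> X \<inter> Ss ! j" by blast
    have "\<phi> ` {..<n + 1} = X"
      by (rule card_subset_eq[OF Xc(2)]) (use \<phi> Xc card_image[OF \<phi>(1)] in auto)
    with \<phi> len show "X \<in> transversals Ss"
      by (auto simp: transversals_def bij_betw_def intro!: exI[of _ \<phi>])
  qed
  then have "transversals Ss = bases" by blast
  moreover have "bases \<noteq> {}"
    using sparse_paving_bases by (auto simp: sparse_paving_def matroid_bases_def)
  moreover have "\<forall>S\<in>set Ss. S \<subseteq> {1..2 * n}" using SE len(1) by (metis in_set_conv_nth)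
  ultimately show ?thesis by (simp add: presentation_def)
qed

lemma transversal_bases: "transversal_matroid {1..2 * n} bases"
proof -
  obtain g where g: "bij_betw g {..<n} A"
    using ex_bij_betw_nat_finite[OF finite_A] card_A by (auto simp: lessThan_atLeast0)
  define f where "f = inv_into {..<n} g"
  have f: "bij_betw f A {..<n}" unfolding f_def by (rule bij_betw_inv_into[OF g])
  \<comment> \<open>The whole ground set is the simplest valid choice of the free set.\<close>
  define Ss where "Ss = map (\<lambda>j. C (g j)) [0..<n] @ [{1..2 * n}]"
  have "{..<n + 1} - {n} = {..<n}" by auto
  with f have "bij_betw f A ({..<n + 1} - {n})" by simp
  moreover have "Ss ! f i = C i" if i: "i \<in> A" for i
  proof -
    have "f i < n" using f i by (auto simp: bij_betw_def)
    moreover have "g (f i) = i" unfolding f_def using g i by (simp add: bij_betw_inv_into_right)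
    ultimately show ?thesis by (simp add: Ss_def nth_append)
  qed
  ultimately have arr: "arranged Ss f n" by (simp add: arranged_def Ss_def)
  have "valid {1..2 * n}"
  proof -
    have "card ({1..2 * n} - C i) = n + 1" if "i \<in> A" for i
      using card_C[OF that] subsets(2)[of i] n by (simp add: card_Diff_subset)
    moreover have "{1..2 * n} \<inter> G i \<noteq> {}" if "i \<in> A" for i
    proof -
      have "G i \<noteq> {}" using card_G[OF that] n by auto
      with subsets(3)[of i] show ?thesis by auto
    qed
    ultimately show ?thesis using n by (auto simp: valid_def)
  qed
  moreover have "Ss ! n = {1..2 * n}" by (simp add: Ss_def nth_append)
  ultimately have "presentation {1..2 * n} bases Ss" using presentation_of_valid[OF arr] by simp
  then show ?thesis unfolding transversal_matroid_def by blast
qed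

end

lemma transversal_hits:
  assumes B: "B \<in> transversals Ss" and K: "K \<subseteq> {..<length Ss}"
  shows "card K \<le> card (B \<inter> (\<Union>j\<in>K. Ss ! j))"
proof -
  from B obtain \<phi> where \<phi>: "bij_betw \<phi> {..<length Ss} B" "\<And>j. j < length Ss \<Longrightarrow> \<phi> j \<in> Ss ! j"
    by (auto simp: transversals_def)
  have "finite B" using bij_betw_finite[OF \<phi>(1)] by simp
  moreover have "\<phi> ` K \<subseteq> B \<inter> (\<Union>j\<in>K. Ss ! j)"
  proof (rule image_subsetI)
    fix j assume j: "j \<in> K"
    with K have "j \<in> {..<length Ss}" by blast
    with \<phi>(2)[of j] bij_betwE[OF \<phi>(1)] j show "\<phi> j \<in> B \<inter> (\<Union>j\<in>K. Ss ! j)" by blast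
  qed
  ultimately have "card (\<phi> ` K) \<le> card (B \<inter> (\<Union>j\<in>K. Ss ! j))" by (intro card_mono) auto
  moreover have "inj_on \<phi> K" using \<phi>(1) K by (auto simp: bij_betw_def intro: inj_on_subset)
  ultimately show ?thesis by (simp add: card_image)
qed

section \<open>The sets of an arbitrary presentation\<close>

context odd_arcs
begin

lemma card_Un_C: "finite S \<Longrightarrow> i \<in> A \<Longrightarrow> card (S \<union> C i) = card (S - C i) + (n - 1)"
  using card_Un_disjoint[of "S - C i" "C i"] card_C[of i]
  by (simp add: Un_Diff_cancel2 Diff_disjoint inf_commute)

text \<open>Distinct sets \<open>H i\<close> share at most \<open>n - 1\<close> elements, so a set
  that shares \<open>n\<close> elements with \<open>H i\<close> is no other
  \<open>H j\<close>.\<close>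

lemma basis_near_H:
  assumes i: "i \<in> A" and B: "B \<subseteq> {1..2 * n}" "card B = n + 1" "B \<noteq> H i" "n \<le> card (B \<inter> H i)"
  shows "B \<in> bases"
proof -
  have "B \<noteq> H j" if "j \<in> A" for j
    using card_H_Int_H[OF that i] B(3,4) by (cases "j = i") auto
  with B(1,2) show ?thesis by (auto simp: bases_def)
qed

lemma exchange_H:
  assumes i: "i \<in> A" and xy: "x \<in> C i" "y \<in> H i"
  shows "insert x (H i - {y}) \<in> bases"
proof (rule basis_near_H[OF i])
  have x: "x \<notin> H i" "x \<in> {1..2 * n}" using xy(1) C_eq[OF i] by auto
  show "insert x (H i - {y}) \<subseteq> {1..2 * n}" using x subsets(1)[of i] by auto
  have c: "card (H i - {y}) = n" using xy(2) card_H[OF i] by (simp add: card_Diff_singleton)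
  with x show "card (insert x (H i - {y})) = n + 1" by simp
  show "insert x (H i - {y}) \<noteq> H i" using x by auto
  have "H i - {y} \<subseteq> insert x (H i - {y}) \<inter> H i" by auto
  from card_mono[OF _ this] c show "n \<le> card (insert x (H i - {y}) \<inter> H i)" by simp
qed

lemma C_nonempty: "i \<in> A \<Longrightarrow> C i \<noteq> {}"
  using card_C[of i] n by auto

lemma presentation_length:
  assumes "presentation {1..2 * n} bases Ss"
  shows "length Ss = n + 1"
proof -
  from assms obtain B where "B \<in> transversals Ss" "B \<in> bases"
    unfolding presentation_def by blast
  then show ?thesis
    by (auto simp: transversals_def bases_def dest: bij_betw_same_card)
qed

text \<open>\<open>H i\<close> violates Hall's condition at some \<open>K\<close>, while every
  single exchange of \<open>H i\<close> gives a basis. Removing an element of the union over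
  \<open>K\<close> would leave the violation in place, so the union is disjoint from
  \<open>H i\<close> and its sets lie in \<open>C i\<close>. Exchanging any \<open>x\<close> of
  \<open>C i\<close> into \<open>H i\<close> shows that such a set contains
  \<open>x\<close>.\<close>

lemma presentation_contains_C:
  assumes pres: "presentation {1..2 * n} bases Ss" and i: "i \<in> A"
  shows "\<exists>j<n + 1. Ss ! j = C i"
proof -
  have len: "length Ss = n + 1" using presentation_length[OF pres] .
  have hits: "card K \<le> card (B \<inter> (\<Union>j\<in>K. Ss ! j))" if "B \<in> bases" "K \<subseteq> {..<n + 1}" for B K
    using transversal_hits[of B Ss K] that pres len by (auto simp: presentation_def)
  have "\<exists>K\<subseteq>{..<n + 1}. card (\<Union>j\<in>K. H i \<inter> Ss ! j) < card K"
  proof (rule ccontr)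
    assume "\<not> ?thesis"
    then have "\<And>K. K \<subseteq> {..<n + 1} \<Longrightarrow> card K \<le> card (\<Union>j\<in>K. H i \<inter> Ss ! j)"
      using not_less by blast
    then have "\<exists>\<phi>. inj_on \<phi> {..<n + 1} \<and> (\<forall>j\<in>{..<n + 1}. \<phi> j \<in> H i \<inter> Ss ! j)"
      by (intro Hall) auto
    then obtain \<phi> where \<phi>: "inj_on \<phi> {..<n + 1}" "\<And>j. j < n + 1 \<Longrightarrow> \<phi> j \<in> H i \<inter> Ss ! j" by blast
    have "\<phi> ` {..<n + 1} = H i"
      by (rule card_subset_eq) (use \<phi> card_image[OF \<phi>(1)] card_H[OF i] in auto)
    with \<phi> len have "H i \<in> transversals Ss"
      by (auto simp: transversals_def bij_betw_def intro!: exI[of _ \<phi>])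
    with pres i show False by (auto simp: presentation_def bases_def)
  qed
  then obtain K where K: "K \<subseteq> {..<n + 1}" "card (\<Union>j\<in>K. H i \<inter> Ss ! j) < card K" by blast
  let ?U = "\<Union>j\<in>K. Ss ! j"
  have U: "(\<Union>j\<in>K. H i \<inter> Ss ! j) = H i \<inter> ?U" by auto
  obtain x where x: "x \<in> C i" using C_nonempty[OF i] by blast
  have disj: "H i \<inter> ?U = {}"
  proof (rule ccontr)
    assume "H i \<inter> ?U \<noteq> {}"
    then obtain y where y: "y \<in> H i" "y \<in> ?U" by blast
    let ?B = "insert x (H i - {y})"
    have "card (?B \<inter> ?U) \<le> card (H i \<inter> ?U)"
    proof -
      have "?B \<inter> ?U \<subseteq> insert x (H i \<inter> ?U - {y})" by auto
      then have "card (?B \<inter> ?U) \<le> card (insert x (H i \<inter> ?U - {y}))" by (intro card_mono) auto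
      also have "\<dots> \<le> Suc (card (H i \<inter> ?U - {y}))" by (simp add: card_insert_if)
      also have "\<dots> = card (H i \<inter> ?U)" using y by (intro card_Suc_Diff1) auto
      finally show ?thesis .
    qed
    with hits[OF exchange_H[OF i x y(1)] K(1)] K(2) U show False by simp
  qed
  have "K \<noteq> {}" using K(2) by auto
  then obtain j where j: "j \<in> K" "j < n + 1" using K(1) by blast
  have dj: "H i \<inter> Ss ! j = {}" using disj j(1) by blast
  have "Ss ! j \<in> set Ss" using j(2) len by simp
  then have "Ss ! j \<subseteq> {1..2 * n}" using pres unfolding presentation_def by blast
  with dj have sub: "Ss ! j \<subseteq> C i" using C_eq[OF i] by blast
  have "C i \<subseteq> Ss ! j"
  proof
    fix x assume x: "x \<in> C i"
    obtain y where y: "y \<in> H i" using card_H[OF i] by fastforce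
    have "card {j} \<le> card (insert x (H i - {y}) \<inter> (\<Union>j\<in>{j}. Ss ! j))"
      using exchange_H[OF i x y] j(2) by (intro hits) auto
    then have "insert x (H i - {y}) \<inter> Ss ! j \<noteq> {}" by auto
    with dj show "x \<in> Ss ! j" by blast
  qed
  with sub j(2) show ?thesis by blast
qed

lemma C_inj: "i \<in> A \<Longrightarrow> j \<in> A \<Longrightarrow> C i = C j \<Longrightarrow> i = j"
  using card_C_Un_C[of i j] card_C[of i] by fastforce

lemma presentation_arranged:
  assumes pres: "presentation {1..2 * n} bases Ss"
  obtains f z where "arranged Ss f z"
proof -
  from presentation_contains_C[OF pres] obtain f where
    f: "\<And>i. i \<in> A \<Longrightarrow> f i < n + 1" "\<And>i. i \<in> A \<Longrightarrow> Ss ! f i = C i" by metis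
  have inj: "inj_on f A" using f(2) C_inj by (metis inj_onI)
  have sub: "f ` A \<subseteq> {..<n + 1}" using f(1) by auto
  have "card ({..<n + 1} - f ` A) = 1"
    using card_image[OF inj] card_A sub finite_A by (simp add: card_Diff_subset)
  then obtain z where z: "{..<n + 1} - f ` A = {z}" by (rule card_1_singletonE)
  then have "f ` A = {..<n + 1} - {z}" "z < n + 1" using sub by blast+
  with inj f(2) presentation_length[OF pres] have "arranged Ss f z"
    by (auto simp: arranged_def bij_betw_def)
  then show ?thesis by (rule that)
qed

text \<open>If a bound fails, there is a basis that meets \<open>S\<close> and the relevant sets
  \<open>C i\<close> in too few points. It has to be shown that the set constructed is not one of
  the \<open>H j\<close>.\<close>

lemma valid_of_presentation:
  assumes pres: "presentation {1..2 * n} bases Ss" and arr: "arranged Ss f z"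
  shows "valid (Ss ! z)"
proof -
  let ?S = "Ss ! z"
  have len: "length Ss = n + 1" "z < n + 1" and f: "bij_betw f A ({..<n + 1} - {z})"
    and Sf: "\<And>i. i \<in> A \<Longrightarrow> Ss ! f i = C i"
    using arr by (auto simp: arranged_def)
  have fA: "f i < n + 1" "f i \<noteq> z" if "i \<in> A" for i using f that by (auto simp: bij_betw_def)
  have injf: "inj_on f A" using f by (simp add: bij_betw_def)
  have hits: "Suc (card T) \<le> card (B \<inter> (?S \<union> (\<Union>i\<in>T. C i)))" if "B \<in> bases" "T \<subseteq> A" for B T
  proof -
    have finT: "finite T" using that(2) finite_A finite_subset by blast
    have "card (insert z (f ` T)) \<le> card (B \<inter> (\<Union>j\<in>insert z (f ` T). Ss ! j))"
    proof (rule transversal_hits)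
      show "B \<in> transversals Ss" using that(1) pres by (simp add: presentation_def)
      show "insert z (f ` T) \<subseteq> {..<length Ss}" using len fA(1) that(2) by auto
    qed
    moreover have "card (insert z (f ` T)) = Suc (card T)"
    proof -
      have "z \<notin> f ` T" using fA(2) that(2) by blast
      with finT card_image[OF inj_on_subset[OF injf that(2)]] show ?thesis by simp
    qed
    moreover have "(\<Union>j\<in>insert z (f ` T). Ss ! j) = ?S \<union> (\<Union>i\<in>T. C i)" using Sf that(2) by auto
    ultimately show ?thesis by simp
  qed
  have "?S \<in> set Ss" using len by simp
  then have SE: "?S \<subseteq> {1..2 * n}" using pres unfolding presentation_def by blast
  then have finS: "finite ?S" by (rule finite_subset) simp
  have two: "2 \<le> card (?S - C i)" if i: "i \<in> A" for i
  proof (rule ccontr)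
    assume "\<not> ?thesis"
    then have "card (?S \<union> C i) \<le> n" using card_Un_C[OF finS i] n by simp
    moreover have "card ({1..2 * n} - (?S \<union> C i)) = 2 * n - card (?S \<union> C i)"
      using SE subsets(2)[of i] finS by (subst card_Diff_subset) auto
    ultimately have "n \<le> card ({1..2 * n} - (?S \<union> C i))" by simp
    then obtain Z where Z: "Z \<subseteq> {1..2 * n} - (?S \<union> C i)" "card Z = n" "finite Z"
      by (rule obtain_subset_with_card_n)
    obtain x where x: "x \<in> C i" using C_nonempty[OF i] by blast
    have ZH: "Z \<subseteq> H i" using Z(1) C_eq[OF i] by blast
    have xZ: "x \<notin> Z" using x Z(1) by blast
    have "insert x Z \<in> bases"
    proof (rule basis_near_H[OF i])
      show "insert x Z \<subseteq> {1..2 * n}" using Z(1) x subsets(2) by blast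
      show "card (insert x Z) = n + 1" using Z xZ by simp
      show "insert x Z \<noteq> H i" using x H_Int_C[OF i] by blast
      have "Z \<subseteq> insert x Z \<inter> H i" using ZH by blast
      from card_mono[OF _ this] Z(2) show "n \<le> card (insert x Z \<inter> H i)" by simp
    qed
    from hits[OF this, of "{i}"] i have "2 \<le> card (insert x Z \<inter> (?S \<union> C i))" by simp
    moreover have "insert x Z \<inter> (?S \<union> C i) \<subseteq> {x}" using Z(1) by blast
    then have "card (insert x Z \<inter> (?S \<union> C i)) \<le> card {x}" by (intro card_mono) auto
    ultimately show False by simp
  qed
  moreover have "?S \<inter> G i \<noteq> {}" if i: "i \<in> A" for i
  proof
    assume SG: "?S \<inter> G i = {}"
    have "card ({1..2 * n} - G i) = n + 1"
      using card_G[OF i] subsets(3)[of i] n by (simp add: card_Diff_subset)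
    \<comment> \<open>Three points outside of \<open>G i\<close> give two candidates that share the
      \<open>n\<close> elements of \<open>insert x (G i)\<close>. Distinct sets \<open>H a\<close>
      and \<open>H b\<close> cannot share that many, so one candidate is a basis.\<close>
    then have "3 \<le> card ({1..2 * n} - G i)" using n by simp
    then obtain P where P: "P \<subseteq> {1..2 * n} - G i" "card P = 3" by (rule obtain_subset_with_card_n) blast
    then obtain x y y' where xy: "P = {x, y, y'}" "x \<noteq> y" "x \<noteq> y'" "y \<noteq> y'"
      by (auto simp: card_3_iff)
    have small: "card (insert x (insert u (G i)) \<inter> (?S \<union> (\<Union>i\<in>{i, succ2 i}. C i))) \<le> 2" for u
    proof -
      have "insert x (insert u (G i)) \<inter> (?S \<union> (\<Union>i\<in>{i, succ2 i}. C i)) \<subseteq> {x, u}"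
        using SG C_Un_C_succ2[OF i] by blast
      then have "card (insert x (insert u (G i)) \<inter> (?S \<union> (\<Union>i\<in>{i, succ2 i}. C i))) \<le> card {x, u}"
        by (intro card_mono) simp_all
      also have "\<dots> \<le> 2" by (simp add: card_insert_if)
      finally show ?thesis .
    qed
    have no: "insert x (insert u (G i)) \<notin> bases" for u
    proof
      assume "insert x (insert u (G i)) \<in> bases"
      from hits[OF this, of "{i, succ2 i}"] small[of u] i succ2[OF i] show False by auto
    qed
    have B: "insert x (insert u (G i)) \<in> H ` A" if u: "u = y \<or> u = y'" for u
    proof -
      have "x \<notin> G i" "u \<notin> G i" "x \<noteq> u" "x \<in> {1..2 * n}" "u \<in> {1..2 * n}" using P(1) xy u by auto
      then have "card (insert x (insert u (G i))) = n + 1" "insert x (insert u (G i)) \<subseteq> {1..2 * n}"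
        using card_G[OF i] n subsets(3)[of i] by auto
      with no[of u] show ?thesis by (simp add: bases_def)
    qed
    from B[of y] obtain a where a: "a \<in> A" "insert x (insert y (G i)) = H a" by auto
    from B[of y'] obtain b where b: "b \<in> A" "insert x (insert y' (G i)) = H b" by auto
    have "y \<in> H a" using a(2) by blast
    moreover have "y \<notin> H b" unfolding b(2)[symmetric] using xy P(1) by auto
    ultimately have "a \<noteq> b" by auto
    note ab = a(1) b(1) a(2) b(2)
    have "x \<notin> G i" using P(1) xy by auto
    then have "card (insert x (G i)) = n" using card_G[OF i] n by simp
    moreover have "insert x (G i) \<subseteq> H a \<inter> H b" using ab by blast
    then have "card (insert x (G i)) \<le> card (H a \<inter> H b)" by (intro card_mono) auto
    ultimately show False using card_H_Int_H[OF ab(1,2) \<open>a \<noteq> b\<close>] by simp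
  qed
  moreover have "n \<le> card ?S"
  proof (rule ccontr)
    assume "\<not> ?thesis"
    moreover have "card ({1..2 * n} - ?S) = 2 * n - card ?S" using SE finS by (simp add: card_Diff_subset)
    ultimately have "n + 1 \<le> card ({1..2 * n} - ?S)" by simp
    then obtain X where X: "X \<subseteq> {1..2 * n} - ?S" "card X = n + 1" by (rule obtain_subset_with_card_n) blast
    have "X \<in> bases"
    proof (rule ccontr)
      assume "X \<notin> bases"
      with X obtain i where i: "i \<in> A" "X = H i" by (auto simp: bases_def)
      with X(1) SE have "?S - C i = {}" using C_eq[OF i(1)] by blast
      with two[OF i(1)] show False by simp
    qed
    from hits[OF this, of "{}"] have "X \<inter> ?S \<noteq> {}" by auto
    with X(1) show False by blast
  qed
  ultimately show ?thesis using SE by (simp add: valid_def)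
qed

text \<open>At most four points of \<open>S\<close> are needed for the condition on the sets \<open>S - C i\<close> and at most two for
  the condition on the sets \<open>S \<inter> G i\<close>.\<close>

lemma valid_remove:
  assumes S: "valid S" and big: "n < card S"
  obtains z where "z \<in> S" "valid (S - {z})"
proof -
  have SE: "S \<subseteq> {1..2 * n}" using S by (simp add: valid_def)
  then have finS: "finite S" by (rule finite_subset) simp
  have S2: "\<And>i. i \<in> A \<Longrightarrow> 2 \<le> card (S - C i)" and S3: "\<And>i. i \<in> A \<Longrightarrow> S \<inter> G i \<noteq> {}"
    using S by (auto simp: valid_def)
  define T where "T = {i \<in> A. card (S - C i) = 2}"
  have finT: "finite T" using finite_A by (simp add: T_def)
  \<comment> \<open>\<open>T\<close> collects the indices whose bound is attained. As
    \<open>S\<close> has more than \<open>n\<close> points and \<open>C i\<close> only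
    \<open>n - 1\<close>, this is possible only for \<open>C i \<subseteq> S\<close>; three such
    sets would cover \<open>n + 3\<close> points.\<close>
  have T_sub: "C i \<subseteq> S \<and> card S = n + 1" if "i \<in> T" for i
  proof -
    have i: "i \<in> A" "card (S - C i) = 2" using that by (auto simp: T_def)
    have "card (S - C i) + card (S \<inter> C i) = card S"
      using finS by (metis Int_Diff_Un Int_Diff_disjoint add.commute card_Un_disjoint finite_Diff finite_Int)
    moreover have "card (S \<inter> C i) \<le> card (C i)" by (intro card_mono) auto
    ultimately have "card (S \<inter> C i) = card (C i)" "card S = n + 1"
      using i card_C[OF i(1)] big n by auto
    then show ?thesis using card_subset_eq[of "C i" "S \<inter> C i"] by auto
  qed
  have "card T \<le> 2"
  proof (rule ccontr)
    assume "\<not> ?thesis"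
    then obtain T' where T': "T' \<subseteq> T" "card T' = 3"
      using obtain_subset_with_card_n[of 3 T] by auto
    have "T' \<subseteq> A" "T' \<noteq> {}" using T' by (auto simp: T_def)
    from card_Union_C[OF this] T'(2) n have "n + 3 \<le> card (\<Union>i\<in>T'. C i)" by simp
    also have "\<dots> \<le> card S" using T_sub T'(1) finS by (intro card_mono) auto
    also have "card S = n + 1" using T_sub T'(1) \<open>T' \<noteq> {}\<close> by blast
    finally show False by simp
  qed
  define Z\<^sub>1 where "Z\<^sub>1 = (\<Union>i\<in>T. S - C i)"
  have "card Z\<^sub>1 \<le> (\<Sum>i\<in>T. card (S - C i))" unfolding Z\<^sub>1_def by (rule card_UN_le[OF finT])
  also have "\<dots> = 2 * card T" by (simp add: T_def)
  finally have Z1: "card Z\<^sub>1 \<le> 4" using \<open>card T \<le> 2\<close> by simp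
  \<comment> \<open>Three points that are sole witnesses would give three sets \<open>G i\<close>
    covering \<open>n + 3\<close> points, but outside of \<open>S\<close> there are at most
    \<open>n - 1\<close>, so together with these three at most \<open>n + 2\<close> are
    available.\<close>
  define Z\<^sub>2 where "Z\<^sub>2 = {z \<in> S. \<exists>i\<in>A. S \<inter> G i = {z}}"
  have Z2: "card Z\<^sub>2 \<le> 2"
  proof (rule ccontr)
    assume "\<not> ?thesis"
    then obtain Z where Z: "Z \<subseteq> Z\<^sub>2" "card Z = 3" "finite Z"
      using obtain_subset_with_card_n[of 3 Z\<^sub>2] by auto
    then have "\<forall>z\<in>Z. \<exists>i. i \<in> A \<and> S \<inter> G i = {z}" by (auto simp: Z\<^sub>2_def)
    then obtain g where g: "\<And>z. z \<in> Z \<Longrightarrow> g z \<in> A \<and> S \<inter> G (g z) = {z}" by metis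
    have "inj_on g Z" using g by (metis inj_onI singleton_inject)
    then have "card (g ` Z) = 3" using Z by (simp add: card_image)
    moreover have "g ` Z \<subseteq> A" using g by blast
    ultimately have "n + 3 \<le> card (\<Union>i\<in>g ` Z. G i)" by (intro card_Union_G)
    also have "\<dots> \<le> card (({1..2 * n} - S) \<union> Z)"
    proof (rule card_mono)
      show "(\<Union>i\<in>g ` Z. G i) \<subseteq> ({1..2 * n} - S) \<union> Z"
      proof
        fix x assume "x \<in> (\<Union>i\<in>g ` Z. G i)"
        then obtain z where z: "z \<in> Z" "x \<in> G (g z)" by blast
        then have "x \<in> {1..2 * n}" using subsets(3) by blast
        moreover have "x \<in> Z" if "x \<in> S"
        proof -
          have "x \<in> S \<inter> G (g z)" using z(2) that by blast
          with g[OF z(1)] have "x = z" by auto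
          with z(1) show ?thesis by simp
        qed
        ultimately show "x \<in> ({1..2 * n} - S) \<union> Z" by blast
      qed
    qed (use Z(3) in simp)
    also have "\<dots> \<le> card ({1..2 * n} - S) + card Z" by (rule card_Un_le)
    also have "card ({1..2 * n} - S) = 2 * n - card S" using SE finS by (simp add: card_Diff_subset)
    finally show False using big Z(2) n by linarith
  qed
  have "card (Z\<^sub>1 \<union> Z\<^sub>2) < card S"
    using card_Un_le[of Z\<^sub>1 Z\<^sub>2] Z1 Z2 big n by simp
  then have "\<not> S \<subseteq> Z\<^sub>1 \<union> Z\<^sub>2"
    using finS finT card_mono[of "Z\<^sub>1 \<union> Z\<^sub>2" S] by (auto simp: Z\<^sub>1_def Z\<^sub>2_def)
  then obtain z where z: "z \<in> S" "z \<notin> Z\<^sub>1" "z \<notin> Z\<^sub>2" by blast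
  have "valid (S - {z})"
  proof -
    have "2 \<le> card (S - {z} - C i)" if i: "i \<in> A" for i
    proof (cases "i \<in> T")
      case True
      with z(1,2) have "S - {z} - C i = S - C i" by (auto simp: Z\<^sub>1_def)
      with S2[OF i] show ?thesis by simp
    next
      case False
      with i S2[OF i] have "3 \<le> card (S - C i)" by (auto simp: T_def)
      moreover have "S - {z} - C i = S - C i - {z}" by blast
      moreover have "card (S - C i) - 1 \<le> card (S - C i - {z})" using finS by (simp add: card_Diff_singleton_if)
      ultimately show ?thesis by simp
    qed
    moreover have "(S - {z}) \<inter> G i \<noteq> {}" if i: "i \<in> A" for i
    proof
      assume "(S - {z}) \<inter> G i = {}"
      with S3[OF i] have "S \<inter> G i = {z}" by blast
      with i z show False by (auto simp: Z\<^sub>2_def)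
    qed
    moreover have "n \<le> card (S - {z})" using z(1) big by (simp add: card_Diff_singleton)
    ultimately show ?thesis using SE by (auto simp: valid_def)
  qed
  with z(1) that show ?thesis by blast
qed

section \<open>Crossings\<close>

text \<open>The starting points of the sets \<open>C i\<close> are the points with the parity of
  \<open>n\<close>, so one of any two neighbouring points is a start.\<close>

lemma arc_in_C:
  assumes p: "p \<in> {1..2 * n}"
  obtains i e where "i \<in> A" "e \<le> 1" "rot (2 * n) p e = C_start i"
proof -
  have start: "\<exists>i\<in>A. C_start i = q" if q: "q \<in> {1..2 * n}" "even q \<longleftrightarrow> even n" for q
  proof (cases "n + 1 < q")
    case True
    with q show ?thesis
      by (intro bexI[of _ "q - n - 1"]) (auto simp: A_def C_start_def)
  next
    case False
    with q n show ?thesis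
      by (intro bexI[of _ "q + n - 1"]) (auto simp: A_def C_start_def)
  qed
  show ?thesis
  proof (cases "even p \<longleftrightarrow> even n")
    case True
    with start[OF p] obtain i where "i \<in> A" "C_start i = p" by blast
    with that[of i 0] p show ?thesis by (auto simp: rot_def)
  next
    case False
    let ?q = "rot (2 * n) p 1"
    have "?q \<in> {1..2 * n}" using p n by (intro rot_in) auto
    moreover have "even ?q \<longleftrightarrow> even n" using False p by (auto simp: rot_def)
    ultimately obtain i where "i \<in> A" "C_start i = ?q" using start by blast
    with that[of i 1] show ?thesis by simp
  qed
qed

text \<open>Two gaps of \<open>S\<close> with an element between them, all inside some
  \<open>C i\<close>, cross together with an element of \<open>S\<close> outside of
  \<open>C i\<close>.\<close>

lemma crossing_of_pattern:
  assumes S: "\<And>i. i \<in> A \<Longrightarrow> \<not> S \<subseteq> C i" "S \<subseteq> {1..2 * n}"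
    and x: "x \<in> {1..2 * n}" and t: "0 < t" "t < t'" "t' \<le> n - 3"
    and pat: "x \<notin> S" "rot (2 * n) x t \<in> S" "rot (2 * n) x t' \<notin> S"
  shows "\<exists>i\<in>A. crosses (2 * n) (C i) S"
proof -
  \<comment> \<open>\<open>y\<close> is the predecessor of \<open>x\<close>. Some \<open>C i\<close>
    starts at \<open>y\<close> or \<open>x\<close> and, having \<open>n - 1\<close> points, reaches
    at least \<open>n - 3\<close> steps beyond \<open>x\<close>, which is the bound on
    \<open>t'\<close>.\<close>
  define y where "y = rot (2 * n) x (2 * n - 1)"
  have y: "y \<in> {1..2 * n}" unfolding y_def using x by (intro rot_in) auto
  have yx: "rot (2 * n) y s = rot (2 * n) x (s - 1)" if "1 \<le> s" "s \<le> n" for s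
    using x that n by (auto simp: y_def rot_def)
  obtain i e where i: "i \<in> A" "e \<le> 1" "rot (2 * n) y e = C_start i" by (rule arc_in_C[OF y])
  let ?p = "C_start i"
  have p: "?p \<in> {1..2 * n}" by (rule C_start_in[OF i(1)])
  have px: "rot (2 * n) ?p (1 - e + s) = rot (2 * n) x s" if "s \<le> n - 3" for s
  proof -
    have "rot (2 * n) ?p (1 - e + s) = rot (2 * n) y (e + (1 - e + s))"
      unfolding i(3)[symmetric] using y that i(2) n by (intro rot_rot) auto
    also have "\<dots> = rot (2 * n) x s" using yx[of "1 + s"] that i(2) n by auto
    finally show ?thesis .
  qed
  obtain b where b: "b \<in> S" "b \<notin> C i" using S(1)[OF i(1)] by blast
  then have "b \<in> {1..2 * n}" using S(2) by blast
  with p obtain t\<^sub>b where tb: "t\<^sub>b < 2 * n" "b = rot (2 * n) ?p t\<^sub>b" by (rule rot_surj)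
  have C_iff: "rot (2 * n) ?p s \<in> C i \<longleftrightarrow> s < n - 1" if "s < 2 * n" for s
    unfolding C_def using p that by (intro rot_in_arc_iff) auto
  have tb': "n - 1 \<le> t\<^sub>b" using C_iff[OF tb(1)] b(2) tb(2) by auto
  have x0: "rot (2 * n) x 0 = x" using x by (simp add: rot_def)
  define a c d where "a = rot (2 * n) ?p (1 - e + t')" and "c = rot (2 * n) ?p (1 - e)"
    and "d = rot (2 * n) ?p (1 - e + t)"
  have acd: "a = rot (2 * n) x t'" "c = x" "d = rot (2 * n) x t"
    using px[of t'] px[of 0] px[of t] t x0 by (auto simp: a_def c_def d_def)
  have "1 - e < 1 - e + t" "1 - e + t < 1 - e + t'" "1 - e + t' < t\<^sub>b"
    using t tb' n by auto
  from cyc_less_rot[OF p this tb(1)]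
  have "cyc_less a a b" "cyc_less a b c" "cyc_less a c d" by (auto simp: a_def c_def d_def tb(2))
  moreover have "a \<in> C i" "c \<in> C i"
    using C_iff[of "1 - e + t'"] C_iff[of "1 - e"] t n by (auto simp: a_def c_def)
  moreover have "a \<in> {1..2 * n}" "c \<in> {1..2 * n}" "d \<in> {1..2 * n}"
    using subsets(2)[of i] \<open>a \<in> C i\<close> \<open>c \<in> C i\<close> S(2) pat(2) acd by auto
  ultimately have "crosses (2 * n) (C i) S"
    unfolding crosses_def using b acd pat \<open>b \<in> {1..2 * n}\<close> by blast
  with i(1) show ?thesis by blast
qed

text \<open>In a set that is not crossed by any \<open>C i\<close>, every gap is followed by a run of \<open>n - 3\<close> elements. As
  \<open>2 (n - 3) > n\<close>, there is only one run, and a cyclic interval of length \<open>n\<close> contains some \<open>C i\<close>.\<close>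

lemma crossing_of_card_eq:
  assumes S: "S \<subseteq> {1..2 * n}" "card S = n" and S2: "\<And>i. i \<in> A \<Longrightarrow> 2 \<le> card (S - C i)"
  shows "\<exists>i\<in>A. crosses (2 * n) (C i) S"
proof (rule ccontr)
  assume nc: "\<not> ?thesis"
  have notsub: "\<not> S \<subseteq> C i" if "i \<in> A" for i
  proof
    assume "S \<subseteq> C i"
    then have "S - C i = {}" by blast
    with S2[OF that] show False by simp
  qed
  have pattern: "rot (2 * n) y t' \<in> S"
    if "y \<in> {1..2 * n}" "0 < t" "t < t'" "t' \<le> n - 3" "y \<notin> S" "rot (2 * n) y t \<in> S" for y t t'
    using crossing_of_pattern[OF notsub S(1) that(1-6)] nc by blast
  have finS: "finite S" using S(1) by (rule finite_subset) simp
  obtain x\<^sub>0 where x0: "x\<^sub>0 \<in> {1..2 * n}" "x\<^sub>0 \<notin> S"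
  proof -
    have "\<not> {1..2 * n} \<subseteq> S" using card_mono[OF finS, of "{1..2 * n}"] S(2) n by auto
    with that show ?thesis by blast
  qed
  obtain s where s: "s \<in> S" using S(2) n by fastforce
  with S(1) have "s \<in> {1..2 * n}" by blast
  with x0(1) obtain u where u: "u < 2 * n" "s = rot (2 * n) x\<^sub>0 u" by (rule rot_surj)
  define L where "L = (LEAST t. rot (2 * n) x\<^sub>0 t \<in> S)"
  have L: "rot (2 * n) x\<^sub>0 L \<in> S" "L \<le> u"
    unfolding L_def using s u(2) by (auto intro: LeastI Least_le)
  have "rot (2 * n) x\<^sub>0 0 = x\<^sub>0" using x0 by (simp add: rot_def)
  with L(1) x0(2) have "L \<noteq> 0" by metis
  \<comment> \<open>A gap directly before an element of \<open>S\<close>; the set \<open>T\<close>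
    below holds the positions of \<open>S\<close> counted from it.\<close>
  define x where "x = rot (2 * n) x\<^sub>0 (L - 1)"
  have x: "x \<in> {1..2 * n}" unfolding x_def using x0(1) L(2) u(1) by (intro rot_in) auto
  have xS: "x \<notin> S" unfolding x_def using not_less_Least[of "L - 1" "\<lambda>t. rot (2 * n) x\<^sub>0 t \<in> S"] \<open>L \<noteq> 0\<close>
    by (simp add: L_def)
  have x1: "rot (2 * n) x 1 \<in> S"
    unfolding x_def using rot_rot[OF x0(1), of "L - 1" 1] \<open>L \<noteq> 0\<close> L u(1) by simp
  define T where "T = {t \<in> {1..2 * n}. rot (2 * n) x t \<in> S}"
  have finT: "finite T" by (simp add: T_def)
  have rot_x: "rot (2 * n) x ` T = S"
  proof
    show "rot (2 * n) x ` T \<subseteq> S" by (auto simp: T_def)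
    show "S \<subseteq> rot (2 * n) x ` T"
    proof
      fix y assume y: "y \<in> S"
      with S(1) have "y \<in> {1..2 * n}" by blast
      with x obtain t where t: "t < 2 * n" "y = rot (2 * n) x t" by (rule rot_surj)
      have "t \<noteq> 0"
      proof
        assume "t = 0"
        with t x have "y = x" by (simp add: rot_def)
        with y xS show False by simp
      qed
      with t y show "y \<in> rot (2 * n) x ` T" by (auto simp: T_def)
    qed
  qed
  have "T \<subseteq> {1..<1 + 2 * n}" by (auto simp: T_def)
  then have "inj_on (rot (2 * n) x) T" using inj_on_rot inj_on_subset by blast
  then have cardT: "card T = n" using rot_x S(2) card_image by fastforce
  have last: "2 * n \<notin> T" using x xS by (auto simp: T_def rot_def)
  have init: "{1..n - 3} \<subseteq> T"
  proof
    fix t assume t: "t \<in> {1..n - 3}"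
    with pattern[OF x, of 1 t] xS x1 show "t \<in> T" by (cases "t = 1") (auto simp: T_def)
  qed
  have down: "y - 1 \<in> T" if y: "y \<in> T" "2 \<le> y" for y
  proof (rule ccontr)
    assume y1: "y - 1 \<notin> T"
    define v where "v = rot (2 * n) x (y - 1)"
    have y2n: "y \<le> 2 * n" using y(1) by (auto simp: T_def)
    have v: "v \<in> {1..2 * n}" "v \<notin> S"
      using rot_in[OF x, of "y - 1"] y1 y y2n by (auto simp: v_def T_def)
    have vr: "rot (2 * n) v r = rot (2 * n) x (y - 1 + r)" if "y - 1 + r \<le> 2 * n" for r
      unfolding v_def using rot_rot[OF x that] .
    have v1: "rot (2 * n) v 1 \<in> S" using vr[of 1] y y2n by (auto simp: T_def)
    have run: "y - 1 + r \<in> T" if "1 \<le> r" "r \<le> n - 3" "y - 1 + r \<le> 2 * n" for r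
      using pattern[OF v(1), of 1 r] v(2) v1 vr[OF that(3)] that y(2) by (cases "r = 1") (auto simp: T_def)
    \<comment> \<open>Position \<open>2 * n\<close> is \<open>x\<close> again and not in
      \<open>S\<close>, so the run ends before it and is not shortened by wrapping around.\<close>
    have "y - 1 + (n - 3) < 2 * n"
    proof (rule ccontr)
      assume "\<not> ?thesis"
      moreover define r where "r = 2 * n - (y - 1)"
      ultimately have r: "1 \<le> r" "r \<le> n - 3" "y - 1 + r = 2 * n"
        using y(2) y2n n by linarith+
      then have "y - 1 + r \<in> T" by (intro run) simp_all
      then show False unfolding r(3) using last by simp
    qed
    then have run2: "(\<lambda>r. y - 1 + r) ` {1..n - 3} \<subseteq> T"
      by (intro image_subsetI run) simp_all
    have "n - 3 < y - 1"
    proof (rule ccontr)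
      assume "\<not> ?thesis"
      with y(2) have "y - 1 \<in> {1..n - 3}" by simp
      with init y1 show False by blast
    qed
    then have "{1..n - 3} \<inter> (\<lambda>r. y - 1 + r) ` {1..n - 3} = {}" by auto
    then have "card ({1..n - 3} \<union> (\<lambda>r. y - 1 + r) ` {1..n - 3}) = (n - 3) + (n - 3)"
      by (subst card_Un_disjoint) (auto simp: card_image)
    moreover have "card ({1..n - 3} \<union> (\<lambda>r. y - 1 + r) ` {1..n - 3}) \<le> card T"
      using init run2 by (intro card_mono finT) auto
    ultimately show False using cardT n by simp
  qed
  have below: "{1..y} \<subseteq> T" if "y \<in> T" for y
    using that
  proof (induction y)
    case (Suc y)
    show ?case
    proof (cases "y = 0")
      case False
      with down[OF Suc.prems] Suc have "{1..y} \<subseteq> T" by auto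
      with Suc.prems show ?thesis by (auto simp: le_Suc_eq)
    qed (use Suc.prems in auto)
  qed simp
  have "T \<subseteq> {1..n}"
  proof
    fix y assume y: "y \<in> T"
    have "card {1..y} \<le> card T" using below[OF y] by (intro card_mono finT)
    with cardT y show "y \<in> {1..n}" by (auto simp: T_def)
  qed
  then have T: "T = {1..n}" using cardT card_subset_eq[of "{1..n}" T] by auto
  have "rot (2 * n) x 1 \<in> {1..2 * n}" using x1 S(1) by blast
  \<comment> \<open>\<open>S\<close> occupies the positions 1 to \<open>n\<close>. Some complement
    starts at position 1 or 2, and its \<open>n - 1\<close> points end at position \<open>n\<close>
    at the latest.\<close>
  then obtain i e where i: "i \<in> A" "e \<le> 1" "rot (2 * n) (rot (2 * n) x 1) e = C_start i"
    by (rule arc_in_C)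
  have start: "C_start i = rot (2 * n) x (1 + e)"
    unfolding i(3)[symmetric] using x i(2) n by (intro rot_rot) auto
  have "C i \<subseteq> S"
  proof
    fix y assume "y \<in> C i"
    then obtain r where r: "r < n - 1" "y = rot (2 * n) (C_start i) r"
      unfolding C_def using arc_eq_rot_image[OF C_start_in[OF i(1)], of "n - 1"] by auto
    have "y = rot (2 * n) x (1 + e + r)"
      unfolding r(2) start using x i(2) r(1) by (intro rot_rot) auto
    moreover have "1 + e + r \<in> T" using i(2) r(1) T by auto
    ultimately show "y \<in> S" using rot_x by blast
  qed
  then have "card (S - C i) = n - (n - 1)" using S(2) card_C[OF i(1)] by (simp add: card_Diff_subset)
  with S2[OF i(1)] n show False by simp
qed

theorem minimal_presentation_crossing:
  assumes "minimal_presentation {1..2 * n} bases Ss"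
  shows "\<not> noncrossing (2 * n) Ss"
proof -
  have pres: "presentation {1..2 * n} bases Ss"
    and min: "\<And>Ss' Ts. presentation {1..2 * n} bases Ss' \<Longrightarrow> mset Ts = mset Ss' \<Longrightarrow>
      list_all2 (\<subseteq>) Ts Ss \<Longrightarrow> mset Ss' = mset Ss"
    using assms unfolding minimal_presentation_def by blast+
  obtain f z where arr: "arranged Ss f z" by (rule presentation_arranged[OF pres])
  then have len: "length Ss = n + 1" "z < n + 1" and Sf: "\<And>i. i \<in> A \<Longrightarrow> f i < n + 1 \<and> f i \<noteq> z \<and> Ss ! f i = C i"
    by (auto simp: arranged_def bij_betw_def)
  have S: "valid (Ss ! z)" by (rule valid_of_presentation[OF pres arr])
  have "card (Ss ! z) \<le> n"
  proof (rule ccontr)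
    assume "\<not> ?thesis"
    then have "n < card (Ss ! z)" by simp
    then obtain y where y: "y \<in> Ss ! z" "valid (Ss ! z - {y})" by (rule valid_remove[OF S])
    let ?Ss' = "Ss[z := Ss ! z - {y}]"
    have "arranged ?Ss' f z" using arr by (auto simp: arranged_def bij_betw_def nth_list_update)
    then have "presentation {1..2 * n} bases ?Ss'"
      by (rule presentation_of_valid) (use y len in simp)
    moreover have "list_all2 (\<subseteq>) ?Ss' Ss"
      using len by (auto simp: list_all2_conv_all_nth nth_list_update split: if_splits)
    ultimately have "mset ?Ss' = mset Ss" using min by blast
    then have "mset Ss - {#Ss ! z#} + {#Ss ! z - {y}#} = mset Ss"
      using len by (simp add: mset_update)
    also have "\<dots> = mset Ss - {#Ss ! z#} + {#Ss ! z#}" using len by simp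
    finally have "Ss ! z - {y} = Ss ! z" unfolding add_left_cancel single_eq_single .
    with y(1) show False by blast
  qed
  with S have "\<exists>i\<in>A. crosses (2 * n) (C i) (Ss ! z)"
    by (intro crossing_of_card_eq) (auto simp: valid_def)
  then show ?thesis using Sf len unfolding noncrossing_def by metis
qed

end

theorem theorem5p1:
  fixes n :: nat and A :: "nat set" and D :: filling
    and w :: "vertex \<times> vertex \<Rightarrow> real" and Bs :: "nat set set"
  assumes "n > 6"
    and "A = {2 * i + 1 | i. i < n}"
    and "D = D_diagram (n + 1) (2 * n) A"
    and "\<And>e. e \<in> left_edges (n + 1) (2 * n - (n + 1)) D \<Longrightarrow> w e > 0"
    and "Bs = positroid_bases (n + 1) (2 * n) D w"
  shows "sparse_paving (n + 1) {1..2 * n} Bs \<and>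
    transversal_matroid {1..2 * n} Bs \<and>
    \<not> (\<exists>Ss. minimal_presentation {1..2 * n} Bs Ss \<and> noncrossing (2 * n) Ss)"
proof -
  interpret O: odd_arcs n using assms(1) by unfold_locales simp
  have A: "A = O.A" unfolding assms(2) O.A_def by (auto elim!: oddE)
  interpret P: le_positroid "n + 1" "2 * n" A w
  proof
    show "A \<subseteq> {1..2 * n}" "1 \<in> A" "2 * n \<notin> A" using assms(1) by (auto simp: A O.A_def)
    show "Suc l \<notin> A" if "l \<in> A" for l using that by (auto simp: A O.A_def)
    show "0 < w e" if "e \<in> left_edges (n + 1) (2 * n - (n + 1)) (D_diagram (n + 1) (2 * n) A)" for e
      using that assms(3,4) by simp
  qed (use assms(1) in auto)
  have "Bs = {I. I \<subseteq> {1..2 * n} \<and> card I = n + 1 \<and> (\<forall>l\<in>A. I \<noteq> arc (2 * n) l (n + 1))}"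
    unfolding assms(5) assms(3) by (rule P.positroid_bases_D)
  also have "\<dots> = O.bases" unfolding O.bases_def O.H_def A by auto
  finally have "Bs = O.bases" .
  then show ?thesis
    using O.sparse_paving_bases O.transversal_bases O.minimal_presentation_crossing by blast
qed

end
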